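(* Let $n\ge m\ge 1$. Let $G$ be a finite nonabelian $2$-group with a central subgroup $N\cong\mathbb{Z}_{2^n}\times\mathbb{Z}_{2^m}$ such that $G/N$ is an elementary abelian $2$-group, and with $G'=\langle c\rangle\cong\mathbb{Z}_2$. Suppose that the center of $G$ is $$\zeta G=\langle z_1\rangle\times\langle z_2\rangle\times\cdots\times\langle z_r\rangle\cong\mathbb{Z}_{2^{n+1}}\times\mathbb{Z}_{2^m}\times\underbrace{\mathbb{Z}_2\times\cdots\times\mathbb{Z}_2}_{r-2},\qquad N=\langle z_1^2\rangle\times\langle z_2\rangle$$ (with $|z_1|=2^{n+1}$, $|z_2|=2^m$), and that $c\in\langle z_2\rangle$. Then $G$ is isomorphic to one of the following groups, for an integer $k$ in the indicated range, where $\mathbb{Z}_2^{(r-2)}$ is the direct product of $r-2$ copies of $\mathbb{Z}_2$: (i) $\bigl(M_2(m+1,1)\mathbin{\mathsf Y}D_8^{\mathsf Y(k-1)}\bigr)\times\mathbb{Z}_{2^{n+1}}\times\mathbb{Z}_2^{(r-2)}$, $k\ge1$; (ii) $\bigl(M_2(m+1,1)\mathbin{\mathsf Y}Q_8\mathbin{\mathsf Y}D_8^{\mathsf Y(k-2)}\bigr)\times\mathbb{Z}_{2^{n+1}}\times\mathbb{Z}_2^{(r-2)}$, $k\ge2$; (iii) $\bigl(D_8^{\mathsf Y k}\mathbin{\mathsf Y}\mathbb{Z}_{2^m}\bigr)\times\mathbb{Z}_{2^{n+1}}\times\mathbb{Z}_2^{(r-2)}$, $k\ge1$; (iv) $\bigl(Q_8\mathbin{\mathsf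 Y}D_8^{\mathsf Y(k-1)}\mathbin{\mathsf Y}\mathbb{Z}_{2^m}\bigr)\times\mathbb{Z}_{2^{n+1}}\times\mathbb{Z}_2^{(r-2)}$, $k\ge1$.
   Context: $D_8$, $Q_8$ are the dihedral and quaternion groups of order $8$. $M_2(u,v)=\langle a,b\mid a^{2^u}=b^{2^v}=1,\ a^b=a^{1+2^{u-1}}\rangle$ for $u\ge2$, $v\ge1$. $H\mathbin{\mathsf Y}K$ denotes the central product (a group $HK$ with $[H,K]=1$). In all the central products listed, the derived subgroups (of order $2$) of the nonabelian factors and the unique subgroup of order $2$ of a cyclic central factor are all identified with one common subgroup $\langle c\rangle$ of order $2$, and factors intersect exactly in $\langle c\rangle$. $D_8^{\mathsf Y j}$ is the central product of $j$ copies of $D_8$ (omitted if $j=0$). *)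

theory Defs
  imports "HOL-Algebra.Algebra"
begin

section \<open>Groups given by generators and relations\<close>

text \<open>A letter \<open>(x, False)\<close> stands for the generator \<open>x\<close> and \<open>(x, True)\<close> for its formal inverse.\<close>

type_synonym 'x gword = "('x \<times> bool) list"

definition gen :: "'x \<Rightarrow> 'x gword"
  where "gen x = [(x, False)]"

definition inv_word :: "'x gword \<Rightarrow> 'x gword"
  where "inv_word w = rev (map (\<lambda>(x, e). (x, \<not> e)) w)"

definition pow_word :: "'x gword \<Rightarrow> nat \<Rightarrow> 'x gword"
  where "pow_word w n = concat (replicate n w)"

text \<open>
  \<open>word_eq S R\<close> is the least congruence on words which cancels adjacent mutually inverse letters
  and kills every relator in \<open>R\<close>; the quotient of the words over \<open>S\<close> by it is
  the group \<open>\<langle>S | r = 1 (r \<in> R)\<rangle>\<close>.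
\<close>

inductive word_eq :: "'x set \<Rightarrow> 'x gword set \<Rightarrow> 'x gword \<Rightarrow> 'x gword \<Rightarrow> bool"
  for S :: "'x set" and R :: "'x gword set"
  where
    refl: "word_eq S R w w"
  | sym: "word_eq S R v w \<Longrightarrow> word_eq S R w v"
  | trans: "word_eq S R u v \<Longrightarrow> word_eq S R v w \<Longrightarrow> word_eq S R u w"
  | cancel: "x \<in> S \<Longrightarrow> word_eq S R (u @ [(x, e), (x, \<not> e)] @ v) (u @ v)"
  | relator: "r \<in> R \<Longrightarrow> word_eq S R (u @ r @ v) (u @ v)"

definition word_class :: "'x set \<Rightarrow> 'x gword set \<Rightarrow> 'x gword \<Rightarrow> 'x gword set"
  where "word_class S R w = {v. word_eq S R w v}"

definition presented_group :: "'x set \<Rightarrow> 'x gword set \<Rightarrow> 'x gword set monoid"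
  where "presented_group S R =
    \<lparr>carrier = word_class S R ` lists (S \<times> UNIV),
     monoid.mult = (\<lambda>A B. {w. \<exists>u\<in>A. \<exists>v\<in>B. word_eq S R (u @ v) w}),
     one = word_class S R []\<rparr>"

lemma word_eq_append_left: "word_eq S R v w \<Longrightarrow> word_eq S R (u @ v) (u @ w)"
proof (induction rule: word_eq.induct)
  case (cancel x p e v)
  then show ?case using word_eq.cancel[of x S R "u @ p" e v] by simp
next
  case (relator r p v)
  then show ?case using word_eq.relator[of r R S "u @ p" v] by simp
qed (auto intro: word_eq.refl word_eq.sym word_eq.trans)

lemma word_eq_append_right: "word_eq S R v w \<Longrightarrow> word_eq S R (v @ u) (w @ u)"
proof (induction rule: word_eq.induct)
  case (cancel x p e v)
  then show ?case using word_eq.cancel[of x S R p e "v @ u"] by simp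
next
  case (relator r p v)
  then show ?case using word_eq.relator[of r R S p "v @ u"] by simp
qed (auto intro: word_eq.refl word_eq.sym word_eq.trans)

lemma word_eq_append: "word_eq S R u u' \<Longrightarrow> word_eq S R v v' \<Longrightarrow> word_eq S R (u @ v) (u' @ v')"
  by (blast intro: word_eq.trans word_eq_append_left word_eq_append_right)

lemma word_class_eq_iff: "word_class S R v = word_class S R w \<longleftrightarrow> word_eq S R v w"
  unfolding word_class_def by (auto intro: word_eq.refl word_eq.sym word_eq.trans)

lemma mult_presented_group:
  "word_class S R u \<otimes>\<^bsub>presented_group S R\<^esub> word_class S R v = word_class S R (u @ v)"
  unfolding presented_group_def word_class_def
  by (auto intro: word_eq.refl word_eq.sym word_eq.trans word_eq_append)

lemma word_eq_inv_word:
  assumes "w \<in> lists (S \<times> UNIV)"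
  shows "word_eq S R (inv_word w @ w) []"
  using assms
proof (induction w rule: list.induct)
  case Nil
  then show ?case by (simp add: inv_word_def word_eq.refl)
next
  case (Cons l w)
  obtain x e where l: "l = (x, e)" by force
  then have "x \<in> S" using Cons.prems by auto
  then have "word_eq S R (inv_word w @ [(x, \<not> e), (x, \<not> \<not> e)] @ w) (inv_word w @ w)"
    by (rule word_eq.cancel)
  then show ?case using Cons l by (auto simp: inv_word_def intro: word_eq.trans)
qed

lemma group_presented_group: "group (presented_group S R)"
proof (rule groupI)
  show "\<one>\<^bsub>presented_group S R\<^esub> \<in> carrier (presented_group S R)"
    by (auto simp: presented_group_def)
next
  fix A B assume "A \<in> carrier (presented_group S R)" "B \<in> carrier (presented_group S R)"
  then obtain u v where uv: "A = word_class S R u" "B = word_class S R v"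
      "u @ v \<in> lists (S \<times> UNIV)"
    by (auto simp: presented_group_def)
  show "A \<otimes>\<^bsub>presented_group S R\<^esub> B \<in> carrier (presented_group S R)"
    unfolding uv(1,2) mult_presented_group using uv(3) by (auto simp: presented_group_def)
next
  fix A B C
  assume "A \<in> carrier (presented_group S R)" "B \<in> carrier (presented_group S R)"
    "C \<in> carrier (presented_group S R)"
  then obtain u v w
    where "A = word_class S R u" "B = word_class S R v" "C = word_class S R w"
    by (auto simp: presented_group_def)
  then show "A \<otimes>\<^bsub>presented_group S R\<^esub> B \<otimes>\<^bsub>presented_group S R\<^esub> C
      = A \<otimes>\<^bsub>presented_group S R\<^esub> (B \<otimes>\<^bsub>presented_group S R\<^esub> C)"
    by (simp add: mult_presented_group)
next
  fix A assume "A \<in> carrier (presented_group S R)"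
  then obtain u where u: "A = word_class S R u" "u \<in> lists (S \<times> UNIV)"
    by (auto simp: presented_group_def)
  have one: "\<one>\<^bsub>presented_group S R\<^esub> = word_class S R []"
    by (simp add: presented_group_def)
  show "\<one>\<^bsub>presented_group S R\<^esub> \<otimes>\<^bsub>presented_group S R\<^esub> A = A"
    by (simp add: one u mult_presented_group)
  have "inv_word u \<in> lists (S \<times> UNIV)"
    using u(2) by (fastforce simp: inv_word_def in_lists_conv_set)
  moreover have "word_class S R (inv_word u) \<otimes>\<^bsub>presented_group S R\<^esub> A
      = \<one>\<^bsub>presented_group S R\<^esub>"
    by (simp add: one u mult_presented_group word_class_eq_iff word_eq_inv_word)
  ultimately show "\<exists>B\<in>carrier (presented_group S R).
      B \<otimes>\<^bsub>presented_group S R\<^esub> A = \<one>\<^bsub>presented_group S R\<^esub>"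
    by (auto simp: presented_group_def)
qed

text \<open>
  In the two-generator presentations \<open>a\<close> is the generator \<open>0\<close> and \<open>b\<close> is the generator \<open>1\<close>;
  \<open>a^b\<close> means \<open>b\<inverse> a b\<close>, and a relation \<open>s = t\<close> is entered as the relator \<open>s t\<inverse>\<close>.
\<close>

definition conj_word :: "'x gword \<Rightarrow> 'x gword \<Rightarrow> 'x gword"
  where "conj_word a b = inv_word b @ a @ b"

definition M2_group :: "nat \<Rightarrow> nat \<Rightarrow> nat gword set monoid"
  where "M2_group u v = (let a = gen 0; b = gen 1 in
    presented_group {0, 1}
      {pow_word a (2 ^ u), pow_word b (2 ^ v),
       conj_word a b @ inv_word (pow_word a (1 + 2 ^ (u - 1)))})"

text \<open>\<open>D\<^sub>8 = \<langle>a, b | a\<^sup>4 = b\<^sup>2 = 1, a^b = a\<inverse>\<rangle>\<close> and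
  \<open>Q\<^sub>8 = \<langle>a, b | a\<^sup>4 = 1, b\<^sup>2 = a\<^sup>2, a^b = a\<inverse>\<rangle>\<close>.\<close>

definition D8_group :: "nat gword set monoid"
  where "D8_group = (let a = gen 0; b = gen 1 in
    presented_group {0, 1}
      {pow_word a 4, pow_word b 2, conj_word a b @ inv_word (inv_word a)})"

definition Q8_group :: "nat gword set monoid"
  where "Q8_group = (let a = gen 0; b = gen 1 in
    presented_group {0, 1}
      {pow_word a 4, pow_word b 2 @ inv_word (pow_word a 2), conj_word a b @ inv_word (inv_word a)})"

text \<open>
  The cyclic group \<open>\<langle>a | a\<^sup>q = 1\<rangle>\<close>. It is isomorphic to \<^const>\<open>integer_mod_group\<close>
  (lemma \<open>cyclic_presented_iso\<close> below), but lives on the same type as the other factors of the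
  central products.
\<close>

definition cyclic_presented :: "nat \<Rightarrow> nat gword set monoid"
  where "cyclic_presented q = presented_group {0} {pow_word (gen 0) q}"

definition exponent_sum :: "'x gword \<Rightarrow> int"
  where "exponent_sum w = (\<Sum>(x, e)\<leftarrow>w. if e then -1 else 1)"

lemma exponent_sum_append: "exponent_sum (u @ v) = exponent_sum u + exponent_sum v"
  by (simp add: exponent_sum_def)

lemma pow_word_gen: "pow_word (gen x) n = replicate n (x, False)"
  by (induction n) (auto simp: pow_word_def gen_def)

lemma exponent_sum_pow_word: "exponent_sum (pow_word (gen x) n) = int n"
  by (induction n) (auto simp: pow_word_gen exponent_sum_def)

lemma word_eq_exponent_sum:
  "word_eq S {pow_word (gen x) q} v w \<Longrightarrow> exponent_sum v mod int q = exponent_sum w mod int q"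
proof (induction rule: word_eq.induct)
  case (cancel y u e v)
  have "exponent_sum [(y, e), (y, \<not> e)] = 0" by (simp add: exponent_sum_def)
  then show ?case by (simp only: exponent_sum_append) simp
next
  case (relator r u v)
  then have "exponent_sum (u @ r @ v) = exponent_sum (u @ v) + int q"
    by (simp add: exponent_sum_append exponent_sum_pow_word)
  then show ?case by simp
qed simp_all

lemma word_eq_cyclic_normal_form:
  fixes x :: 'x
  assumes q: "q > 0" and "w \<in> lists ({x} \<times> UNIV)"
  shows "\<exists>k<q. word_eq {x} {pow_word (gen x) q} w (pow_word (gen x) k)"
  using assms(2)
proof (induction w rule: list.induct)
  case Nil
  show ?case using q by (intro exI[of _ 0]) (auto simp: pow_word_def intro: word_eq.refl)
next
  case (Cons l w)
  let ?R = "{pow_word (gen x) q}"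
  obtain e where l: "l = (x, e)" using Cons.prems by (cases l) auto
  obtain k where k: "k < q" "word_eq {x} ?R w (pow_word (gen x) k)"
    using Cons by auto
  have lw: "word_eq {x} ?R (l # w) ([(x, e)] @ replicate k (x, False))"
    using word_eq_append_left[OF k(2), of "[(x, e)]"] by (simp add: l pow_word_gen)
  have rel: "word_eq {x} ?R (u @ replicate q (x, False)) u" for u
    using word_eq.relator[of "pow_word (gen x) q" ?R "{x}" u "[]"] by (simp add: pow_word_gen)
  show ?case
  proof (cases e)
    case False
    then have lw': "word_eq {x} ?R (l # w) (replicate (Suc k) (x, False))" using lw by simp
    show ?thesis
    proof (cases "Suc k = q")
      case True
      then have "word_eq {x} ?R (l # w) (pow_word (gen x) 0)"
        using word_eq.trans[OF lw'] rel[of "[]"] by (simp add: pow_word_def)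
      then show ?thesis using q by blast
    next
      case False
      then show ?thesis using lw' k(1) by (intro exI[of _ "Suc k"]) (simp add: pow_word_gen)
    qed
  next
    case True
    have canc: "word_eq {x} ?R ([(x, True)] @ replicate (Suc j) (x, False)) (replicate j (x, False))"
      for j
      using word_eq.cancel[of x "{x}" ?R "[]" True "replicate j (x, False)"] by simp
    show ?thesis
    proof (cases k)
      case 0
      obtain p where p: "q = Suc p" using q by (cases q) auto
      have "word_eq {x} ?R (l # w) [(x, True)]" using lw True 0 by simp
      moreover have "word_eq {x} ?R [(x, True)] ([(x, True)] @ replicate q (x, False))"
        by (rule word_eq.sym[OF rel])
      moreover have "word_eq {x} ?R ([(x, True)] @ replicate q (x, False)) (replicate p (x, False))"
        using canc[of p] by (simp add: p)
      ultimately have "word_eq {x} ?R (l # w) (replicate p (x, False))"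
        by (blast intro: word_eq.trans)
      then show ?thesis using p by (intro exI[of _ p]) (simp add: pow_word_gen)
    next
      case (Suc j)
      then have "word_eq {x} ?R (l # w) (replicate j (x, False))"
        using word_eq.trans[OF lw] canc[of j] True by simp
      then show ?thesis using Suc k(1) by (intro exI[of _ j]) (simp add: pow_word_gen)
    qed
  qed
qed

lemma cyclic_presented_iso:
  assumes q: "q > 0"
  shows "integer_mod_group q \<cong> cyclic_presented q"
proof -
  let ?R = "{pow_word (gen (0::nat)) q}"
  let ?h = "\<lambda>i. word_class {0} ?R (pow_word (gen 0) (nat i))"
  have car: "carrier (cyclic_presented q) = word_class {0} ?R ` lists ({0} \<times> UNIV)"
    by (simp add: cyclic_presented_def presented_group_def)
  have Z: "carrier (integer_mod_group q) = {0..<int q}"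
    using q by (simp add: carrier_integer_mod_group)
  have words: "pow_word (gen (0::nat)) k \<in> lists ({0} \<times> UNIV)" for k
    by (auto simp: pow_word_gen)
  have eq: "j = k" if "word_eq {0} ?R (pow_word (gen 0) j) (pow_word (gen 0) k)" "j < q" "k < q" for j k
    using word_eq_exponent_sum[OF that(1)] that(2,3) by (simp add: exponent_sum_pow_word)
  have "?h \<in> hom (integer_mod_group q) (cyclic_presented q)"
  proof (rule homI)
    fix i assume "i \<in> carrier (integer_mod_group q)"
    show "?h i \<in> carrier (cyclic_presented q)" using words car by blast
  next
    fix i j assume "i \<in> carrier (integer_mod_group q)" "j \<in> carrier (integer_mod_group q)"
    then have ij: "0 \<le> i" "0 \<le> j" by (auto simp: Z)
    let ?w = "pow_word (gen (0::nat)) (nat i) @ pow_word (gen 0) (nat j)"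
    have w: "?w \<in> lists ({0} \<times> UNIV)" using words by simp
    obtain k where k: "k < q" "word_eq {0} ?R ?w (pow_word (gen 0) k)"
      using word_eq_cyclic_normal_form[OF q w] by auto
    have "(i + j) mod int q = int k"
      using word_eq_exponent_sum[OF k(2)] k(1) ij
      by (simp add: exponent_sum_append exponent_sum_pow_word)
    then show "?h (i \<otimes>\<^bsub>integer_mod_group q\<^esub> j) = ?h i \<otimes>\<^bsub>cyclic_presented q\<^esub> ?h j"
      using word_eq.sym[OF k(2)]
      by (simp add: cyclic_presented_def mult_presented_group word_class_eq_iff)
  qed
  moreover have "bij_betw ?h (carrier (integer_mod_group q)) (carrier (cyclic_presented q))"
  proof (rule bij_betw_imageI)
    show "inj_on ?h (carrier (integer_mod_group q))"
    proof (rule inj_onI)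
      fix i j assume ij: "i \<in> carrier (integer_mod_group q)" "j \<in> carrier (integer_mod_group q)"
        and "?h i = ?h j"
      then have "nat i = nat j" using eq[of "nat i" "nat j"] by (auto simp: Z word_class_eq_iff)
      then show "i = j" using ij by (auto simp: Z)
    qed
    have "A \<in> ?h ` {0..<int q}" if A: "A \<in> carrier (cyclic_presented q)" for A
    proof -
      obtain w where w: "w \<in> lists ({0} \<times> UNIV)" "A = word_class {0} ?R w" using A car by auto
      obtain k where k: "k < q" "word_eq {0} ?R w (pow_word (gen 0) k)"
        using word_eq_cyclic_normal_form[OF q w(1)] by blast
      then have "A = ?h (int k)" by (simp add: w word_class_eq_iff)
      moreover have "int k \<in> {0..<int q}" using k(1) by simp
      ultimately show ?thesis by (rule image_eqI)
    qed
    then show "?h ` carrier (integer_mod_group q) = carrier (cyclic_presented q)"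
      using words car by (auto simp: Z)
  qed
  ultimately show ?thesis by (auto simp: is_iso_def intro: isoI)
qed


section \<open>Central products amalgamating a subgroup of order 2\<close>

text \<open>
  The subgroup of a factor to be amalgamated: the derived subgroup of a nonabelian factor, and
  the elements of order at most 2 of an abelian one, which for a cyclic group of even order
  form its unique subgroup of order 2.
\<close>

definition amalgam_subgroup :: "('a, 'b) monoid_scheme \<Rightarrow> 'a set"
  where "amalgam_subgroup H =
    (if comm_group H then {x \<in> carrier H. x \<otimes>\<^bsub>H\<^esub> x = \<one>\<^bsub>H\<^esub>} else derived H (carrier H))"

text \<open>
  The central product of a list of groups, each of whose amalgamated subgroups is central of
  order 2, say \<open>{1, c\<^sub>i}\<close>: the quotient of the direct product by the subgroup generated by the
  elements \<open>c\<^sub>i c\<^sub>j\<close>. That subgroup consists of the tuples of elements of the amalgamated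
  subgroups in which an even number of the \<open>c\<^sub>i\<close> occur.
\<close>

definition central_product :: "('a, 'b) monoid_scheme list \<Rightarrow> (nat \<Rightarrow> 'a) set monoid"
  where "central_product Hs =
    product_group {..<length Hs} (\<lambda>i. Hs ! i) Mod
      {f \<in> (\<Pi>\<^sub>E i\<in>{..<length Hs}. amalgam_subgroup (Hs ! i)).
        even (card {i \<in> {..<length Hs}. f i \<noteq> \<one>\<^bsub>Hs ! i\<^esub>})}"


section \<open>Further group-theoretic notions\<close>

definition group_center :: "('a, 'b) monoid_scheme \<Rightarrow> 'a set"
  where "group_center G = {z \<in> carrier G. \<forall>x\<in>carrier G. z \<otimes>\<^bsub>G\<^esub> x = x \<otimes>\<^bsub>G\<^esub> z}"

definition elementary_abelian :: "nat \<Rightarrow> ('a, 'b) monoid_scheme \<Rightarrow> bool"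
  where "elementary_abelian p H \<longleftrightarrow>
    comm_group H \<and> (\<forall>x\<in>carrier H. x [^]\<^bsub>H\<^esub> p = \<one>\<^bsub>H\<^esub>)"

text \<open>\<open>H\<close> is the internal direct product of the subgroups in the list \<open>As\<close> of \<open>G\<close>.\<close>

definition internal_direct_product :: "('a, 'b) monoid_scheme \<Rightarrow> 'a set \<Rightarrow> 'a set list \<Rightarrow> bool"
  where "internal_direct_product G H As \<longleftrightarrow>
    (\<forall>A\<in>set As. subgroup A G) \<and>
    (\<forall>i<length As. \<forall>j<length As. i \<noteq> j \<longrightarrow>
       (\<forall>x\<in>As ! i. \<forall>y\<in>As ! j. x \<otimes>\<^bsub>G\<^esub> y = y \<otimes>\<^bsub>G\<^esub> x)) \<and>
    (\<forall>i<length As. As ! i \<inter> generate G (\<Union>j\<in>{..<length As} - {i}. As ! j) = {\<one>\<^bsub>G\<^esub>}) \<and>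
    H = generate G (\<Union>(set As))"

abbreviation cyclic_power :: "nat \<Rightarrow> nat \<Rightarrow> (nat \<Rightarrow> int) monoid"
  where "cyclic_power q s \<equiv> product_group {..<s} (\<lambda>_. integer_mod_group q)"

end

theory Submission
  imports Defs
begin

text \<open>
  Commutators induce a nondegenerate alternating form on \<open>G/\<zeta>G\<close> with values in \<open>\<langle>c\<rangle>\<close>, and
  every square is \<open>u\<^sup>2\<close> or \<open>u\<^sup>2 z\<^sub>2\<close> for some central \<open>u\<close>. Call the square class of \<open>x\<close>
  trivial if \<open>x\<^sup>2\<close> is the square of a central element. A noncommuting pair with trivial square
  classes can be corrected by central elements so that it generates a \<open>D\<^sub>8\<close>. Split off
  such pairs as long as possible. In the remaining subgroup at most one more pair can be split off,
  because two commuting elements with nontrivial square class have a product with trivial square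
  class, which would lie in a further \<open>D\<^sub>8\<close>. That last pair generates \<open>Q\<^sub>8\<close> if
  \<open>m = 1\<close> (where \<open>z\<^sub>2 = c\<close>) and \<open>M\<^sub>2(m + 1, 1)\<close> if \<open>m > 1\<close> (where \<open>c\<close> is
  a central square), so that family (ii) is never needed. The other central generators
  \<open>z\<^sub>1, z\<^sub>3, \<dots>, z\<^sub>r\<close> split off as a direct factor because \<open>c \<in> \<langle>z\<^sub>2\<rangle>\<close>.
\<close>

text \<open>The commutator form supplies the pairs; the remaining work is to show that nothing
  collapses when the pieces are put back together. A factor given by a presentation has no known
  order, so it is compared with the subgroup <a, b> of G by evaluating words. This is onto. The
  product map from all factors and the complement of <z_2> in the center is handled by one kind of
  relation: if y_0 ... y_(n-1) w = 1 with w central, every y_i is central in its own factor. The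
  argument closes if all these centers are <c> with at most one exception, which may be as large as
  <d>, where d = z_2. In families (iii) and (iv) the exception is the cyclic factor <d>; in (i) it
  is the center <a^2> = <d> of the group of the last pair, and therefore Z_(2^m) does not appear
  beside M_2(m + 1, 1).\<close>

subsection \<open>Splitting off noncommuting pairs\<close>

context group
begin

lemma commute_mult:
  assumes "x \<otimes> a = a \<otimes> x" "y \<otimes> a = a \<otimes> y" "x \<in> carrier G" "y \<in> carrier G" "a \<in> carrier G"
  shows "(x \<otimes> y) \<otimes> a = a \<otimes> (x \<otimes> y)"
proof -
  have "(x \<otimes> y) \<otimes> a = x \<otimes> (a \<otimes> y)" using assms by (simp add: m_assoc)
  also have "\<dots> = (a \<otimes> x) \<otimes> y" using assms by (simp add: m_assoc[symmetric])
  finally show ?thesis using assms by (simp add: m_assoc)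
qed

lemma noncommute_mult_commute:
  assumes "x \<otimes> a \<noteq> a \<otimes> x" "y \<otimes> a = a \<otimes> y"
    and [simp]: "x \<in> carrier G" "y \<in> carrier G" "a \<in> carrier G"
  shows "(x \<otimes> y) \<otimes> a \<noteq> a \<otimes> (x \<otimes> y)"
proof
  assume *: "(x \<otimes> y) \<otimes> a = a \<otimes> (x \<otimes> y)"
  have "(x \<otimes> a) \<otimes> y = (a \<otimes> x) \<otimes> y"
    using * assms(2) by (simp add: m_assoc)
  then show False using assms(1) by simp
qed

lemma square_mult_commute:
  assumes "x \<otimes> y = y \<otimes> x" and [simp]: "x \<in> carrier G" "y \<in> carrier G"
  shows "(x \<otimes> y) \<otimes> (x \<otimes> y) = (x \<otimes> x) \<otimes> (y \<otimes> y)"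
proof -
  have "y \<otimes> (x \<otimes> y) = (x \<otimes> y) \<otimes> y" by (simp add: assms(1) m_assoc)
  then show ?thesis by (simp add: m_assoc)
qed

lemma commute_inv:
  assumes "x \<otimes> y = y \<otimes> x" and [simp]: "x \<in> carrier G" "y \<in> carrier G"
  shows "inv x \<otimes> y = y \<otimes> inv x"
proof -
  have "inv x \<otimes> (x \<otimes> y) \<otimes> inv x = inv x \<otimes> (y \<otimes> x) \<otimes> inv x"
    by (simp only: assms(1))
  moreover have "inv x \<otimes> (x \<otimes> y) \<otimes> inv x = y \<otimes> inv x" by (simp add: m_assoc[symmetric])
  moreover have "inv x \<otimes> (y \<otimes> x) \<otimes> inv x = inv x \<otimes> y" by (simp add: m_assoc)
  ultimately show ?thesis by simp
qed

text \<open>The orthogonal complement of the pair \<open>a\<close>, \<open>b\<close> for the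
  commutator form, taken inside \<open>K\<close>.\<close>

abbreviation commuting_with :: "'a set \<Rightarrow> 'a \<Rightarrow> 'a \<Rightarrow> 'a set"
  where "commuting_with K a b \<equiv> {h \<in> K. h \<otimes> a = a \<otimes> h \<and> h \<otimes> b = b \<otimes> h}"

lemma subgroup_commuting_with:
  assumes "subgroup K G" and [simp]: "a \<in> carrier G" "b \<in> carrier G"
  shows "subgroup (commuting_with K a b) G"
proof (rule subgroupI)
  have K: "K \<subseteq> carrier G" using assms(1) by (rule subgroup.subset)
  then show "commuting_with K a b \<subseteq> carrier G" by auto
  show "commuting_with K a b \<noteq> {}"
    using subgroup.one_closed[OF assms(1)] by (auto intro!: exI[of _ \<one>])
  show "inv x \<in> commuting_with K a b" if "x \<in> commuting_with K a b" for x
  proof -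
    have x: "x \<in> K" "x \<in> carrier G" "x \<otimes> a = a \<otimes> x" "x \<otimes> b = b \<otimes> x" using that K by auto
    show ?thesis using x subgroup.m_inv_closed[OF assms(1)] by (simp add: commute_inv)
  qed
  show "x \<otimes> y \<in> commuting_with K a b"
    if "x \<in> commuting_with K a b" "y \<in> commuting_with K a b" for x y
    using that K subgroup.m_closed[OF assms(1)] by (auto intro!: commute_mult)
qed

lemma commute_generate:
  assumes "y \<in> generate G S" and S: "S \<subseteq> carrier G" "\<And>s. s \<in> S \<Longrightarrow> s \<otimes> x = x \<otimes> s"
    and x: "x \<in> carrier G"
  shows "y \<otimes> x = x \<otimes> y"
  using assms(1)
proof (induction rule: generate.induct)
  case one
  then show ?case using x by simp
next
  case (incl h)
  then show ?case by (rule S(2))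
next
  case (inv h)
  then show ?case using S x by (intro commute_inv) auto
next
  case (eng h1 h2)
  then show ?case using S(1) x by (intro commute_mult) (auto intro: generate_in_carrier)
qed

lemma center_generating:
  assumes x: "x \<in> carrier G" and S: "S \<subseteq> carrier G" "carrier G = generate G S"
    and comm: "\<And>s. s \<in> S \<Longrightarrow> s \<otimes> x = x \<otimes> s"
  shows "x \<in> group_center G"
  unfolding group_center_def using commute_generate[of _ S x, OF _ S(1) comm x] x S(2) by auto

lemma center_in_carrier: "u \<in> group_center G \<Longrightarrow> u \<in> carrier G"
  by (simp add: group_center_def)

lemma center_commute: "u \<in> group_center G \<Longrightarrow> x \<in> carrier G \<Longrightarrow> u \<otimes> x = x \<otimes> u"
  by (simp add: group_center_def)

lemma subgroup_center: "subgroup (group_center G) G"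
proof (rule subgroupI)
  show "group_center G \<subseteq> carrier G" by (auto simp: group_center_def)
  show "group_center G \<noteq> {}" by (auto simp: group_center_def intro!: exI[of _ \<one>])
  show "inv x \<in> group_center G" if "x \<in> group_center G" for x
    using that commute_inv[of x] unfolding group_center_def by blast
  show "x \<otimes> y \<in> group_center G" if "x \<in> group_center G" "y \<in> group_center G" for x y
    using that commute_mult[of x _ y] unfolding group_center_def by blast
qed

text \<open>This is what allows squares to be corrected: a central factor alters x^2 but none of the
  commutators of x.\<close>

lemma commute_center_mult:
  assumes "u \<in> group_center G" and [simp]: "x \<in> carrier G" "y \<in> carrier G"
  shows "(x \<otimes> u) \<otimes> y = y \<otimes> (x \<otimes> u) \<longleftrightarrow> x \<otimes> y = y \<otimes> x"
proof -
  note [simp] = center_in_carrier[OF assms(1)]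
  have uy: "u \<otimes> y = y \<otimes> u" by (rule center_commute[OF assms(1,3)])
  have "(x \<otimes> u) \<otimes> y = x \<otimes> y \<otimes> u" by (simp add: m_assoc uy)
  moreover have "y \<otimes> (x \<otimes> u) = y \<otimes> x \<otimes> u" by (simp add: m_assoc)
  ultimately show ?thesis by simp
qed

end

text \<open>The hypothesis that G' lies in <c>, with c central of order 2, in elementwise form. The
  commutator is then a bilinear form with values in {1, c}; the lemmas below are its rules written
  without commutators.\<close>

locale two_commutator_group = group G for G (structure) +
  fixes c :: 'a
  assumes c_closed [simp, intro]: "c \<in> carrier G"
    and c_commute: "x \<in> carrier G \<Longrightarrow> c \<otimes> x = x \<otimes> c"
    and c_square: "c \<otimes> c = \<one>"
    and c_neq_one: "c \<noteq> \<one>"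
    and commute_or: "x \<in> carrier G \<Longrightarrow> y \<in> carrier G \<Longrightarrow>
      x \<otimes> y = y \<otimes> x \<or> x \<otimes> y = y \<otimes> x \<otimes> c"
begin

lemma noncommute:
  assumes "x \<otimes> y \<noteq> y \<otimes> x" "x \<in> carrier G" "y \<in> carrier G"
  shows "x \<otimes> y = y \<otimes> (x \<otimes> c)"
  using assms commute_or[of x y] by (simp add: m_assoc)

lemma c_left_commute: "x \<in> carrier G \<Longrightarrow> y \<in> carrier G \<Longrightarrow> c \<otimes> (x \<otimes> y) = x \<otimes> (c \<otimes> y)"
  by (simp add: c_commute[of x] m_assoc[symmetric])

text \<open>Bilinearity: x and y each contribute a factor c when moved past a, and c^2 = 1.\<close>

lemma noncommute_mult:
  assumes n: "x \<otimes> a \<noteq> a \<otimes> x" "y \<otimes> a \<noteq> a \<otimes> y"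
    and [simp]: "x \<in> carrier G" "y \<in> carrier G" "a \<in> carrier G"
  shows "(x \<otimes> y) \<otimes> a = a \<otimes> (x \<otimes> y)"
proof -
  have "(x \<otimes> y) \<otimes> a = x \<otimes> (a \<otimes> (y \<otimes> c))"
    using noncommute[OF n(2)] by (simp add: m_assoc)
  also have "\<dots> = a \<otimes> (x \<otimes> c) \<otimes> (y \<otimes> c)"
    using noncommute[OF n(1)] by (simp add: m_assoc[symmetric])
  also have "\<dots> = a \<otimes> (x \<otimes> y)"
    by (simp add: m_assoc c_left_commute[of y] c_square)
  finally show ?thesis .
qed

text \<open>Squaring behaves like a quadratic form whose polar form is the commutator, hence the
  extra \<open>c\<close>.\<close>

lemma square_mult_noncommute:
  assumes n: "x \<otimes> y \<noteq> y \<otimes> x" and [simp]: "x \<in> carrier G" "y \<in> carrier G"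
  shows "(x \<otimes> y) \<otimes> (x \<otimes> y) = (x \<otimes> x) \<otimes> (y \<otimes> y) \<otimes> c"
proof -
  have "y \<otimes> x = x \<otimes> (y \<otimes> c)" using noncommute[of y x] n by simp
  then have "y \<otimes> (x \<otimes> y) = x \<otimes> (y \<otimes> c) \<otimes> y" by (simp add: m_assoc[symmetric])
  then show ?thesis by (simp add: m_assoc c_commute[of y])
qed

text \<open>Orthogonal projection away from the nondegenerate plane spanned by a and b. A factor
  \<open>b\<close> repairs the commutator of k with a; a further factor \<open>a\<close> repairs the
  one with b and leaves the one with a unchanged.\<close>

lemma commuting_with_complement:
  assumes K: "subgroup K G" and ab: "a \<in> K" "b \<in> K" "a \<otimes> b \<noteq> b \<otimes> a" and k: "k \<in> K"
  obtains w where "w \<in> generate G {a, b}" "k \<otimes> w \<in> commuting_with K a b"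
proof -
  have [simp]: "a \<in> carrier G" "b \<in> carrier G" "k \<in> carrier G"
    using K ab k subgroup.subset by blast+
  have mK: "x \<otimes> y \<in> K" if "x \<in> K" "y \<in> K" for x y
    using that K by (rule subgroup.m_closed[rotated])
  obtain w1 where w1: "w1 \<in> {\<one>, b}" "k \<otimes> w1 \<in> K" "(k \<otimes> w1) \<otimes> a = a \<otimes> (k \<otimes> w1)"
  proof (cases "k \<otimes> a = a \<otimes> k")
    case True
    then show ?thesis using that[of \<one>] k by simp
  next
    case False
    then show ?thesis using that[of b] ab k noncommute_mult[of k a b] mK by simp
  qed
  then have c1 [simp]: "w1 \<in> carrier G" "k \<otimes> w1 \<in> carrier G" by auto
  obtain w2 where w2: "w2 \<in> {\<one>, a}" "k \<otimes> w1 \<otimes> w2 \<in> commuting_with K a b"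
  proof (cases "(k \<otimes> w1) \<otimes> b = b \<otimes> (k \<otimes> w1)")
    case True
    then show ?thesis using that[of \<one>] w1 by simp
  next
    case False
    then show ?thesis using that[of a] ab w1 noncommute_mult[of "k \<otimes> w1" b a] mK
      commute_mult[of "k \<otimes> w1" a a] by auto
  qed
  have "w1 \<otimes> w2 \<in> generate G {a, b}"
    using w1(1) w2(1) by (intro generate.eng) (auto intro: generate.one generate.incl)
  moreover have "k \<otimes> (w1 \<otimes> w2) \<in> commuting_with K a b"
    using w2 by (auto simp: m_assoc)
  ultimately show ?thesis by (rule that)
qed

abbreviation commuting_pairs :: "'a \<times> 'a \<Rightarrow> 'a \<times> 'a \<Rightarrow> bool"
  where "commuting_pairs p q \<equiv> (\<forall>x\<in>{fst p, snd p}. \<forall>y\<in>{fst q, snd q}. x \<otimes> y = y \<otimes> x)"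

abbreviation pair_elements :: "('a \<times> 'a) list \<Rightarrow> 'a set"
  where "pair_elements ps \<equiv> (\<Union>p\<in>set ps. {fst p, snd p})"

text \<open>By the projection, each k in K is an element of the centralizer of the pair times an
  element of <a, b>.\<close>

lemma subset_generate_complement:
  assumes K: "subgroup K G" and ab: "a \<in> K" "b \<in> K" "a \<otimes> b \<noteq> b \<otimes> a"
    and sub: "commuting_with K a b \<subseteq> generate G S" "{a, b} \<subseteq> S" "S \<subseteq> carrier G"
  shows "K \<subseteq> generate G S"
proof
  fix k assume k: "k \<in> K"
  obtain w where w: "w \<in> generate G {a, b}" "k \<otimes> w \<in> commuting_with K a b"
    by (rule commuting_with_complement[OF K ab k])
  have S: "subgroup (generate G S) G" by (rule generate_is_subgroup[OF sub(3)])
  have "w \<in> generate G S" using w(1) mono_generate[OF sub(2)] by blast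
  then have "k \<otimes> w \<otimes> inv w \<in> generate G S"
    using S w(2) sub(1) by (meson subgroup.m_closed subgroup.m_inv_closed subsetD)
  moreover have "w \<in> carrier G" "k \<in> carrier G"
    using \<open>w \<in> generate G S\<close> subgroup.subset[OF S] subgroup.subset[OF K] k by auto
  ultimately show "k \<in> generate G S" by (simp add: m_assoc)
qed

text \<open>Induction on the order of K: a good pair does not lie in its own centralizer, which is
  therefore smaller, and the splitting continues there. \<open>L\<close> is what remains when no
  good pair is left. It still contains the center of G, so that its elements can be corrected by
  central factors.\<close>

lemma split_off_pairs:
  assumes fin: "finite (carrier G)"
    and good: "\<forall>a b. good a b \<longrightarrow> a \<otimes> b \<noteq> b \<otimes> a"
    and K: "subgroup K G" "group_center G \<subseteq> K"
  shows "\<exists>ps L. subgroup L G \<and> group_center G \<subseteq> L \<and> L \<subseteq> K \<and> pair_elements ps \<subseteq> K \<and>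
    (\<forall>p\<in>set ps. good (fst p) (snd p)) \<and> sorted_wrt commuting_pairs ps \<and>
    (\<forall>l\<in>L. \<forall>x\<in>pair_elements ps. l \<otimes> x = x \<otimes> l) \<and>
    \<not> (\<exists>a\<in>L. \<exists>b\<in>L. good a b) \<and> K \<subseteq> generate G (pair_elements ps \<union> L)"
  using K
proof (induction "card K" arbitrary: K rule: less_induct)
  case less
  note K = less.prems
  have KG: "K \<subseteq> carrier G" using K(1) by (rule subgroup.subset)
  show ?case
  proof (cases "\<exists>a\<in>K. \<exists>b\<in>K. good a b")
    case False
    then show ?thesis using K by (intro exI[of _ "[]"] exI[of _ K]) (auto intro: generate.incl)
  next
    case True
    then obtain a b where ab: "a \<in> K" "b \<in> K" "good a b" by blast
    let ?K = "commuting_with K a b"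
    have nc: "a \<otimes> b \<noteq> b \<otimes> a" using ab(3) good by blast
    have abG: "a \<in> carrier G" "b \<in> carrier G" using ab KG by auto
    have "?K \<subset> K" using ab(1) nc by auto
    then have card: "card ?K < card K" using finite_subset[OF KG fin] by (simp add: psubset_card_mono)
    have sub: "subgroup ?K G" by (rule subgroup_commuting_with[OF K(1) abG])
    have cen: "group_center G \<subseteq> ?K" using K(2) abG by (auto simp: group_center_def)
    obtain ps L where ps: "subgroup L G" "group_center G \<subseteq> L" "L \<subseteq> ?K"
      "pair_elements ps \<subseteq> ?K" "\<forall>p\<in>set ps. good (fst p) (snd p)" "sorted_wrt commuting_pairs ps"
      "\<forall>l\<in>L. \<forall>x\<in>pair_elements ps. l \<otimes> x = x \<otimes> l" "\<not> (\<exists>a\<in>L. \<exists>b\<in>L. good a b)"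
      "?K \<subseteq> generate G (pair_elements ps \<union> L)"
      using less.hyps[OF card sub cen] by (elim exE conjE) (rule that)
    let ?S = "pair_elements ((a, b) # ps) \<union> L"
    have "?S \<subseteq> carrier G" using ps(3,4) abG KG by auto
    moreover have "?K \<subseteq> generate G ?S" using ps(9) mono_generate[of "pair_elements ps \<union> L" ?S] by auto
    ultimately have gen: "K \<subseteq> generate G ?S"
      by (intro subset_generate_complement[OF K(1) ab(1,2) nc]) auto
    have comm: "commuting_pairs (a, b) p" if "p \<in> set ps" for p
    proof -
      have "{fst p, snd p} \<subseteq> ?K" using that ps(4) by blast
      then show ?thesis by simp
    qed
    have "\<forall>l\<in>L. \<forall>x\<in>pair_elements ((a, b) # ps). l \<otimes> x = x \<otimes> l" using ps(3,7) by auto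
    moreover have "pair_elements ((a, b) # ps) \<subseteq> K" using ps(4) ab by auto
    moreover have "sorted_wrt commuting_pairs ((a, b) # ps)" using comm ps(6) by simp
    moreover have "\<forall>p\<in>set ((a, b) # ps). good (fst p) (snd p)" using ab(3) ps(5) by simp
    moreover have "L \<subseteq> K" using ps(3) by auto
    ultimately show ?thesis using ps(1,2,8) gen
      by (intro exI[of _ "(a, b) # ps"] exI[of _ L] conjI) assumption+
  qed
qed

definition central_square :: "'a \<Rightarrow> bool"
  where "central_square x \<longleftrightarrow> (\<exists>u\<in>group_center G. x \<otimes> x = u \<otimes> u)"

text \<open>The witness is x times \<open>inv u\<close>: as u is central, the square becomes u^(-2)
  x^2 = w and no commutator changes. The witness stays in \<open>L\<close> because \<open>L\<close>
  contains the center.\<close>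

lemma adjust_square:
  assumes L: "subgroup L G" "group_center G \<subseteq> L"
    and x: "x \<in> L" "x \<otimes> x = u \<otimes> u \<otimes> w" and u: "u \<in> group_center G" and w: "w \<in> carrier G"
  obtains x' where "x' \<in> L" "x' \<otimes> x' = w"
    "\<And>y. y \<in> carrier G \<Longrightarrow> x' \<otimes> y = y \<otimes> x' \<longleftrightarrow> x \<otimes> y = y \<otimes> x"
proof (rule that)
  have i: "inv u \<in> group_center G" using subgroup.m_inv_closed[OF subgroup_center u] .
  have [simp]: "x \<in> carrier G" "u \<in> carrier G"
    using L(1) x(1) u center_in_carrier by (auto dest: subgroup.mem_carrier)
  show "x \<otimes> inv u \<in> L" using L x(1) i subgroup.m_closed by fast
  show "(x \<otimes> inv u) \<otimes> y = y \<otimes> (x \<otimes> inv u) \<longleftrightarrow> x \<otimes> y = y \<otimes> x" if "y \<in> carrier G" for y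
    using i that by (simp add: commute_center_mult)
  have "(x \<otimes> inv u) \<otimes> (x \<otimes> inv u) = inv u \<otimes> inv u \<otimes> (x \<otimes> x)"
    using square_mult_commute[of "inv u" x] center_commute[OF i, of x] by simp
  also have "\<dots> = inv u \<otimes> (inv u \<otimes> (u \<otimes> (u \<otimes> w)))"
    using x(2) w by (simp add: m_assoc)
  also have "\<dots> = w" using w by (simp add: m_assoc[symmetric, of "inv u" u])
  finally show "(x \<otimes> inv u) \<otimes> (x \<otimes> inv u) = w" .
qed

text \<open>For commuting x and y the two factors d multiply to a square: (x y)^2 = (u v
  d)^2.\<close>

lemma central_square_mult:
  assumes comm: "x \<otimes> y = y \<otimes> x" "x \<in> carrier G" "y \<in> carrier G"
    and sq: "x \<otimes> x = u \<otimes> u \<otimes> d" "y \<otimes> y = v \<otimes> v \<otimes> d"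
    and c: "u \<in> group_center G" "v \<in> group_center G" "d \<in> group_center G"
  shows "central_square (x \<otimes> y)"
proof -
  have m: "p \<otimes> q \<in> group_center G" if "p \<in> group_center G" "q \<in> group_center G" for p q
    using subgroup.m_closed[OF subgroup_center that] .
  have k: "p \<otimes> q = q \<otimes> p" if "p \<in> group_center G" "q \<in> group_center G" for p q
    using that by (blast intro: center_commute center_in_carrier)
  have "(x \<otimes> y) \<otimes> (x \<otimes> y) = (u \<otimes> u) \<otimes> d \<otimes> ((v \<otimes> v) \<otimes> d)"
    using square_mult_commute[OF comm] sq by simp
  also have "\<dots> = (u \<otimes> u) \<otimes> (d \<otimes> (v \<otimes> v)) \<otimes> d"
    using c by (simp add: center_in_carrier m_assoc)
  also have "\<dots> = (u \<otimes> u) \<otimes> ((v \<otimes> v) \<otimes> d) \<otimes> d"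
    using k[of d "v \<otimes> v"] c m by simp
  also have "\<dots> = ((u \<otimes> u) \<otimes> (v \<otimes> v)) \<otimes> (d \<otimes> d)"
    using c by (simp add: center_in_carrier m_assoc)
  also have "\<dots> = ((u \<otimes> v) \<otimes> d) \<otimes> ((u \<otimes> v) \<otimes> d)"
    using c k m by (simp add: square_mult_commute center_in_carrier)
  finally show ?thesis unfolding central_square_def using m c by blast
qed

text \<open>A rotation of order 4 and a reflection, as in the presentation
  \<open>D8_group\<close>.\<close>

abbreviation D8_pair :: "'a \<Rightarrow> 'a \<Rightarrow> bool"
  where "D8_pair a b \<equiv> a \<otimes> b \<noteq> b \<otimes> a \<and> a \<otimes> a = c \<and> b \<otimes> b = \<one>"

text \<open>Correction turns a and b into two noncommuting involutions. Their product is the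
  rotation: by \<open>square_mult_noncommute\<close> its square is c.\<close>

lemma D8_pair_of_central_squares:
  assumes L: "subgroup L G" "group_center G \<subseteq> L"
    and ab: "a \<in> L" "b \<in> L" "a \<otimes> b \<noteq> b \<otimes> a" "central_square a" "central_square b"
  obtains a' b' where "a' \<in> L" "b' \<in> L" "D8_pair a' b'"
proof -
  have LG: "x \<in> carrier G" if "x \<in> L" for x using subgroup.mem_carrier[OF L(1) that] .
  obtain u v where uv: "u \<in> group_center G" "a \<otimes> a = u \<otimes> u" "v \<in> group_center G" "b \<otimes> b = v \<otimes> v"
    using ab(4,5) by (auto simp: central_square_def)
  obtain a' where a': "a' \<in> L" "a' \<otimes> a' = \<one>"
    "\<And>y. y \<in> carrier G \<Longrightarrow> a' \<otimes> y = y \<otimes> a' \<longleftrightarrow> a \<otimes> y = y \<otimes> a"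
    using adjust_square[OF L ab(1) _ uv(1), of \<one>] uv(1,2) by (auto simp: center_in_carrier)
  obtain b' where b': "b' \<in> L" "b' \<otimes> b' = \<one>"
    "\<And>y. y \<in> carrier G \<Longrightarrow> b' \<otimes> y = y \<otimes> b' \<longleftrightarrow> b \<otimes> y = y \<otimes> b"
    using adjust_square[OF L ab(2) _ uv(3), of \<one>] uv(3,4) by (auto simp: center_in_carrier)
  have n: "a' \<otimes> b' \<noteq> b' \<otimes> a'"
    using a'(3)[OF LG[OF b'(1)]] b'(3)[OF LG[OF ab(1)]] ab(3) by simp
  show ?thesis
  proof (rule that[of "a' \<otimes> b'" b'])
    show "a' \<otimes> b' \<in> L" using a'(1) b'(1) subgroup.m_closed[OF L(1)] by simp
    show "b' \<in> L" by fact
    have "(a' \<otimes> b') \<otimes> b' \<noteq> b' \<otimes> (a' \<otimes> b')"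
      using noncommute_mult_commute[OF n] a'(1) b'(1) LG by simp
    then show "D8_pair (a' \<otimes> b') b'"
      using square_mult_noncommute[OF n] a'(1,2) b'(1,2) LG by simp
  qed
qed

end

text \<open>In the application d is \<open>z 2\<close>: squares lie in N = <z_1^2> x <z_2>, and
  modulo squares of central elements only the classes of 1 and d are left there.\<close>

locale square_classes = two_commutator_group +
  fixes d :: 'a
  assumes d_center: "d \<in> group_center G"
    and squares: "x \<in> carrier G \<Longrightarrow>
      \<exists>u\<in>group_center G. x \<otimes> x = u \<otimes> u \<or> x \<otimes> x = u \<otimes> u \<otimes> d"
begin

lemma d_closed [simp, intro]: "d \<in> carrier G"
  using d_center by (rule center_in_carrier)

lemma not_central_square:
  assumes "\<not> central_square x" "x \<in> carrier G"
  obtains u where "u \<in> group_center G" "x \<otimes> x = u \<otimes> u \<otimes> d"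
  using assms squares[of x] by (auto simp: central_square_def)

lemma central_square_mult_not:
  assumes "x \<otimes> y = y \<otimes> x" "x \<in> carrier G" "y \<in> carrier G"
    "\<not> central_square x" "\<not> central_square y"
  shows "central_square (x \<otimes> y)"
proof -
  obtain u where "u \<in> group_center G" "x \<otimes> x = u \<otimes> u \<otimes> d"
    using not_central_square assms(2,4) by blast
  moreover obtain v where "v \<in> group_center G" "y \<otimes> y = v \<otimes> v \<otimes> d"
    using not_central_square assms(3,5) by blast
  ultimately show ?thesis using central_square_mult assms(1-3) d_center by blast
qed

text \<open>
  If \<open>a\<close> and a further element \<open>h\<close> commuting with \<open>a\<close> and \<open>b\<close> both have nontrivial square class,
  then \<open>(ah, b)\<close> or \<open>(ah, bh)\<close> is a noncommuting pair with trivial square classes.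
\<close>

lemma commuting_with_central_square:
  assumes L: "subgroup L G" "group_center G \<subseteq> L" and no: "\<not> (\<exists>a\<in>L. \<exists>b\<in>L. D8_pair a b)"
    and ab: "a \<in> L" "b \<in> L" "a \<otimes> b \<noteq> b \<otimes> a" "\<not> central_square a"
    and h: "h \<in> commuting_with L a b"
  shows "central_square h"
proof (rule ccontr)
  assume nh: "\<not> central_square h"
  have [simp]: "a \<in> carrier G" "b \<in> carrier G" "h \<in> carrier G"
    using L(1) ab h by (auto dest: subgroup.mem_carrier)
  have hc: "h \<in> L" "h \<otimes> a = a \<otimes> h" "h \<otimes> b = b \<otimes> h" using h by auto
  have m: "x \<otimes> h \<in> L" if "x \<in> L" for x using that hc(1) by (rule subgroup.m_closed[OF L(1)])
  have ah: "central_square (a \<otimes> h)" using hc nh ab(4) by (intro central_square_mult_not) auto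
  show False
  proof (cases "central_square b")
    case True
    have "(a \<otimes> h) \<otimes> b \<noteq> b \<otimes> (a \<otimes> h)" using noncommute_mult_commute[OF ab(3) hc(3)] by simp
    then show False
      using D8_pair_of_central_squares[OF L m[OF ab(1)] ab(2) _ ah True] no by metis
  next
    case False
    have bh: "central_square (b \<otimes> h)" using hc nh False by (intro central_square_mult_not) auto
    \<comment> \<open>As h commutes with a and b, the commutator of a h and b h equals that of a and
      b.\<close>
    have "(b \<otimes> h) \<otimes> a \<noteq> a \<otimes> (b \<otimes> h)"
      using noncommute_mult_commute[OF ab(3)[symmetric] hc(2)] by simp
    moreover have "h \<otimes> (b \<otimes> h) = (b \<otimes> h) \<otimes> h"
      by (simp add: m_assoc[symmetric] hc(3))
    ultimately have "(a \<otimes> h) \<otimes> (b \<otimes> h) \<noteq> (b \<otimes> h) \<otimes> (a \<otimes> h)"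
      by (intro noncommute_mult_commute) auto
    then show False
      using D8_pair_of_central_squares[OF L m[OF ab(1)] m[OF ab(2)] _ ah bh] no by metis
  qed
qed

text \<open>Both elements have trivial square class by \<open>commuting_with_central_square\<close>;
  if they did not commute, they would give the \<open>D8_pair\<close> that \<open>L\<close> does not
  contain.\<close>

lemma commuting_with_abelian:
  assumes L: "subgroup L G" "group_center G \<subseteq> L" and no: "\<not> (\<exists>a\<in>L. \<exists>b\<in>L. D8_pair a b)"
    and ab: "a \<in> L" "b \<in> L" "a \<otimes> b \<noteq> b \<otimes> a" "\<not> central_square a"
    and hk: "h \<in> commuting_with L a b" "k \<in> commuting_with L a b"
  shows "h \<otimes> k = k \<otimes> h"
proof (rule ccontr)
  assume "h \<otimes> k \<noteq> k \<otimes> h"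
  moreover have "central_square h" "central_square k"
    using commuting_with_central_square[OF L no ab] hk by blast+
  ultimately show False using D8_pair_of_central_squares[OF L, of h k] hk no by blast
qed

text \<open>The alternative \<open>b \<otimes> b = \<one>\<close> leads to M_2(m + 1, 1), the other
  one, possible only for d = c, to Q_8.\<close>

definition last_pair :: "'a \<Rightarrow> 'a \<Rightarrow> bool"
  where "last_pair a b \<longleftrightarrow> a \<otimes> b \<noteq> b \<otimes> a \<and> a \<otimes> a = d \<and> (b \<otimes> b = \<one> \<or> d = c \<and> b \<otimes> b = c)"

lemma exists_last_pair:
  assumes dc: "d = c \<or> (\<exists>v\<in>group_center G. c = v \<otimes> v)"
    and L: "subgroup L G" "group_center G \<subseteq> L" and no: "\<not> (\<exists>a\<in>L. \<exists>b\<in>L. D8_pair a b)"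
    and nonab: "\<exists>a\<in>L. \<exists>b\<in>L. a \<otimes> b \<noteq> b \<otimes> a"
  obtains a b where "a \<in> L" "b \<in> L" "last_pair a b" "\<not> central_square a"
proof -
  note found = that
  have LG: "x \<in> carrier G" if "x \<in> L" for x using subgroup.mem_carrier[OF L(1) that] .
  \<comment> \<open>A noncommuting pair with both square classes trivial would yield a
    \<open>D8_pair\<close>; so in any noncommuting pair one member has nontrivial class, and it is
    called \<open>a\<close>.\<close>
  obtain a b where ab: "a \<in> L" "b \<in> L" "a \<otimes> b \<noteq> b \<otimes> a" "\<not> central_square a"
    using nonab D8_pair_of_central_squares[OF L] no by metis
  note [simp] = LG[OF ab(1)] LG[OF ab(2)]
  obtain u where u: "u \<in> group_center G" "a \<otimes> a = u \<otimes> u \<otimes> d"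
    using not_central_square[OF ab(4)] by auto
  obtain a' where a': "a' \<in> L" "a' \<otimes> a' = d"
    "\<And>y. y \<in> carrier G \<Longrightarrow> a' \<otimes> y = y \<otimes> a' \<longleftrightarrow> a \<otimes> y = y \<otimes> a"
    using adjust_square[OF L ab(1) u(2,1)] by auto
  note [simp] = LG[OF a'(1)]
  \<comment> \<open>Otherwise d is a central square w^2, and a^2 = (u w)^2.\<close>
  have na': "\<not> central_square a'"
  proof
    assume "central_square a'"
    then obtain w where w: "w \<in> group_center G" "d = w \<otimes> w" using a'(2) by (auto simp: central_square_def)
    then have "a \<otimes> a = (u \<otimes> w) \<otimes> (u \<otimes> w)"
      using u by (simp add: square_mult_commute center_commute center_in_carrier)
    then show False using ab(4) u w subgroup.m_closed[OF subgroup_center]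
      by (auto simp: central_square_def)
  qed
  \<comment> \<open>\<open>a'\<close> commutes with the same elements as \<open>a\<close>, so a
    candidate for its partner may be tested against \<open>a\<close>.\<close>
  have result: thesis if "b' \<in> L" "b' \<otimes> b' = \<one> \<or> d = c \<and> b' \<otimes> b' = c" "b' \<otimes> a \<noteq> a \<otimes> b'" for b'
  proof (rule found[OF a'(1) that(1) _ na'])
    show "last_pair a' b'"
      using a'(3)[OF LG[OF that(1)]] a'(2) that(2,3) by (auto simp: last_pair_def)
  qed
  have adjust: thesis if b: "x \<in> L" "x \<otimes> a \<noteq> a \<otimes> x" "v \<in> group_center G"
    "x \<otimes> x = v \<otimes> v \<otimes> w" "w = \<one> \<or> d = c \<and> w = c" for x v w
  proof -
    have "w \<in> carrier G" using b(5) by auto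
    then obtain b' where b': "b' \<in> L" "b' \<otimes> b' = w"
      "\<And>y. y \<in> carrier G \<Longrightarrow> b' \<otimes> y = y \<otimes> b' \<longleftrightarrow> x \<otimes> y = y \<otimes> x"
      using adjust_square[OF L b(1,4,3)] by auto
    show thesis using result[of b'] b' b(2,5) by simp
  qed
  show thesis
  proof (cases "central_square b")
    case True
    then obtain v where "v \<in> group_center G" "b \<otimes> b = v \<otimes> v" by (auto simp: central_square_def)
    then show ?thesis using adjust[of b v \<one>] ab by (simp add: center_in_carrier)
  next
    case False
    then obtain v where v: "v \<in> group_center G" "b \<otimes> b = v \<otimes> v \<otimes> d"
      using not_central_square[OF False] by auto
    show ?thesis
    proof (cases "d = c")
      case True
      then show ?thesis using adjust[of b v c] v ab by simp
    next
      case False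
      then obtain w where w: "w \<in> group_center G" "c = w \<otimes> w" using dc by auto
      \<comment> \<open>Since b has nontrivial square class, it is replaced by
        \<open>a \<otimes> b\<close>: its square is u^2 d v^2 d c with c = w^2, the square of the
        central element \<open>?p\<close>.\<close>
      let ?p = "u \<otimes> v \<otimes> d \<otimes> w"
      have m: "p \<otimes> q \<in> group_center G" if "p \<in> group_center G" "q \<in> group_center G" for p q
        using subgroup.m_closed[OF subgroup_center that] .
      note [simp] = center_in_carrier[OF u(1)] center_in_carrier[OF v(1)] center_in_carrier[OF w(1)]
      have "(a \<otimes> b) \<otimes> (a \<otimes> b) = (u \<otimes> u) \<otimes> (d \<otimes> (v \<otimes> v)) \<otimes> d \<otimes> (w \<otimes> w)"
        using square_mult_noncommute[OF ab(3)] u v w(2) by (simp add: m_assoc)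
      also have "d \<otimes> (v \<otimes> v) = (v \<otimes> v) \<otimes> d" by (rule center_commute[OF d_center]) simp
      also have "(u \<otimes> u) \<otimes> (v \<otimes> v \<otimes> d) \<otimes> d \<otimes> (w \<otimes> w) = ((u \<otimes> u) \<otimes> (v \<otimes> v)) \<otimes> (d \<otimes> d) \<otimes> (w \<otimes> w)"
        by (simp add: m_assoc)
      also have "\<dots> = ?p \<otimes> ?p"
        using u v w d_center m by (simp add: square_mult_commute center_commute)
      finally have "(a \<otimes> b) \<otimes> (a \<otimes> b) = ?p \<otimes> ?p \<otimes> \<one>" by simp
      moreover have "?p \<in> group_center G" using u v w d_center m by simp
      moreover have "(a \<otimes> b) \<otimes> a \<noteq> a \<otimes> (a \<otimes> b)"
        using ab(3) by (simp add: m_assoc)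
      moreover have "a \<otimes> b \<in> L" using ab by (intro subgroup.m_closed[OF L(1)])
      ultimately show ?thesis using adjust[of "a \<otimes> b" ?p \<one>] by blast
    qed
  qed
qed

text \<open>The head \<open>p\<close> is singled out because it is the only pair that need not be a
  \<open>D8_pair\<close>. If the remaining subgroup \<open>L\<close> is nonabelian, \<open>p\<close>
  is its last pair, whose centralizer in \<open>L\<close> is central in G; if \<open>L\<close> is
  abelian, it is the center itself and \<open>p\<close> is just the first pair split off.\<close>

lemma pair_decomposition:
  assumes fin: "finite (carrier G)"
    and dc: "d = c \<or> (\<exists>v\<in>group_center G. c = v \<otimes> v)"
    and nonab: "\<exists>a\<in>carrier G. \<exists>b\<in>carrier G. a \<otimes> b \<noteq> b \<otimes> a"
  obtains p ps where "pair_elements (p # ps) \<subseteq> carrier G" "sorted_wrt commuting_pairs (p # ps)"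
    "carrier G = generate G (pair_elements (p # ps) \<union> group_center G)"
    "\<And>q. q \<in> set ps \<Longrightarrow> D8_pair (fst q) (snd q)"
    "D8_pair (fst p) (snd p) \<or> last_pair (fst p) (snd p)"
proof -
  have D8_pair_noncommute: "\<forall>a b. D8_pair a b \<longrightarrow> a \<otimes> b \<noteq> b \<otimes> a" by simp
  have cG: "group_center G \<subseteq> carrier G" by (auto simp: group_center_def)
  obtain ps L where L: "subgroup L G" "group_center G \<subseteq> L" "L \<subseteq> carrier G"
    and ps: "pair_elements ps \<subseteq> carrier G" "\<forall>p\<in>set ps. D8_pair (fst p) (snd p)"
      "sorted_wrt commuting_pairs ps"
    and comm: "\<forall>l\<in>L. \<forall>x\<in>pair_elements ps. l \<otimes> x = x \<otimes> l"
    and no: "\<not> (\<exists>a\<in>L. \<exists>b\<in>L. D8_pair a b)" and gen: "carrier G \<subseteq> generate G (pair_elements ps \<union> L)"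
    using split_off_pairs[of D8_pair "carrier G", OF fin D8_pair_noncommute subgroup_self cG]
    by (elim exE conjE) (rule that)
  have gen': "carrier G = generate G (pair_elements ps \<union> L)"
    using gen generate_incl[of "pair_elements ps \<union> L"] ps(1) L(3) by blast
  show thesis
  proof (cases "\<exists>a\<in>L. \<exists>b\<in>L. a \<otimes> b \<noteq> b \<otimes> a")
    case True
    then obtain a b where ab: "a \<in> L" "b \<in> L" "last_pair a b" "\<not> central_square a"
      using exists_last_pair[OF _ L(1,2) no] dc by metis
    then have nc: "a \<otimes> b \<noteq> b \<otimes> a" by (simp add: last_pair_def)
    let ?C = "commuting_with L a b"
    let ?S = "pair_elements ((a, b) # ps) \<union> ?C"
    have S: "?S \<subseteq> carrier G" using ab L(3) ps(1) by auto
    have "L \<subseteq> generate G ({a, b} \<union> ?C)"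
      using ab L by (intro subset_generate_complement[OF L(1) ab(1,2) nc]) (auto intro: generate.incl)
    also have "\<dots> \<subseteq> generate G ?S" by (intro mono_generate) auto
    finally have "pair_elements ps \<union> L \<subseteq> generate G ?S" by (auto intro: generate.incl)
    then have "generate G (pair_elements ps \<union> L) \<subseteq> generate G ?S"
      by (rule generate_subgroup_incl[OF _ generate_is_subgroup[OF S]])
    then have genS: "carrier G = generate G ?S" using gen generate_incl[OF S] by blast
    \<comment> \<open>Such an h commutes with the pairs already split off because it lies in
      \<open>L\<close>, with a and b by definition, and with the rest of \<open>?C\<close> because
      \<open>?C\<close> is abelian.\<close>
    have "?C \<subseteq> group_center G"
    proof
      fix h assume h: "h \<in> ?C"
      show "h \<in> group_center G"
      proof (rule center_generating[OF _ S genS])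
        show "h \<in> carrier G" using h L(3) by auto
        show "s \<otimes> h = h \<otimes> s" if s: "s \<in> ?S" for s
        proof -
          have hL: "h \<in> L" "h \<otimes> a = a \<otimes> h" "h \<otimes> b = b \<otimes> h" using h by auto
          consider "s \<in> pair_elements ps" | "s \<in> {a, b}" | "s \<in> ?C" using s by auto
          then show ?thesis
          proof cases
            case 1
            then show ?thesis using comm hL(1) by metis
          next
            case 2
            then show ?thesis using hL by auto
          next
            case 3
            then show ?thesis by (rule commuting_with_abelian[OF L(1,2) no ab(1,2) nc ab(4) _ h])
          qed
        qed
      qed
    qed
    then have "generate G ?S \<subseteq> generate G (pair_elements ((a, b) # ps) \<union> group_center G)"
      by (intro mono_generate) auto
    moreover have S': "pair_elements ((a, b) # ps) \<subseteq> carrier G" using S by auto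
    ultimately have "carrier G = generate G (pair_elements ((a, b) # ps) \<union> group_center G)"
      using genS generate_incl[of "pair_elements ((a, b) # ps) \<union> group_center G"] cG by blast
    moreover have "sorted_wrt commuting_pairs ((a, b) # ps)" using comm ab(1,2) ps(3) by auto
    ultimately show thesis using that[of "(a, b)" ps] S' ab(3) ps(2) by simp
  next
    case False
    have "L \<subseteq> group_center G"
    proof
      fix h assume h: "h \<in> L"
      show "h \<in> group_center G"
      proof (rule center_generating[OF _ _ gen'])
        show "h \<in> carrier G" "pair_elements ps \<union> L \<subseteq> carrier G" using h L(3) ps(1) by auto
        show "s \<otimes> h = h \<otimes> s" if s: "s \<in> pair_elements ps \<union> L" for s
          using s
        proof
          assume "s \<in> L"
          then show ?thesis using h False by metis
        next
          assume "s \<in> pair_elements ps"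
          then show ?thesis using h comm by metis
        qed
      qed
    qed
    then have LZ: "L = group_center G" using L(2) by blast
    \<comment> \<open>Without pairs G would equal \<open>L\<close>, which is now known to be the
      center.\<close>
    have "ps \<noteq> []"
    proof
      assume "ps = []"
      then have "carrier G = L" using gen' generate_subgroup_incl[OF _ L(1), of L] L(3) by auto
      then show False using LZ nonab by (auto simp: group_center_def)
    qed
    then obtain p qs where "ps = p # qs" by (cases ps) auto
    then show thesis using that[of p qs] ps gen' LZ by auto
  qed
qed

end

subsection \<open>Homomorphisms from presented groups\<close>

definition eval_word :: "('a, 'b) monoid_scheme \<Rightarrow> ('x \<Rightarrow> 'a) \<Rightarrow> 'x gword \<Rightarrow> 'a"
  where "eval_word G h w =
    foldr (\<lambda>(x, e) g. (if e then inv\<^bsub>G\<^esub> h x else h x) \<otimes>\<^bsub>G\<^esub> g) w \<one>\<^bsub>G\<^esub>"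

lemma eval_word_Nil [simp]: "eval_word G h [] = \<one>\<^bsub>G\<^esub>"
  by (simp add: eval_word_def)

lemma eval_word_Cons:
  "eval_word G h ((x, e) # w) = (if e then inv\<^bsub>G\<^esub> h x else h x) \<otimes>\<^bsub>G\<^esub> eval_word G h w"
  by (simp add: eval_word_def)

lemma gen_in_lists: "x \<in> S \<Longrightarrow> gen x \<in> lists (S \<times> UNIV)"
  by (simp add: gen_def)

lemma pow_word_in_lists: "w \<in> lists A \<Longrightarrow> pow_word w n \<in> lists A"
  by (induction n) (auto simp: pow_word_def)

lemma inv_word_in_lists: "w \<in> lists (S \<times> UNIV) \<Longrightarrow> inv_word w \<in> lists (S \<times> UNIV)"
  by (fastforce simp: inv_word_def in_lists_conv_set)

text \<open>An element of the presented group is a class of words and is evaluated at an arbitrary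
  representative; the choice does not matter once all relators evaluate to 1.\<close>

definition presented_hom :: "('a, 'b) monoid_scheme \<Rightarrow> ('x \<Rightarrow> 'a) \<Rightarrow> 'x gword set \<Rightarrow> 'a"
  where "presented_hom G h A = eval_word G h (SOME w. w \<in> A)"

lemma word_class_in_carrier:
  "w \<in> lists (S \<times> UNIV) \<Longrightarrow> word_class S R w \<in> carrier (presented_group S R)"
  by (auto simp: presented_group_def)

lemma presented_group_cases:
  assumes "A \<in> carrier (presented_group S R)"
  obtains w where "w \<in> lists (S \<times> UNIV)" "A = word_class S R w"
  using assms by (auto simp: presented_group_def)

context group
begin

text \<open>\<open>h\<close> takes values in G on every letter, also outside the generating set, so
  that all words can be evaluated.\<close>

context
  fixes h :: "'x \<Rightarrow> 'a"
  assumes h: "\<And>x. h x \<in> carrier G"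
begin

lemma eval_word_closed [simp]: "eval_word G h w \<in> carrier G"
  by (induction w) (auto simp: eval_word_Cons h)

lemma eval_word_append: "eval_word G h (v @ w) = eval_word G h v \<otimes> eval_word G h w"
  by (induction v) (auto simp: eval_word_Cons h m_assoc)

lemma eval_word_gen: "eval_word G h (gen x) = h x"
  by (simp add: gen_def eval_word_Cons h)

lemma eval_word_pow: "eval_word G h (pow_word w n) = eval_word G h w [^] n"
proof (induction n)
  case (Suc n)
  have "eval_word G h (pow_word w (Suc n)) = eval_word G h w \<otimes> eval_word G h w [^] n"
    using Suc by (simp add: pow_word_def eval_word_append)
  then show ?case by (simp only: nat_pow_Suc2[OF eval_word_closed])
qed (simp add: pow_word_def)

lemma eval_word_inv: "eval_word G h (inv_word w) = inv eval_word G h w"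
proof (induction w)
  case (Cons l w)
  obtain x e where l: "l = (x, e)" by force
  have "eval_word G h (inv_word (l # w)) = inv eval_word G h w \<otimes> eval_word G h [(x, \<not> e)]"
    using Cons by (simp add: inv_word_def l eval_word_append)
  then show ?case by (simp add: l eval_word_Cons h inv_mult_group)
qed (simp add: inv_word_def)

text \<open>This and the next three rules give evaluations in the shape demanded by
  \<open>two_power_factor\<close>, integer powers of one generator; this is why 1 appears as a power
  with exponent 0.\<close>

lemma eval_word_gen_pow: "eval_word G h (pow_word (gen x) n) = h x [^] int n"
  by (simp only: eval_word_pow eval_word_gen int_pow_int)

lemma eval_word_gen_inv: "eval_word G h (inv_word (gen x)) = h x [^] (- 1 :: int)"
  by (simp add: eval_word_inv eval_word_gen int_pow_neg h)

lemma eval_word_square_eq_one_iff: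
  "eval_word G h (pow_word (gen x) 2) = \<one> \<longleftrightarrow> h x \<otimes> h x = h y [^] (0 :: int)"
  by (simp add: eval_word_pow eval_word_gen numeral_2_eq_2 h)

lemma eval_word_square_eq_iff:
  "eval_word G h (pow_word (gen x) 2 @ inv_word (pow_word (gen y) 2)) = \<one> \<longleftrightarrow>
    h x \<otimes> h x = h y [^] (2 :: int)"
proof -
  have "h x \<otimes> h x \<otimes> inv (h y \<otimes> h y) = \<one> \<longleftrightarrow> h x \<otimes> h x = h y \<otimes> h y"
    using inv_solve_right'[of \<one> "h x \<otimes> h x" "h y \<otimes> h y"] h by auto
  then show ?thesis
    by (simp add: eval_word_append eval_word_inv eval_word_pow eval_word_gen int_pow_def2 numeral_2_eq_2 h)
qed

lemma eval_word_eq: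
  assumes "word_eq S R v w" "\<And>r. r \<in> R \<Longrightarrow> eval_word G h r = \<one>"
  shows "eval_word G h v = eval_word G h w"
  using assms(1)
proof (induction rule: word_eq.induct)
  case (cancel x u e v)
  have "(if e then inv h x else h x) \<otimes> ((if \<not> e then inv h x else h x) \<otimes> eval_word G h v) = eval_word G h v"
    by (simp add: h m_assoc[symmetric])
  then show ?case by (simp add: eval_word_append eval_word_Cons h)
next
  case (relator r u v)
  then show ?case by (simp add: eval_word_append assms(2))
qed auto

lemma eval_word_in_generate:
  assumes "w \<in> lists (S \<times> UNIV)"
  shows "eval_word G h w \<in> generate G (h ` S)"
  using assms
proof (induction w rule: list.induct)
  case (Cons l w)
  obtain x e where l: "l = (x, e)" by force
  then show ?case using Cons
    by (auto simp: eval_word_Cons intro!: generate.eng intro: generate.incl generate.inv)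
qed (simp add: generate.one)

context
  fixes S :: "'x set" and R :: "'x gword set"
  assumes R: "\<And>r. r \<in> R \<Longrightarrow> eval_word G h r = \<one>"
begin

lemma presented_hom_word_class: "presented_hom G h (word_class S R w) = eval_word G h w"
proof -
  have "w \<in> word_class S R w" by (simp add: word_class_def word_eq.refl)
  then have "(SOME v. v \<in> word_class S R w) \<in> word_class S R w" by (rule someI)
  then have "word_eq S R w (SOME v. v \<in> word_class S R w)" by (simp add: word_class_def)
  then show ?thesis using eval_word_eq R unfolding presented_hom_def by metis
qed

lemma presented_hom_hom: "presented_hom G h \<in> hom (presented_group S R) G"
proof (rule homI)
  fix A B assume "A \<in> carrier (presented_group S R)" "B \<in> carrier (presented_group S R)"
  then show "presented_hom G h (A \<otimes>\<^bsub>presented_group S R\<^esub> B) = presented_hom G h A \<otimes> presented_hom G h B"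
    by (elim presented_group_cases)
      (simp add: mult_presented_group presented_hom_word_class eval_word_append)
next
  fix A assume "A \<in> carrier (presented_group S R)"
  then show "presented_hom G h A \<in> carrier G"
    by (elim presented_group_cases) (simp add: presented_hom_word_class)
qed

lemma presented_hom_image: "presented_hom G h ` carrier (presented_group S R) = generate G (h ` S)"
proof
  interpret P: group_hom "presented_group S R" G "presented_hom G h"
    by (intro group_hom.intro group_hom_axioms.intro group_presented_group presented_hom_hom is_group)
  have "h ` S \<subseteq> presented_hom G h ` carrier (presented_group S R)"
  proof
    fix y assume "y \<in> h ` S"
    then obtain x where x: "x \<in> S" "y = h x" by blast
    then have "y = presented_hom G h (word_class S R (gen x))"
      by (simp add: presented_hom_word_class eval_word_gen)
    moreover have "word_class S R (gen x) \<in> carrier (presented_group S R)"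
      using x(1) by (intro word_class_in_carrier) (simp add: gen_def)
    ultimately show "y \<in> presented_hom G h ` carrier (presented_group S R)" by blast
  qed
  then show "generate G (h ` S) \<subseteq> presented_hom G h ` carrier (presented_group S R)"
    by (rule generate_subgroup_incl[OF _ P.img_is_subgroup])
  show "presented_hom G h ` carrier (presented_group S R) \<subseteq> generate G (h ` S)"
  proof (rule image_subsetI)
    fix A assume "A \<in> carrier (presented_group S R)"
    then obtain w where "w \<in> lists (S \<times> UNIV)" "A = word_class S R w" by (rule presented_group_cases)
    then show "presented_hom G h A \<in> generate G (h ` S)" by (simp only: presented_hom_word_class eval_word_in_generate)
  qed
qed

end

end

text \<open>y is moved to the left past one x at a time. A negative exponent -n is reduced to n by
  cancelling x^(-n) x^n.\<close>

lemma int_pow_conj_shift: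
  assumes x: "x \<in> carrier G" "y \<in> carrier G" and eq: "x \<otimes> y = y \<otimes> x [^] (e::int)"
  shows "x [^] (i::int) \<otimes> y = y \<otimes> x [^] (e * i)"
proof -
  have nat: "x [^] (int n) \<otimes> y = y \<otimes> x [^] (e * int n)" for n
  proof (induction n)
    case (Suc n)
    have "x [^] (int (Suc n)) \<otimes> y = x [^] int n \<otimes> (x \<otimes> y)"
      using x by (simp add: int_pow_mult m_assoc add.commute[of 1])
    also have "\<dots> = (x [^] int n \<otimes> y) \<otimes> x [^] e" using x eq by (simp add: m_assoc)
    also have "\<dots> = y \<otimes> (x [^] (e * int n) \<otimes> x [^] e)" using x Suc by (simp add: m_assoc)
    also have "\<dots> = y \<otimes> x [^] (e * int (Suc n))"
      using x by (simp add: distrib_left add.commute[of e] int_pow_mult)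
    finally show ?case .
  qed (use x in simp)
  show ?thesis
  proof (cases "i \<ge> 0")
    case True
    then show ?thesis using nat[of "nat i"] by simp
  next
    case False
    define n where "n = nat (- i)"
    have i: "i = - int n" using False by (simp add: n_def)
    have "x [^] i \<otimes> (y \<otimes> x [^] (e * int n)) = x [^] i \<otimes> (x [^] int n \<otimes> y)" by (simp only: nat)
    also have "\<dots> = (x [^] i \<otimes> x [^] int n) \<otimes> y" using x by (simp add: m_assoc)
    also have "\<dots> = y" using x by (simp add: i flip: int_pow_mult)
    finally have y: "x [^] i \<otimes> y \<otimes> x [^] (e * int n) = y" using x by (simp add: m_assoc)
    have "y \<otimes> x [^] (e * i) = x [^] i \<otimes> y \<otimes> x [^] (e * int n) \<otimes> x [^] (e * i)" by (simp only: y)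
    also have "\<dots> = x [^] i \<otimes> y \<otimes> (x [^] (e * int n) \<otimes> x [^] (e * i))" using x by (simp add: m_assoc)
    also have "\<dots> = x [^] i \<otimes> y" using x by (simp add: i flip: int_pow_mult)
    finally show ?thesis by simp
  qed
qed

text \<open>\<open>conj\<close> moves every b to the left and \<open>sq\<close> turns two b into a
  power of a, so <a> has index at most 2. The inverse of b has the same shape, b a^(-t).\<close>

lemma generate_two:
  fixes e t :: int
  assumes ab: "a \<in> carrier G" "b \<in> carrier G"
    and conj: "a \<otimes> b = b \<otimes> a [^] e" and sq: "b \<otimes> b = a [^] t"
    and x: "x \<in> generate G {a, b}"
  shows "\<exists>i::int. x = a [^] i \<or> x = b \<otimes> a [^] i"
  using x
proof (induction rule: generate.induct)
  case one
  show ?case by (intro exI[of _ 0]) simp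
next
  case (incl x)
  then show ?case using ab by (metis insertE singletonD int_pow_1 int_pow_0 r_one)
next
  case (inv x)
  have "b \<otimes> (b \<otimes> a [^] (- t)) = a [^] t \<otimes> a [^] (- t)"
    using ab by (simp add: m_assoc[symmetric] sq)
  also have "\<dots> = \<one>" using ab by (simp flip: int_pow_mult)
  finally have "inv b = b \<otimes> a [^] (- t)"
    using inv_solve_left[of "b \<otimes> a [^] (- t)" b \<one>] ab by simp
  moreover have "inv a = a [^] (-1::int)" using ab by (simp add: int_pow_neg)
  ultimately show ?case using inv by blast
next
  case (eng x y)
  obtain i j :: int where i: "x = a [^] i \<or> x = b \<otimes> a [^] i" and j: "y = a [^] j \<or> y = b \<otimes> a [^] j"
    using eng.IH by blast
  have *: "a [^] i \<otimes> (b \<otimes> a [^] j) = b \<otimes> a [^] (e * i + j)"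
    using ab by (simp add: m_assoc[symmetric] int_pow_conj_shift[OF ab conj] int_pow_mult)
  have "b \<otimes> a [^] i \<otimes> (b \<otimes> a [^] j) = b \<otimes> (b \<otimes> a [^] (e * i + j))"
    using ab * by (simp add: m_assoc)
  also have "\<dots> = a [^] (t + (e * i + j))"
    using ab by (simp add: m_assoc[symmetric] sq int_pow_mult)
  finally have **: "b \<otimes> a [^] i \<otimes> (b \<otimes> a [^] j) = a [^] (t + (e * i + j))" .
  have "a [^] i \<otimes> a [^] j = a [^] (i + j)" "b \<otimes> a [^] i \<otimes> a [^] j = b \<otimes> a [^] (i + j)"
    using ab by (simp_all add: m_assoc int_pow_mult)
  then show ?case using i j * ** by metis
qed

end

text \<open>With this the lemmas on \<open>eval_word\<close> apply to the presented group itself,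
  both to read relators as equations there and to see that the generators generate. Letters outside
  \<open>S\<close> get the default value 1 to make the assignment total.\<close>

lemma presented_group_word_class:
  fixes S R
  defines "P \<equiv> presented_group S R"
  assumes w: "w \<in> lists (S \<times> UNIV)"
  shows "eval_word P (\<lambda>x. if x \<in> S then word_class S R (gen x) else \<one>\<^bsub>P\<^esub>) w = word_class S R w"
  using w
proof (induction w rule: list.induct)
  case Nil
  then show ?case by (simp add: P_def presented_group_def)
next
  case (Cons l w)
  interpret P: group P unfolding P_def by (rule group_presented_group)
  obtain x e where l: "l = (x, e)" by force
  have x: "x \<in> S" using Cons.prems l by auto
  have c: "word_class S R [(x, b)] \<in> carrier P" for b
    unfolding P_def using x by (intro word_class_in_carrier) simp
  have "word_class S R [(x, True)] \<otimes>\<^bsub>P\<^esub> word_class S R [(x, False)] = \<one>\<^bsub>P\<^esub>"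
    using word_eq.cancel[of x S R "[]" True "[]"] x
    unfolding P_def mult_presented_group by (simp add: presented_group_def word_class_eq_iff)
  then have "inv\<^bsub>P\<^esub> word_class S R [(x, False)] = word_class S R [(x, True)]"
    using c by (intro P.inv_equality)
  then show ?case using Cons x
    by (simp add: l eval_word_Cons gen_def) (simp add: P_def mult_presented_group)
qed

lemma relator_word_class:
  assumes "r \<in> R"
  shows "word_class S R r = \<one>\<^bsub>presented_group S R\<^esub>"
  using word_eq.relator[OF assms, of S "[]" "[]"]
  by (simp add: presented_group_def word_class_eq_iff)

section \<open>Presented groups embedded in G\<close>

context two_commutator_group
begin

text \<open>The last clause hides whether P is abelian, so that all factors of a central product can
  be treated alike: what is amalgamated always becomes {1, c} in G.\<close>

definition factor :: "'p monoid \<Rightarrow> ('p \<Rightarrow> 'a) \<Rightarrow> 'a set \<Rightarrow> bool"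
  where "factor P \<phi> U \<longleftrightarrow> group P \<and> \<phi> \<in> hom P G \<and> inj_on \<phi> (carrier P) \<and>
    \<phi> ` carrier P = generate G U \<and> amalgam_subgroup P = {p \<in> carrier P. \<phi> p \<in> {\<one>, c}}"

lemma inv_c: "inv c = c"
  using c_square by (simp add: inv_equality)

lemma subgroup_one_c: "subgroup {\<one>, c} G"
  by (rule subgroupI) (auto simp: inv_c c_square)

lemma commutator_in:
  assumes "x \<in> carrier G" "y \<in> carrier G"
  shows "x \<otimes> y \<otimes> inv x \<otimes> inv y \<in> {\<one>, c}"
proof -
  have "x \<otimes> y \<otimes> inv x \<otimes> inv y = x \<otimes> y \<otimes> inv (y \<otimes> x)"
    using assms by (simp add: inv_mult_group m_assoc)
  moreover have "z \<otimes> c \<otimes> inv z = c" if "z \<in> carrier G" for z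
    using that c_commute[OF that, symmetric] by (simp add: m_assoc)
  moreover have "x \<otimes> y = y \<otimes> x \<or> x \<otimes> y = y \<otimes> x \<otimes> c" using commute_or assms by simp
  ultimately show ?thesis using assms by auto
qed

lemma noncommute_commutator:
  assumes "x \<otimes> y \<noteq> y \<otimes> x" "x \<in> carrier G" "y \<in> carrier G"
  shows "x \<otimes> y \<otimes> inv x \<otimes> inv y = c"
proof (rule ccontr)
  assume "\<not> ?thesis"
  then have "x \<otimes> y \<otimes> inv x \<otimes> inv y = \<one>" using commutator_in assms by blast
  then have "x \<otimes> y \<otimes> inv x = y" using assms by (simp add: inv_solve_right')
  then show False using assms by (metis inv_solve_right' m_closed)
qed

text \<open>All commutators of the image lie in {1, c} and a noncommuting pair realizes c, so the
  derived subgroup of P is exactly the preimage of {1, c}.\<close>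

lemma factor_nonabelian:
  assumes P: "group P" and hom: "\<phi> \<in> hom P G" and inj: "inj_on \<phi> (carrier P)"
    and U: "\<phi> ` carrier P = generate G U" and nc: "\<exists>x\<in>U. \<exists>y\<in>U. x \<otimes> y \<noteq> y \<otimes> x"
  shows "factor P \<phi> U"
proof -
  interpret P: group P by (rule P)
  interpret \<phi>: group_hom P G \<phi> by (unfold_locales) (rule hom)
  obtain x y where xy: "x \<in> U" "y \<in> U" "x \<otimes> y \<noteq> y \<otimes> x" using nc by blast
  obtain p q where pq: "p \<in> carrier P" "q \<in> carrier P" "x = \<phi> p" "y = \<phi> q"
    using xy(1,2) U generate.incl by (metis imageE)
  have nonab: "\<not> comm_group P"
  proof
    assume "comm_group P"
    then have "p \<otimes>\<^bsub>P\<^esub> q = q \<otimes>\<^bsub>P\<^esub> p" using pq by (intro comm_groupE(4)) auto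
    then show False using xy(3) pq \<phi>.hom_mult by metis
  qed
  let ?A = "{p \<in> carrier P. \<phi> p \<in> {\<one>, c}}"
  have comm: "\<phi> (u \<otimes>\<^bsub>P\<^esub> v \<otimes>\<^bsub>P\<^esub> inv\<^bsub>P\<^esub> u \<otimes>\<^bsub>P\<^esub> inv\<^bsub>P\<^esub> v) = \<phi> u \<otimes> \<phi> v \<otimes> inv \<phi> u \<otimes> inv \<phi> v"
    if "u \<in> carrier P" "v \<in> carrier P" for u v
    using that by simp
  have "subgroup ?A P"
  proof (rule P.subgroupI)
    show "?A \<noteq> {}" by (auto intro!: exI[of _ "\<one>\<^bsub>P\<^esub>"])
    show "inv\<^bsub>P\<^esub> u \<in> ?A" if "u \<in> ?A" for u
      using that subgroup.m_inv_closed[OF subgroup_one_c, of "\<phi> u"] by simp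
    show "u \<otimes>\<^bsub>P\<^esub> v \<in> ?A" if "u \<in> ?A" "v \<in> ?A" for u v
      using that subgroup.m_closed[OF subgroup_one_c, of "\<phi> u" "\<phi> v"] by simp
  qed auto
  then have "derived P (carrier P) \<subseteq> ?A"
    unfolding derived_def
  proof (rule P.generate_subgroup_incl[rotated], intro subsetI)
    fix r assume "r \<in> derived_set P (carrier P)"
    then obtain u v where "u \<in> carrier P" "v \<in> carrier P"
      "r = u \<otimes>\<^bsub>P\<^esub> v \<otimes>\<^bsub>P\<^esub> inv\<^bsub>P\<^esub> u \<otimes>\<^bsub>P\<^esub> inv\<^bsub>P\<^esub> v" by blast
    then show "r \<in> ?A" using comm[of u v] commutator_in[of "\<phi> u" "\<phi> v"] by simp
  qed
  moreover have "?A \<subseteq> derived P (carrier P)"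
  proof
    fix r assume r: "r \<in> ?A"
    show "r \<in> derived P (carrier P)"
    proof (cases "\<phi> r = \<one>")
      case True
      then have "r = \<one>\<^bsub>P\<^esub>" using r inj by (auto dest: inj_onD[of _ _ r "\<one>\<^bsub>P\<^esub>"])
      then show ?thesis by (simp add: derived_def generate.one)
    next
      case False
      let ?k = "p \<otimes>\<^bsub>P\<^esub> q \<otimes>\<^bsub>P\<^esub> inv\<^bsub>P\<^esub> p \<otimes>\<^bsub>P\<^esub> inv\<^bsub>P\<^esub> q"
      have "\<phi> r = \<phi> ?k" using False r noncommute_commutator xy(3) pq comm by simp
      then have "r = ?k" using inj r pq by (auto dest: inj_onD[of _ _ r ?k])
      then show ?thesis unfolding derived_def using pq by (blast intro: generate.incl)
    qed
  qed
  ultimately have "amalgam_subgroup P = ?A" using nonab by (auto simp: amalgam_subgroup_def)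
  then show ?thesis using assms(1-4) by (simp add: factor_def)
qed

text \<open>Injectivity is checked on normal forms, without counting P. An element b a^i with
  trivial image would make b a power of a, against noncommutation; for a^i the hypothesis
  \<open>ord\<close> takes over. \<open>conj\<close> and \<open>sq\<close> are required in P because
  the normal form is needed there.\<close>

lemma two_generator_factor:
  fixes R :: "nat gword set" and a b :: 'a and e t :: int
  defines "P \<equiv> presented_group {0, 1} R"
  defines "\<alpha> \<equiv> word_class {0, 1} R (gen 0)" and "\<beta> \<equiv> word_class {0, 1} R (gen 1)"
  defines "h \<equiv> \<lambda>x::nat. if x = 0 then a else b"
  assumes ab: "a \<in> carrier G" "b \<in> carrier G" "a \<otimes> b \<noteq> b \<otimes> a"
    and R: "\<And>r. r \<in> R \<Longrightarrow> eval_word G h r = \<one>"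
    and conj: "\<alpha> \<otimes>\<^bsub>P\<^esub> \<beta> = \<beta> \<otimes>\<^bsub>P\<^esub> \<alpha> [^]\<^bsub>P\<^esub> e" and sq: "\<beta> \<otimes>\<^bsub>P\<^esub> \<beta> = \<alpha> [^]\<^bsub>P\<^esub> t"
    and ord: "\<And>i::int. a [^] i = \<one> \<Longrightarrow> \<alpha> [^]\<^bsub>P\<^esub> i = \<one>\<^bsub>P\<^esub>"
  shows "factor P (presented_hom G h) {a, b}"
proof (rule factor_nonabelian)
  interpret P: group P unfolding P_def by (rule group_presented_group)
  have h: "h x \<in> carrier G" for x using ab by (simp add: h_def)
  show "group P" by (rule P.is_group)
  show hom: "presented_hom G h \<in> hom P G"
    unfolding P_def by (rule presented_hom_hom[OF h R])
  have "h ` {0, 1} = {a, b}" by (auto simp: h_def)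
  then show "presented_hom G h ` carrier P = generate G {a, b}"
    unfolding P_def using presented_hom_image[of h R "{0, 1}", OF h R] by simp
  show "\<exists>x\<in>{a, b}. \<exists>y\<in>{a, b}. x \<otimes> y \<noteq> y \<otimes> x" using ab(3) by blast
  interpret \<phi>: group_hom P G "presented_hom G h" by unfold_locales (rule hom)
  have c [simp]: "\<alpha> \<in> carrier P" "\<beta> \<in> carrier P"
    by (auto simp: \<alpha>_def \<beta>_def P_def gen_def intro!: word_class_in_carrier)
  have \<phi>: "presented_hom G h \<alpha> = a" "presented_hom G h \<beta> = b"
    unfolding \<alpha>_def \<beta>_def by (simp_all add: presented_hom_word_class[OF h R] eval_word_gen[OF h], simp_all add: h_def)
  have elem: "\<exists>i::int. A = \<alpha> [^]\<^bsub>P\<^esub> i \<or> A = \<beta> \<otimes>\<^bsub>P\<^esub> \<alpha> [^]\<^bsub>P\<^esub> i" if A: "A \<in> carrier P" for A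
  proof (rule P.generate_two[OF c conj sq])
    let ?h = "\<lambda>x. if x \<in> {0, 1} then word_class {0, 1} R (gen x) else \<one>\<^bsub>P\<^esub>"
    obtain w where w: "w \<in> lists ({0, 1} \<times> UNIV)" "A = word_class {0, 1} R w"
      using A unfolding P_def by (rule presented_group_cases)
    have "?h x \<in> carrier P" for x using c by (auto simp: \<alpha>_def \<beta>_def)
    then have "eval_word P ?h w \<in> generate P (?h ` {0, 1})"
      using w(1) by (rule P.eval_word_in_generate)
    moreover have "eval_word P ?h w = A"
      unfolding w(2) P_def by (rule presented_group_word_class[OF w(1)])
    moreover have "?h ` {0, 1} = {\<alpha>, \<beta>}" by (auto simp: \<alpha>_def \<beta>_def)
    ultimately show "A \<in> generate P {\<alpha>, \<beta>}" by simp
  qed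
  show "inj_on (presented_hom G h) (carrier P)"
    unfolding \<phi>.inj_on_one_iff
  proof (intro allI impI)
    fix A assume A: "A \<in> carrier P" "presented_hom G h A = \<one>"
    obtain i :: int where "A = \<alpha> [^]\<^bsub>P\<^esub> i \<or> A = \<beta> \<otimes>\<^bsub>P\<^esub> \<alpha> [^]\<^bsub>P\<^esub> i" using elem[OF A(1)] by blast
    then consider "A = \<alpha> [^]\<^bsub>P\<^esub> i" | "A = \<beta> \<otimes>\<^bsub>P\<^esub> \<alpha> [^]\<^bsub>P\<^esub> i" by blast
    then show "A = \<one>\<^bsub>P\<^esub>"
    proof cases
      case 1
      then have "a [^] i = \<one>" using A(2) by (simp add: \<phi>.hom_int_pow \<phi>)
      then show ?thesis using ord 1 by simp
    next
      case 2
      then have "b \<otimes> a [^] i = \<one>" using A(2) by (simp add: \<phi>.hom_int_pow \<phi>)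
      then have "b = inv (a [^] i)" using ab by (simp add: inv_equality)
      then have "b = a [^] (- i)" using ab by (simp add: int_pow_neg)
      then have "a \<otimes> b = b \<otimes> a"
        using ab int_pow_mult[of a 1 "- i"] int_pow_mult[of a "- i" 1] by simp
      then show ?thesis using ab(3) by simp
    qed
  qed
qed

end

subsection \<open>The factors\<close>

context two_commutator_group
begin

text \<open>The order divides 2^(k + 1) since c^2 = 1, but not 2^k since c is not 1.\<close>

lemma pow_two_pow_c:
  assumes a: "a \<in> carrier G" "a [^] (2 ^ k :: nat) = c"
  shows "ord a = 2 ^ Suc k"
proof -
  have "a [^] (2 ^ Suc k :: nat) = a [^] (2 ^ k :: nat) \<otimes> a [^] (2 ^ k :: nat)"
    using a(1) by (simp add: nat_pow_mult mult_2)
  then have "a [^] (2 ^ Suc k :: nat) = \<one>" using a(2) c_square by simp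
  then have "ord a dvd 2 ^ Suc k" using pow_eq_id[OF a(1)] by blast
  then obtain j where j: "j \<le> Suc k" "ord a = 2 ^ j"
    using divides_primepow_nat[of 2 "ord a" "Suc k"] by auto
  have "\<not> ord a dvd 2 ^ k" using pow_eq_id[OF a(1)] a(2) c_neq_one by metis
  then have "\<not> j \<le> k" using j(2) by (metis le_imp_power_dvd)
  then show ?thesis using j by (simp add: le_antisym not_less_eq_eq)
qed

text \<open>Odd powers of a do not commute with b, and no b a^i commutes with a, so only <a^2> is
  left as center of <a, b>. For D_8 and Q_8 this is <c>, for M_2(m + 1, 1) it is <d>. The hypothesis
  \<open>conj\<close> writes the conjugate a c of a by b as a power of a.\<close>

lemma centralizing_generate_two:
  fixes e t :: int
  assumes ab: "a \<in> carrier G" "b \<in> carrier G" "a \<otimes> b \<noteq> b \<otimes> a"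
    and conj: "a \<otimes> c = a [^] e" and sq: "b \<otimes> b = a [^] t"
    and x: "x \<in> generate G {a, b}" "x \<otimes> a = a \<otimes> x" "x \<otimes> b = b \<otimes> x"
  shows "x \<in> generate G {a \<otimes> a}"
proof -
  have pow_comm: "a [^] i \<otimes> a = a \<otimes> a [^] i" for i :: int
    using ab(1) int_pow_mult[of a i 1] int_pow_mult[of a 1 i] by (simp add: add.commute)
  have "a \<otimes> b = b \<otimes> a [^] e" using noncommute[OF ab(3,1,2)] conj by simp
  then obtain i :: int where "x = a [^] i \<or> x = b \<otimes> a [^] i"
    using generate_two[OF ab(1,2) _ sq x(1)] by blast
  then consider "x = a [^] i" | "x = b \<otimes> a [^] i" by blast
  then show ?thesis
  proof cases
    case 1
    let ?y = "(a \<otimes> a) [^] (i div 2)"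
    have y: "?y \<in> generate G {a \<otimes> a}"
      using ab by (intro group.generate_pow[THEN equalityD2, THEN subsetD]) (auto simp: is_group)
    have yG: "?y \<in> carrier G" using ab by simp
    have "(a \<otimes> a) [^] j = a [^] (2 * j)" for j :: int
      using ab int_pow_pow[of a 2 j] by (simp add: int_pow_def2 numeral_2_eq_2)
    then have x': "x = ?y \<otimes> a [^] (i mod 2)"
      using 1 ab by (simp flip: int_pow_mult)
    have yb: "?y \<otimes> b = b \<otimes> ?y"
      using commute_generate[OF y _ _ ab(2)] noncommute_mult[of a b a] ab by simp
    show ?thesis
    proof (cases "even i")
      case True
      then show ?thesis using x' y yG by (simp add: even_iff_mod_2_eq_zero)
    next
      case False
      then have "x = ?y \<otimes> a" using x' ab by (simp add: odd_iff_mod_2_eq_one)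
      moreover have "a \<otimes> ?y = ?y \<otimes> a" using pow_comm[of "2 * (i div 2)"] \<open>\<And>j. (a \<otimes> a) [^] j = a [^] (2 * j)\<close> by simp
      ultimately have "x \<otimes> b \<noteq> b \<otimes> x"
        using noncommute_mult_commute[OF ab(3) yb ab(1) yG ab(2)] by simp
      then show ?thesis using x(3) by simp
    qed
  next
    case 2
    have "b \<otimes> a \<noteq> a \<otimes> b" using ab(3) by metis
    from noncommute_mult_commute[OF this pow_comm[of i]] show ?thesis using x(2) 2 ab by simp
  qed
qed

text \<open>One presentation covers D_8, Q_8 and M_2(m + 1, 1): a^(2^(k+1)) = 1, \<open>W\<close>
  says b^2 = a^t, and \<open>V\<close> is the word for a^b = a^e. The last four hypotheses give
  \<open>V\<close> and \<open>W\<close> this meaning both in G and in the presented group. D_8 has k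
  = 1, e = -1, t = 0; Q_8 has k = 1, e = -1, t = 2; M_2(m + 1, 1) has k = m, e = 1 + 2^m, t =
  0.\<close>

lemma two_power_factor:
  fixes a b :: 'a and V W :: "nat gword" and e t :: int and k :: nat
  defines "R \<equiv> {pow_word (gen 0) (2 ^ Suc k), W, conj_word (gen 0) (gen 1) @ inv_word V}"
  defines "P \<equiv> presented_group {0, 1} R"
  assumes ab: "a \<in> carrier G" "b \<in> carrier G" "a \<otimes> b \<noteq> b \<otimes> a"
    and conj: "a \<otimes> c = a [^] e" and sq: "b \<otimes> b = a [^] t" and pow: "a [^] (2 ^ k :: nat) = c"
    and words: "V \<in> lists ({0, 1} \<times> UNIV)" "W \<in> lists ({0, 1} \<times> UNIV)"
    and VG: "\<And>h. (\<And>x. h x \<in> carrier G) \<Longrightarrow> eval_word G h V = h 0 [^] e"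
    and VP: "\<And>h. (\<And>x. h x \<in> carrier P) \<Longrightarrow> eval_word P h V = h 0 [^]\<^bsub>P\<^esub> e"
    and WG: "\<And>h. (\<And>x. h x \<in> carrier G) \<Longrightarrow> h 1 \<otimes> h 1 = h 0 [^] t \<Longrightarrow> eval_word G h W = \<one>"
    and WP: "\<And>h. (\<And>x. h x \<in> carrier P) \<Longrightarrow> eval_word P h W = \<one>\<^bsub>P\<^esub> \<Longrightarrow> h 1 \<otimes>\<^bsub>P\<^esub> h 1 = h 0 [^]\<^bsub>P\<^esub> t"
  shows "\<exists>\<phi>. factor P \<phi> {a, b}"
proof -
  interpret P: group P unfolding P_def by (rule group_presented_group)
  define h where "h = (\<lambda>x::nat. if x = 0 then a else b)"
  define g where "g = (\<lambda>x. if x \<in> {0, 1} then word_class {0, 1} R (gen x) else \<one>\<^bsub>P\<^esub>)"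
  have h: "h x \<in> carrier G" for x using ab by (simp add: h_def)
  have g: "g x \<in> carrier P" for x
    using word_class_in_carrier[of "gen x" "{0, 1}" R] unfolding g_def P_def[symmetric]
    by (simp add: gen_def)
  have R_words: "r \<in> lists ({0, 1} \<times> UNIV)" if "r \<in> R" for r
  proof -
    have g: "gen 0 \<in> lists ({0::nat, 1} \<times> UNIV)" "gen 1 \<in> lists ({0::nat, 1} \<times> UNIV)"
      by (simp_all add: gen_in_lists)
    have "pow_word (gen 0) (2 ^ Suc k) \<in> lists ({0::nat, 1} \<times> UNIV)"
      by (rule pow_word_in_lists[OF g(1)])
    moreover have "conj_word (gen 0) (gen 1) @ inv_word V \<in> lists ({0::nat, 1} \<times> UNIV)"
      unfolding conj_word_def append_in_lists_conv
      by (intro conjI inv_word_in_lists g words(1))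
    moreover note words(2)
    ultimately show ?thesis using that unfolding R_def by (elim insertE emptyE; simp only:)
  qed
  have rel: "eval_word P g r = \<one>\<^bsub>P\<^esub>" if "r \<in> R" for r
    using presented_group_word_class[OF R_words[OF that], of R] relator_word_class[OF that]
    unfolding g_def P_def by simp
  have ev: "eval_word H j (conj_word (gen 0) (gen 1)) = inv\<^bsub>H\<^esub> j 1 \<otimes>\<^bsub>H\<^esub> (j 0 \<otimes>\<^bsub>H\<^esub> j 1)"
    if "group H" "\<And>x::nat. j x \<in> carrier H" for H :: "('h, 'i) monoid_scheme" and j
    using that by (simp add: conj_word_def group.eval_word_append group.eval_word_inv group.eval_word_gen)
  show ?thesis
    unfolding P_def
  proof (rule exI, rule two_generator_factor[OF ab])
    fix r assume "r \<in> R"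
    then consider "r = pow_word (gen 0) (2 ^ Suc k)" | "r = W"
      | "r = conj_word (gen 0) (gen 1) @ inv_word V" unfolding R_def by blast
    then have "eval_word G h r = \<one>"
    proof cases
      case 1
      then show ?thesis
        using pow_eq_id[OF ab(1), of "2 ^ Suc k"] pow_two_pow_c[OF ab(1) pow]
        by (simp del: power_Suc add: eval_word_pow[OF h] eval_word_gen[OF h], simp add: h_def)
    next
      case 2
      then show ?thesis using WG[OF h] sq by (simp add: h_def)
    next
      case 3
      \<comment> \<open>The conjugate of a by b is a c, because a and b do not commute.\<close>
      have "inv b \<otimes> (a \<otimes> b) = a [^] e"
        using noncommute[OF ab(3,1,2)] conj ab by (simp add: m_assoc[symmetric])
      then show ?thesis
        unfolding 3 eval_word_append[OF h] eval_word_inv[OF h] VG[OF h] ev[OF is_group h]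
        using ab by (simp add: h_def)
    qed
    then show "eval_word G (\<lambda>x. if x = 0 then a else b) r = \<one>" by (simp add: h_def)
  next
    have "eval_word P g (conj_word (gen 0) (gen 1) @ inv_word V) = \<one>\<^bsub>P\<^esub>"
      by (rule rel) (simp add: R_def)
    then have "(inv\<^bsub>P\<^esub> g 1 \<otimes>\<^bsub>P\<^esub> (g 0 \<otimes>\<^bsub>P\<^esub> g 1)) \<otimes>\<^bsub>P\<^esub> inv\<^bsub>P\<^esub> (g 0 [^]\<^bsub>P\<^esub> e) = \<one>\<^bsub>P\<^esub>"
      by (simp only: P.eval_word_append[OF g] P.eval_word_inv[OF g] VP[OF g] ev[OF P.is_group g])
    then have "inv\<^bsub>P\<^esub> g 1 \<otimes>\<^bsub>P\<^esub> (g 0 \<otimes>\<^bsub>P\<^esub> g 1) = g 0 [^]\<^bsub>P\<^esub> e"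
      using g by (metis P.int_pow_closed P.inv_closed P.inv_equality P.inv_inv P.m_closed)
    then have "g 0 \<otimes>\<^bsub>P\<^esub> g 1 = g 1 \<otimes>\<^bsub>P\<^esub> g 0 [^]\<^bsub>P\<^esub> e"
      using P.inv_solve_left[of "g 0 [^]\<^bsub>P\<^esub> e" "g 1" "g 0 \<otimes>\<^bsub>P\<^esub> g 1"] g by simp
    then show "word_class {0, 1} R (gen 0) \<otimes>\<^bsub>presented_group {0, 1} R\<^esub> word_class {0, 1} R (gen 1) =
      word_class {0, 1} R (gen 1) \<otimes>\<^bsub>presented_group {0, 1} R\<^esub> word_class {0, 1} R (gen 0) [^]\<^bsub>presented_group {0, 1} R\<^esub> e"
      by (simp add: g_def P_def)
  next
    have "g 1 \<otimes>\<^bsub>P\<^esub> g 1 = g 0 [^]\<^bsub>P\<^esub> t"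
      by (rule WP[OF g rel]) (simp add: R_def)
    then show "word_class {0, 1} R (gen 1) \<otimes>\<^bsub>presented_group {0, 1} R\<^esub> word_class {0, 1} R (gen 1) =
      word_class {0, 1} R (gen 0) [^]\<^bsub>presented_group {0, 1} R\<^esub> t"
      by (simp add: g_def P_def)
  next
    fix i :: int assume "a [^] i = \<one>"
    \<comment> \<open>The order of a in G is the exponent of the first relator, so a^i = 1 in G
      forces the same equation in the presented group.\<close>
    then have "int (2 ^ Suc k) dvd i"
      using int_pow_eq_id[OF ab(1)] pow_two_pow_c[OF ab(1) pow] by metis
    then obtain j where j: "i = int (2 ^ Suc k) * j" by blast
    have "eval_word P g (pow_word (gen 0) (2 ^ Suc k)) = \<one>\<^bsub>P\<^esub>" by (rule rel) (simp add: R_def)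
    then have "g 0 [^]\<^bsub>P\<^esub> int (2 ^ Suc k) = \<one>\<^bsub>P\<^esub>"
      by (simp only: P.eval_word_pow[OF g] P.eval_word_gen[OF g] int_pow_int)
    then have "g 0 [^]\<^bsub>P\<^esub> i = \<one>\<^bsub>P\<^esub>"
      unfolding j using P.int_pow_pow[OF g, of 0 "int (2 ^ Suc k)" j] by simp
    then show "word_class {0, 1} R (gen 0) [^]\<^bsub>presented_group {0, 1} R\<^esub> i = \<one>\<^bsub>presented_group {0, 1} R\<^esub>"
      by (simp add: g_def P_def)
  qed
qed

lemma square_c_inv:
  assumes "a \<in> carrier G" "a \<otimes> a = c"
  shows "inv a = a \<otimes> c"
proof (rule inv_equality)
  have "a \<otimes> c \<otimes> a = c \<otimes> (a \<otimes> a)"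
    unfolding c_commute[OF assms(1), symmetric] by (rule m_assoc) (use assms in auto)
  then show "a \<otimes> c \<otimes> a = \<one>" using assms c_square by simp
qed (use assms in auto)

lemma D8_factor:
  assumes "a \<in> carrier G" "b \<in> carrier G" "D8_pair a b"
  shows "\<exists>\<phi>. factor D8_group \<phi> {a, b}"
    and "x \<in> generate G {a, b} \<Longrightarrow> x \<otimes> a = a \<otimes> x \<Longrightarrow> x \<otimes> b = b \<otimes> x \<Longrightarrow> x \<in> generate G {c}"
proof -
  have conj: "a \<otimes> c = a [^] (-1 :: int)"
    using square_c_inv[of a] assms by (simp add: int_pow_neg)
  have sq: "b \<otimes> b = a [^] (0 :: int)" using assms by simp
  have pow: "a [^] (2 ^ 1 :: nat) = c" using assms by (simp add: numeral_2_eq_2)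
  have nc: "a \<otimes> b \<noteq> b \<otimes> a" using assms by simp
  let ?P = "presented_group {0, 1} {pow_word (gen (0::nat)) (2 ^ Suc 1), pow_word (gen 1) 2,
    conj_word (gen 0) (gen 1) @ inv_word (inv_word (gen 0))}"
  have "\<exists>\<phi>. factor ?P \<phi> {a, b}"
  proof (rule two_power_factor[OF assms(1,2) nc conj sq pow])
    show "inv_word (gen 0) \<in> lists ({0, 1} \<times> UNIV)" "pow_word (gen 1) 2 \<in> lists ({0, 1} \<times> UNIV)"
      unfolding append_in_lists_conv
      by (intro conjI pow_word_in_lists inv_word_in_lists gen_in_lists; simp)+
    show "eval_word G h (inv_word (gen 0)) = h 0 [^] (- 1 :: int)"
      if "\<And>x. h x \<in> carrier G" for h :: "nat \<Rightarrow> 'a"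
      by (rule eval_word_gen_inv[OF that])
    show "eval_word ?P h (inv_word (gen 0)) = h 0 [^]\<^bsub>?P\<^esub> (- 1 :: int)"
      if "\<And>x. h x \<in> carrier ?P" for h
      by (rule group.eval_word_gen_inv[OF group_presented_group that])
    show "eval_word G h (pow_word (gen 1) 2) = \<one>"
      if "\<And>x. h x \<in> carrier G" "h 1 \<otimes> h 1 = h 0 [^] (0 :: int)" for h :: "nat \<Rightarrow> 'a"
      by (rule iffD2[OF eval_word_square_eq_one_iff[OF that(1)] that(2)])
    show "h 1 \<otimes>\<^bsub>?P\<^esub> h 1 = h 0 [^]\<^bsub>?P\<^esub> (0 :: int)"
      if "\<And>x. h x \<in> carrier ?P" "eval_word ?P h (pow_word (gen 1) 2) = \<one>\<^bsub>?P\<^esub>" for h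
      by (rule iffD1[OF group.eval_word_square_eq_one_iff[OF group_presented_group that(1)] that(2)])
  qed
  then show "\<exists>\<phi>. factor D8_group \<phi> {a, b}" by (simp add: D8_group_def Let_def)
  show "x \<in> generate G {c}" if "x \<in> generate G {a, b}" "x \<otimes> a = a \<otimes> x" "x \<otimes> b = b \<otimes> x"
    using centralizing_generate_two[OF assms(1,2) nc conj sq that] assms by simp
qed

lemma Q8_factor:
  assumes "a \<in> carrier G" "b \<in> carrier G" "a \<otimes> b \<noteq> b \<otimes> a" "a \<otimes> a = c" "b \<otimes> b = c"
  shows "\<exists>\<phi>. factor Q8_group \<phi> {a, b}"
    and "x \<in> generate G {a, b} \<Longrightarrow> x \<otimes> a = a \<otimes> x \<Longrightarrow> x \<otimes> b = b \<otimes> x \<Longrightarrow> x \<in> generate G {c}"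
proof -
  have conj: "a \<otimes> c = a [^] (-1 :: int)"
    using square_c_inv[of a] assms by (simp add: int_pow_neg)
  have sq: "b \<otimes> b = a [^] (2 :: int)" using assms by (simp add: int_pow_def2 numeral_2_eq_2)
  have pow: "a [^] (2 ^ 1 :: nat) = c" using assms by (simp add: numeral_2_eq_2)
  let ?P = "presented_group {0, 1} {pow_word (gen (0::nat)) (2 ^ Suc 1),
    pow_word (gen 1) 2 @ inv_word (pow_word (gen 0) 2),
    conj_word (gen 0) (gen 1) @ inv_word (inv_word (gen 0))}"
  have "\<exists>\<phi>. factor ?P \<phi> {a, b}"
  proof (rule two_power_factor[OF assms(1-3) conj sq pow])
    show "inv_word (gen 0) \<in> lists ({0, 1} \<times> UNIV)" "pow_word (gen 1) 2 @ inv_word (pow_word (gen 0) 2) \<in> lists ({0, 1} \<times> UNIV)"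
      unfolding append_in_lists_conv
      by (intro conjI pow_word_in_lists inv_word_in_lists gen_in_lists; simp)+
    show "eval_word G h (inv_word (gen 0)) = h 0 [^] (- 1 :: int)"
      if "\<And>x. h x \<in> carrier G" for h :: "nat \<Rightarrow> 'a"
      by (rule eval_word_gen_inv[OF that])
    show "eval_word ?P h (inv_word (gen 0)) = h 0 [^]\<^bsub>?P\<^esub> (- 1 :: int)"
      if "\<And>x. h x \<in> carrier ?P" for h
      by (rule group.eval_word_gen_inv[OF group_presented_group that])
    show "eval_word G h (pow_word (gen 1) 2 @ inv_word (pow_word (gen 0) 2)) = \<one>"
      if "\<And>x. h x \<in> carrier G" "h 1 \<otimes> h 1 = h 0 [^] (2 :: int)" for h :: "nat \<Rightarrow> 'a"
      by (rule iffD2[OF eval_word_square_eq_iff[OF that(1)] that(2)])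
    show "h 1 \<otimes>\<^bsub>?P\<^esub> h 1 = h 0 [^]\<^bsub>?P\<^esub> (2 :: int)"
      if "\<And>x. h x \<in> carrier ?P" "eval_word ?P h (pow_word (gen 1) 2 @ inv_word (pow_word (gen 0) 2)) = \<one>\<^bsub>?P\<^esub>" for h
      by (rule iffD1[OF group.eval_word_square_eq_iff[OF group_presented_group that(1)] that(2)])
  qed
  then show "\<exists>\<phi>. factor Q8_group \<phi> {a, b}" by (simp add: Q8_group_def Let_def)
  show "x \<in> generate G {c}" if "x \<in> generate G {a, b}" "x \<otimes> a = a \<otimes> x" "x \<otimes> b = b \<otimes> x"
    using centralizing_generate_two[OF assms(1-3) conj sq that] assms by simp
qed

lemma M2_factor:
  assumes "a \<in> carrier G" "b \<in> carrier G" "a \<otimes> b \<noteq> b \<otimes> a" "b \<otimes> b = \<one>"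
    and pow: "a [^] (2 ^ m :: nat) = c"
  shows "\<exists>\<phi>. factor (M2_group (m + 1) 1) \<phi> {a, b}"
    and "x \<in> generate G {a, b} \<Longrightarrow> x \<otimes> a = a \<otimes> x \<Longrightarrow> x \<otimes> b = b \<otimes> x \<Longrightarrow> x \<in> generate G {a \<otimes> a}"
proof -
  have conj: "a \<otimes> c = a [^] (int (1 + 2 ^ m))"
    using assms(1) pow nat_pow_mult[of a 1 "2 ^ m"] unfolding int_pow_int by simp
  have sq: "b \<otimes> b = a [^] (0 :: int)" using assms by simp
  let ?P = "presented_group {0, 1} {pow_word (gen (0::nat)) (2 ^ Suc m), pow_word (gen 1) 2,
    conj_word (gen 0) (gen 1) @ inv_word (pow_word (gen 0) (1 + 2 ^ m))}"
  have "\<exists>\<phi>. factor ?P \<phi> {a, b}"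
  proof (rule two_power_factor[OF assms(1-3) conj sq pow])
    show "pow_word (gen 0) (1 + 2 ^ m) \<in> lists ({0, 1} \<times> UNIV)" "pow_word (gen 1) 2 \<in> lists ({0, 1} \<times> UNIV)"
      unfolding append_in_lists_conv
      by (intro conjI pow_word_in_lists inv_word_in_lists gen_in_lists; simp)+
    show "eval_word G h (pow_word (gen 0) (1 + 2 ^ m)) = h 0 [^] int (1 + 2 ^ m)"
      if "\<And>x. h x \<in> carrier G" for h :: "nat \<Rightarrow> 'a"
      by (rule eval_word_gen_pow[OF that])
    show "eval_word ?P h (pow_word (gen 0) (1 + 2 ^ m)) = h 0 [^]\<^bsub>?P\<^esub> int (1 + 2 ^ m)"
      if "\<And>x. h x \<in> carrier ?P" for h
      by (rule group.eval_word_gen_pow[OF group_presented_group that])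
    show "eval_word G h (pow_word (gen 1) 2) = \<one>"
      if "\<And>x. h x \<in> carrier G" "h 1 \<otimes> h 1 = h 0 [^] (0 :: int)" for h :: "nat \<Rightarrow> 'a"
      by (rule iffD2[OF eval_word_square_eq_one_iff[OF that(1)] that(2)])
    show "h 1 \<otimes>\<^bsub>?P\<^esub> h 1 = h 0 [^]\<^bsub>?P\<^esub> (0 :: int)"
      if "\<And>x. h x \<in> carrier ?P" "eval_word ?P h (pow_word (gen 1) 2) = \<one>\<^bsub>?P\<^esub>" for h
      by (rule iffD1[OF group.eval_word_square_eq_one_iff[OF group_presented_group that(1)] that(2)])
  qed
  then show "\<exists>\<phi>. factor (M2_group (m + 1) 1) \<phi> {a, b}" by (simp add: M2_group_def Let_def)
  show "x \<in> generate G {a \<otimes> a}" if "x \<in> generate G {a, b}" "x \<otimes> a = a \<otimes> x" "x \<otimes> b = b \<otimes> x"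
    by (rule centralizing_generate_two[OF assms(1-3) conj sq that])
qed

text \<open>c is the only involution in <d>; this matters because the amalgamated subgroup of an
  abelian factor is defined by x^2 = 1.\<close>

lemma square_one_pow:
  fixes j k :: nat
  assumes d: "d \<in> carrier G" "d [^] (2 ^ k :: nat) = c" and sq: "d [^] j \<otimes> d [^] j = \<one>"
  shows "d [^] j \<in> {\<one>, c}"
proof -
  have "d [^] (2 * j) = \<one>" using sq d(1) by (simp add: nat_pow_mult mult_2)
  then have "2 ^ Suc k dvd 2 * j" using pow_eq_id[OF d(1)] pow_two_pow_c[OF d] by metis
  then obtain i where "j = 2 ^ k * i" by auto
  then have "d [^] j = c [^] i" using d by (simp flip: nat_pow_pow)
  moreover have "c [^] i \<in> {\<one>, c}" by (induction i) (auto simp: c_square)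
  ultimately show ?thesis by simp
qed

text \<open>Every element is a power with exponent below 2^(k + 1), the order of d in G, which gives
  injectivity. The amalgamated subgroup is found through the abelian branch of its definition, with
  \<open>square_one_pow\<close>.\<close>

lemma cyclic_factor:
  assumes d: "d \<in> carrier G" "d [^] (2 ^ k :: nat) = c"
  shows "\<exists>\<phi>. factor (cyclic_presented (2 ^ Suc k)) \<phi> {d}"
proof -
  define h where "h = (\<lambda>x::nat. d)"
  let ?R = "{pow_word (gen (0::nat)) (2 ^ Suc k)}" and ?P = "cyclic_presented (2 ^ Suc k)"
  have h: "h x \<in> carrier G" for x using d by (simp add: h_def)
  have R: "eval_word G h r = \<one>" if "r \<in> ?R" for r
    using that pow_eq_id[OF d(1), of "2 ^ Suc k"] pow_two_pow_c[OF d]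
    by (simp del: power_Suc add: eval_word_pow[OF h] eval_word_gen[OF h], simp add: h_def)
  let ?\<phi> = "presented_hom G h"
  interpret P: group ?P unfolding cyclic_presented_def by (rule group_presented_group)
  have hom: "?\<phi> \<in> hom ?P G" unfolding cyclic_presented_def by (rule presented_hom_hom[OF h R])
  interpret \<phi>: group_hom ?P G ?\<phi> by unfold_locales (rule hom)
  have elem: "\<exists>j<2 ^ Suc k. A = word_class {0} ?R (pow_word (gen 0) j) \<and> ?\<phi> A = d [^] j"
    if A: "A \<in> carrier ?P" for A
  proof -
    obtain w where w: "w \<in> lists ({0} \<times> UNIV)" "A = word_class {0} ?R w"
      using A unfolding cyclic_presented_def by (rule presented_group_cases)
    obtain j where "j < 2 ^ Suc k" "word_eq {0} ?R w (pow_word (gen 0) j)"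
      using word_eq_cyclic_normal_form[OF _ w(1), of "2 ^ Suc k"] by auto
    then have "j < 2 ^ Suc k" "A = word_class {0} ?R (pow_word (gen 0) j)"
      using w(2) by (simp_all only: word_class_eq_iff)
    moreover from this(2) have "?\<phi> A = d [^] j"
      by (simp only: presented_hom_word_class[OF h R] eval_word_pow[OF h] eval_word_gen[OF h], simp only: h_def)
    ultimately show ?thesis by blast
  qed
  have inj: "inj_on ?\<phi> (carrier ?P)"
    unfolding \<phi>.inj_on_one_iff
  proof (intro allI impI)
    fix A assume A: "A \<in> carrier ?P" "?\<phi> A = \<one>"
    obtain j where j: "j < 2 ^ Suc k" "A = word_class {0} ?R (pow_word (gen 0) j)" "?\<phi> A = d [^] j"
      using elem[OF A(1)] by blast
    then have "2 ^ Suc k dvd j" using A(2) pow_eq_id[OF d(1), of j] pow_two_pow_c[OF d] by simp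
    then have "j = 0" using j(1) by (auto dest: dvd_imp_le)
    then show "A = \<one>\<^bsub>?P\<^esub>" using j(2) by (simp add: cyclic_presented_def presented_group_def pow_word_def)
  qed
  have "comm_group ?P"
  proof (rule P.group_comm_groupI)
    fix A B assume AB: "A \<in> carrier ?P" "B \<in> carrier ?P"
    obtain i j :: nat where "?\<phi> A = d [^] i" "?\<phi> B = d [^] j" using elem[OF AB(1)] elem[OF AB(2)] by blast
    then have "?\<phi> (A \<otimes>\<^bsub>?P\<^esub> B) = ?\<phi> (B \<otimes>\<^bsub>?P\<^esub> A)"
      using AB d by (simp del: power_Suc add: nat_pow_mult add.commute)
    then show "A \<otimes>\<^bsub>?P\<^esub> B = B \<otimes>\<^bsub>?P\<^esub> A" 
      by (rule inj_onD[OF inj _ P.m_closed[OF AB] P.m_closed[OF AB(2,1)]])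
  qed
  then have "amalgam_subgroup ?P = {p \<in> carrier ?P. p \<otimes>\<^bsub>?P\<^esub> p = \<one>\<^bsub>?P\<^esub>}"
    by (simp add: amalgam_subgroup_def)
  moreover have "A \<otimes>\<^bsub>?P\<^esub> A = \<one>\<^bsub>?P\<^esub> \<longleftrightarrow> ?\<phi> A \<in> {\<one>, c}" if A: "A \<in> carrier ?P" for A
  proof -
    obtain j where j: "?\<phi> A = d [^] (j::nat)" using elem[OF A] by blast
    have "A \<otimes>\<^bsub>?P\<^esub> A = \<one>\<^bsub>?P\<^esub> \<longleftrightarrow> ?\<phi> A \<otimes> ?\<phi> A = \<one>"
      using inj_onD[OF inj _ P.m_closed[OF A A] P.one_closed] \<phi>.hom_mult[OF A A] \<phi>.hom_one by metis
    also have "\<dots> \<longleftrightarrow> ?\<phi> A \<in> {\<one>, c}"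
      using square_one_pow[OF d, of j] c_square j by auto
    finally show ?thesis .
  qed
  ultimately have "amalgam_subgroup ?P = {p \<in> carrier ?P. ?\<phi> p \<in> {\<one>, c}}" by blast
  then have "factor ?P ?\<phi> {d}"
    using presented_hom_image[of h ?R "{0}", OF h R] hom inj P.is_group
    by (simp add: factor_def cyclic_presented_def h_def)
  then show ?thesis by blast
qed

end

subsection \<open>Recognizing central products\<close>

text \<open>G is not abelian, so the order of the terms is part of the data.\<close>

definition (in monoid) list_prod :: "('i \<Rightarrow> 'a) \<Rightarrow> 'i list \<Rightarrow> 'a"
  where "list_prod f xs = foldr (\<lambda>i g. f i \<otimes> g) xs \<one>"

context group
begin

lemma list_prod_simps [simp]:
  "list_prod f [] = \<one>" "list_prod f (i # xs) = f i \<otimes> list_prod f xs"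
  by (simp_all add: list_prod_def)

lemma list_prod_in_subgroup:
  assumes "subgroup H G" "\<And>i. i \<in> set xs \<Longrightarrow> f i \<in> H"
  shows "list_prod f xs \<in> H"
  using assms(2) by (induction xs) (auto intro: subgroup.one_closed subgroup.m_closed assms(1))

lemma list_prod_closed: "(\<And>i. i \<in> set xs \<Longrightarrow> f i \<in> carrier G) \<Longrightarrow> list_prod f xs \<in> carrier G"
  by (rule list_prod_in_subgroup[OF subgroup_self])

lemma list_prod_append:
  assumes "\<And>i. i \<in> set (xs @ ys) \<Longrightarrow> f i \<in> carrier G"
  shows "list_prod f (xs @ ys) = list_prod f xs \<otimes> list_prod f ys"
  using assms by (induction xs) (auto simp: m_assoc list_prod_closed)

lemma list_prod_cong: "(\<And>i. i \<in> set xs \<Longrightarrow> f i = g i) \<Longrightarrow> list_prod f xs = list_prod g xs"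
  by (induction xs) auto

lemma list_prod_map: "list_prod f (map g xs) = list_prod (\<lambda>i. f (g i)) xs"
  by (induction xs) auto

lemma list_prod_one: "(\<And>i. i \<in> set xs \<Longrightarrow> f i = \<one>) \<Longrightarrow> list_prod f xs = \<one>"
  by (induction xs) auto

lemma list_prod_single:
  assumes "distinct xs" "i \<in> set xs" "f i \<in> carrier G" "\<And>j. j \<in> set xs \<Longrightarrow> j \<noteq> i \<Longrightarrow> f j = \<one>"
  shows "list_prod f xs = f i"
  using assms
proof (induction xs)
  case (Cons j xs)
  show ?case
  proof (cases "j = i")
    case True
    then have "list_prod f xs = \<one>" using Cons.prems by (intro list_prod_one) auto
    then show ?thesis using True Cons.prems by simp
  next
    case False
    then show ?thesis using Cons by auto
  qed
qed simp

lemma list_prod_commute: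
  assumes q: "q \<in> carrier G" and f: "\<And>i. i \<in> set xs \<Longrightarrow> f i \<in> carrier G \<and> f i \<otimes> q = q \<otimes> f i"
  shows "list_prod f xs \<otimes> q = q \<otimes> list_prod f xs"
  using f
proof (induction xs)
  case (Cons i xs)
  have [simp]: "f i \<in> carrier G" "list_prod f xs \<in> carrier G"
    using Cons.prems by (auto intro: list_prod_closed)
  have "list_prod f (i # xs) \<otimes> q = f i \<otimes> (q \<otimes> list_prod f xs)"
    using q Cons by (simp add: m_assoc)
  also have "\<dots> = (q \<otimes> f i) \<otimes> list_prod f xs"
    using q Cons.prems[of i] by (simp add: m_assoc[symmetric])
  finally show ?case using q by (simp add: m_assoc)
qed (use q in simp)

lemma list_prod_extract:
  assumes i: "i < n" and f: "\<And>j. j < n \<Longrightarrow> f j \<in> carrier G"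
  shows "\<exists>us vs. [0..<n] = us @ i # vs \<and> i \<notin> set us \<union> set vs \<and> set us \<union> set vs \<subseteq> {..<n} \<and>
    list_prod f [0..<n] = list_prod f us \<otimes> (f i \<otimes> list_prod f vs)"
proof -
  obtain us vs where uv: "[0..<n] = us @ i # vs" using split_list[of i "[0..<n]"] i by auto
  have "distinct (us @ i # vs)" "set (us @ i # vs) = {..<n}" unfolding uv[symmetric] by auto
  moreover from this(2) have "list_prod f [0..<n] = list_prod f us \<otimes> (f i \<otimes> list_prod f vs)"
    unfolding uv using f by (subst list_prod_append) auto
  ultimately show ?thesis using uv by auto
qed

text \<open>Solving the relation for the i-th term expresses it by the inverses of the products
  before and after it.\<close>

lemma list_prod_solve:
  assumes i: "i < n" and f: "\<And>j. j < n \<Longrightarrow> f j \<in> carrier G" and H: "subgroup H G"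
    and rel: "list_prod f [0..<n] = \<one>" and other: "\<And>j. j < n \<Longrightarrow> j \<noteq> i \<Longrightarrow> f j \<in> H"
  shows "f i \<in> H"
proof -
  obtain us vs where uv: "i \<notin> set us \<union> set vs" "set us \<union> set vs \<subseteq> {..<n}"
    "list_prod f [0..<n] = list_prod f us \<otimes> (f i \<otimes> list_prod f vs)"
    using list_prod_extract[of i n f, OF i f] by blast
  have H_mem: "list_prod f us \<in> H" "list_prod f vs \<in> H"
    by (rule list_prod_in_subgroup[OF H]; use uv other in blast)+
  then have [simp]: "list_prod f us \<in> carrier G" "list_prod f vs \<in> carrier G" "f i \<in> carrier G"
    using subgroup.mem_carrier[OF H] f[OF i] by blast+
  have "list_prod f us \<otimes> (f i \<otimes> list_prod f vs) = \<one>" using uv(3) rel by simp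
  then have "f i \<otimes> list_prod f vs = inv list_prod f us"
    using inv_solve_left[of "f i \<otimes> list_prod f vs" "list_prod f us" \<one>] by simp
  then have "f i = inv list_prod f us \<otimes> inv list_prod f vs"
    using inv_solve_right[of "f i" "inv list_prod f us" "list_prod f vs"] by simp
  then show ?thesis
    using subgroup.m_closed[OF H] subgroup.m_inv_closed[OF H] H_mem by metis
qed

lemma list_prod_mult:
  assumes "distinct xs"
    and "\<And>i. i \<in> set xs \<Longrightarrow> f i \<in> carrier G" "\<And>i. i \<in> set xs \<Longrightarrow> g i \<in> carrier G"
    and "\<And>i j. i \<in> set xs \<Longrightarrow> j \<in> set xs \<Longrightarrow> i \<noteq> j \<Longrightarrow> f i \<otimes> g j = g j \<otimes> f i"
  shows "list_prod (\<lambda>i. f i \<otimes> g i) xs = list_prod f xs \<otimes> list_prod g xs"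
  using assms
proof (induction xs)
  case (Cons i xs)
  have [simp]: "f i \<in> carrier G" "g i \<in> carrier G" "list_prod f xs \<in> carrier G" "list_prod g xs \<in> carrier G"
    using Cons.prems by (auto intro: list_prod_closed)
  have "list_prod f xs \<otimes> g i = g i \<otimes> list_prod f xs"
    using Cons.prems by (intro list_prod_commute) auto
  then have "g i \<otimes> (list_prod f xs \<otimes> list_prod g xs) = list_prod f xs \<otimes> (g i \<otimes> list_prod g xs)"
    by (simp add: m_assoc[symmetric])
  moreover have "list_prod (\<lambda>i. f i \<otimes> g i) xs = list_prod f xs \<otimes> list_prod g xs"
    using Cons by auto
  ultimately show ?case by (simp add: m_assoc)
qed simp

lemma list_prod_hom:
  fixes H :: "nat \<Rightarrow> ('p, 'q) monoid_scheme"
  assumes hom: "\<And>i. i < n \<Longrightarrow> \<phi> i \<in> hom (H i) G"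
    and comm: "\<And>i j p q. i < n \<Longrightarrow> j < n \<Longrightarrow> i \<noteq> j \<Longrightarrow> p \<in> carrier (H i) \<Longrightarrow> q \<in> carrier (H j) \<Longrightarrow>
      \<phi> i p \<otimes> \<phi> j q = \<phi> j q \<otimes> \<phi> i p"
  shows "(\<lambda>f. list_prod (\<lambda>i. \<phi> i (f i)) [0..<n]) \<in> hom (product_group {..<n} H) G"
proof (rule homI)
  fix f g assume f: "f \<in> carrier (product_group {..<n} H)" and g: "g \<in> carrier (product_group {..<n} H)"
  have fi: "f i \<in> carrier (H i)" "g i \<in> carrier (H i)" if "i < n" for i using f g that by auto
  have fc: "\<phi> i (f i) \<in> carrier G" "\<phi> i (g i) \<in> carrier G" if "i < n" for i
    using fi[OF that] hom[OF that] by (auto dest: hom_in_carrier)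
  show "list_prod (\<lambda>i. \<phi> i (f i)) [0..<n] \<in> carrier G" using fc by (intro list_prod_closed) auto
  have "list_prod (\<lambda>i. \<phi> i ((f \<otimes>\<^bsub>product_group {..<n} H\<^esub> g) i)) [0..<n] =
    list_prod (\<lambda>i. \<phi> i (f i) \<otimes> \<phi> i (g i)) [0..<n]"
    using fi hom by (intro list_prod_cong) (auto simp: hom_mult)
  also have "\<dots> = list_prod (\<lambda>i. \<phi> i (f i)) [0..<n] \<otimes> list_prod (\<lambda>i. \<phi> i (g i)) [0..<n]"
    using fc fi comm by (intro list_prod_mult) auto
  finally show "list_prod (\<lambda>i. \<phi> i ((f \<otimes>\<^bsub>product_group {..<n} H\<^esub> g) i)) [0..<n] =
    list_prod (\<lambda>i. \<phi> i (f i)) [0..<n] \<otimes> list_prod (\<lambda>i. \<phi> i (g i)) [0..<n]" .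
qed

end

section \<open>The multiplication map and its kernel\<close>

context two_commutator_group
begin

lemma generate_c: "generate G {c} = {\<one>, c}"
proof
  show "generate G {c} \<subseteq> {\<one>, c}"
    by (rule generate_subgroup_incl[OF _ subgroup_one_c]) simp
  show "{\<one>, c} \<subseteq> generate G {c}" by (auto intro: generate.one generate.incl)
qed

text \<open>Each c toggles the value. This parity is the one in the definition of
  \<open>central_product\<close>, and it will identify the kernel there.\<close>

lemma list_prod_one_c:
  assumes "distinct xs" "\<And>i. i \<in> set xs \<Longrightarrow> f i \<in> {\<one>, c}"
  shows "list_prod f xs = (if even (card {i \<in> set xs. f i \<noteq> \<one>}) then \<one> else c)"
  using assms
proof (induction xs)
  case (Cons i xs)
  have fin: "finite {j \<in> set xs. f j \<noteq> \<one>}" by simp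
  show ?case
  proof (cases "f i = \<one>")
    case True
    then have "{j \<in> set (i # xs). f j \<noteq> \<one>} = {j \<in> set xs. f j \<noteq> \<one>}" by auto
    then show ?thesis using Cons True by simp
  next
    case False
    then have "{j \<in> set (i # xs). f j \<noteq> \<one>} = insert i {j \<in> set xs. f j \<noteq> \<one>}" by auto
    moreover have "i \<notin> {j \<in> set xs. f j \<noteq> \<one>}" using Cons.prems(1) by auto
    ultimately have "card {j \<in> set (i # xs). f j \<noteq> \<one>} = Suc (card {j \<in> set xs. f j \<noteq> \<one>})"
      using fin by simp
    moreover have "f i = c" using False Cons.prems(2)[of i] by simp
    ultimately show ?thesis using Cons by (simp add: c_square)
  qed
qed simp

text \<open>
  A relation \<open>y\<^sub>0 \<cdots> y\<^sub>n\<^sub>-\<^sub>1 w = 1\<close> with \<open>w\<close> central forces every \<open>y\<^sub>i\<close> to centralize its own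
  factor.
\<close>

lemma factor_relation:
  fixes y :: "nat \<Rightarrow> 'a"
  assumes U: "\<And>i. i < n \<Longrightarrow> U i \<subseteq> carrier G" and y: "\<And>i. i < n \<Longrightarrow> y i \<in> generate G (U i)"
    and comm: "\<And>i j u v. i < n \<Longrightarrow> j < n \<Longrightarrow> i \<noteq> j \<Longrightarrow> u \<in> generate G (U i) \<Longrightarrow> v \<in> generate G (U j) \<Longrightarrow>
      u \<otimes> v = v \<otimes> u"
    and cent: "\<And>i x. i < n \<Longrightarrow> x \<in> generate G (U i) \<Longrightarrow> (\<And>u. u \<in> U i \<Longrightarrow> x \<otimes> u = u \<otimes> x) \<Longrightarrow>
      x \<in> generate G {if i = t then d else c}"
    and d: "d \<in> carrier G" "c \<in> generate G {d}"
    and w: "w \<in> group_center G" "w \<in> generate G {d} \<Longrightarrow> w = \<one>"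
    and rel: "list_prod y [0..<n] \<otimes> w = \<one>"
  shows "w = \<one>" "\<And>i. i < n \<Longrightarrow> y i \<in> {\<one>, c}"
proof -
  have yG: "y i \<in> carrier G" if "i < n" for i using y[OF that] U[OF that] generate_in_carrier by blast
  have wG: "w \<in> carrier G" using w(1) by (rule center_in_carrier)
  let ?L = "list_prod y [0..<n]"
  have LG: "?L \<in> carrier G" using yG by (intro list_prod_closed) auto
  have L: "?L = inv w" using inv_equality[OF rel wG LG] by (simp add: LG wG)
  have LC: "?L \<in> group_center G" unfolding L using subgroup.m_inv_closed[OF subgroup_center w(1)] .
  have split: "\<exists>us vs. [0..<n] = us @ i # vs \<and> i \<notin> set us \<union> set vs \<and> set us \<union> set vs \<subseteq> {..<n} \<and>
      ?L = list_prod y us \<otimes> (y i \<otimes> list_prod y vs)" if i: "i < n" for i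
    using list_prod_extract[of i n y, OF i yG] by blast
  \<comment> \<open>The whole product is w^(-1), hence central, and every other term commutes with
    q; cancelling these terms leaves y_i q = q y_i.\<close>
  have yd: "y i \<in> generate G {if i = t then d else c}" if i: "i < n" for i
  proof (rule cent[OF i y[OF i]])
    fix q assume "q \<in> U i"
    then have q: "q \<in> generate G (U i)" "q \<in> carrier G" using U[OF i] by (auto intro: generate.incl)
    obtain us vs where uv: "i \<notin> set us \<union> set vs" "set us \<union> set vs \<subseteq> {..<n}"
      "?L = list_prod y us \<otimes> (y i \<otimes> list_prod y vs)" using split[OF i] by blast
    have c1: "list_prod y us \<otimes> q = q \<otimes> list_prod y us"
    proof (rule list_prod_commute[OF q(2)])
      fix j assume "j \<in> set us"
      then have "j < n" "j \<noteq> i" using uv by auto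
      then show "y j \<in> carrier G \<and> y j \<otimes> q = q \<otimes> y j" using yG y comm i q(1) by blast
    qed
    have c2: "list_prod y vs \<otimes> q = q \<otimes> list_prod y vs"
    proof (rule list_prod_commute[OF q(2)])
      fix j assume "j \<in> set vs"
      then have "j < n" "j \<noteq> i" using uv by auto
      then show "y j \<in> carrier G \<and> y j \<otimes> q = q \<otimes> y j" using yG y comm i q(1) by blast
    qed
    have [simp]: "list_prod y us \<in> carrier G" "list_prod y vs \<in> carrier G" "y i \<in> carrier G"
      using uv(2) yG i by (auto intro!: list_prod_closed)
    have "list_prod y us \<otimes> ((y i \<otimes> q) \<otimes> list_prod y vs) = ?L \<otimes> q"
      unfolding uv(3) using q c2 by (simp add: m_assoc)
    also have "\<dots> = q \<otimes> ?L" by (rule center_commute[OF LC q(2)])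
    also have "\<dots> = (q \<otimes> list_prod y us) \<otimes> (y i \<otimes> list_prod y vs)"
      unfolding uv(3) using q by (simp add: m_assoc)
    also have "\<dots> = list_prod y us \<otimes> ((q \<otimes> y i) \<otimes> list_prod y vs)"
      unfolding c1[symmetric] using q by (simp add: m_assoc)
    finally show "y i \<otimes> q = q \<otimes> y i" using q by simp
  qed
  have sub: "subgroup (generate G {d}) G" by (rule generate_is_subgroup) (use d in simp)
  have cd: "generate G {c} \<subseteq> generate G {d}"
    by (rule generate_subgroup_incl[OF _ sub]) (use d in simp)
  \<comment> \<open>All terms now lie in <d>, hence so does w, and \<open>w(2)\<close> gives w =
    1.\<close>
  have "?L \<in> generate G {d}"
  proof (rule list_prod_in_subgroup[OF sub])
    fix i assume "i \<in> set [0..<n]"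
    then show "y i \<in> generate G {d}" using yd[of i] cd by (cases "i = t") auto
  qed
  then have "inv ?L \<in> generate G {d}" by (rule subgroup.m_inv_closed[OF sub])
  then show "w = \<one>" using w(2) L wG by simp
  then have L1: "?L = \<one>" using L by simp
  have yc: "y i \<in> {\<one>, c}" if "i < n" "i \<noteq> t" for i
    using yd[OF that(1)] that(2) generate_c by simp
  \<comment> \<open>Only the term with index t may still lie outside {1, c}; solving the relation
    for it puts it there too.\<close>
  show "y i \<in> {\<one>, c}" if i: "i < n" for i
  proof (cases "i = t")
    case True
    then show ?thesis using list_prod_solve[of i n y, OF i yG subgroup_one_c L1] yc by blast
  next
    case False
    then show ?thesis using yc i by blast
  qed
qed

text \<open>
  The factor with index \<open>t\<close> is the one whose center may be as large as \<open>\<langle>d\<rangle>\<close>; all others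
  have center \<open>\<langle>c\<rangle>\<close>. Choosing \<open>t\<close> out of range means that there is no such factor.
\<close>

lemma central_product_iso:
  fixes Hs :: "'p monoid list" and A :: "('q, 'r) monoid_scheme"
  defines "n \<equiv> length Hs"
  assumes fac: "\<And>i. i < n \<Longrightarrow> \<exists>\<phi>. factor (Hs ! i) \<phi> (U i)"
    and U: "\<And>i. i < n \<Longrightarrow> U i \<subseteq> carrier G"
    and comm: "\<And>i j u v. i < n \<Longrightarrow> j < n \<Longrightarrow> i \<noteq> j \<Longrightarrow> u \<in> U i \<Longrightarrow> v \<in> U j \<Longrightarrow> u \<otimes> v = v \<otimes> u"
    and cent: "\<And>i x. i < n \<Longrightarrow> x \<in> generate G (U i) \<Longrightarrow> (\<And>u. u \<in> U i \<Longrightarrow> x \<otimes> u = u \<otimes> x) \<Longrightarrow>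
      x \<in> generate G {if i = t then d else c}"
    and d: "d \<in> carrier G" "c \<in> generate G {d}"
    and A: "group A" and \<omega>: "\<omega> \<in> hom A G" "\<And>a. a \<in> carrier A \<Longrightarrow> \<omega> a \<in> group_center G"
      "\<And>a. a \<in> carrier A \<Longrightarrow> \<omega> a \<in> generate G {d} \<Longrightarrow> a = \<one>\<^bsub>A\<^esub>"
    and gen: "carrier G = generate G ((\<Union>i<n. U i) \<union> \<omega> ` carrier A)"
  shows "G \<cong> central_product Hs \<times>\<times> A"
proof -
  obtain \<phi> where \<phi>: "factor (Hs ! i) (\<phi> i) (U i)" if "i < n" for i
    using fac by metis
  have grp: "group (Hs ! i)" and hom: "\<phi> i \<in> hom (Hs ! i) G" and inj: "inj_on (\<phi> i) (carrier (Hs ! i))"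
    and img: "\<phi> i ` carrier (Hs ! i) = generate G (U i)"
    and amalgam: "amalgam_subgroup (Hs ! i) = {p \<in> carrier (Hs ! i). \<phi> i p \<in> {\<one>, c}}"
    if "i < n" for i
    using \<phi>[OF that] by (auto simp only: factor_def)
  have one: "\<phi> i \<one>\<^bsub>Hs ! i\<^esub> = \<one>" if "i < n" for i
    using hom_one[OF hom[OF that] grp[OF that] is_group] .
  have one_mem: "\<one>\<^bsub>Hs ! i\<^esub> \<in> carrier (Hs ! i)" if "i < n" for i
    by (rule monoid.one_closed[OF group.is_monoid[OF grp[OF that]]])
  have gen_comm: "u \<otimes> v = v \<otimes> u"
    if "i < n" "j < n" "i \<noteq> j" and u: "u \<in> generate G (U i)" and v: "v \<in> generate G (U j)" for i j u v
  proof -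
    have vG: "v \<in> carrier G" using v U[OF that(2)] generate_in_carrier by blast
    have "v \<otimes> x = x \<otimes> v" if "x \<in> U i" for x
      using commute_generate[OF v U[OF \<open>j < n\<close>]] comm[of i j] U[OF \<open>i < n\<close>] that \<open>i < n\<close> \<open>j < n\<close> \<open>i \<noteq> j\<close>
      by (metis subsetD)
    then show ?thesis using commute_generate[OF u U[OF that(1)] _ vG] by metis
  qed
  let ?D = "product_group {..<n} (\<lambda>i. Hs ! i)"
  define L where "L = (\<lambda>f. list_prod (\<lambda>i. \<phi> i (f i)) [0..<n])"
  have img_mem: "\<phi> i p \<in> generate G (U i)" if "i < n" "p \<in> carrier (Hs ! i)" for i p
    using that img by blast
  have Lhom: "L \<in> hom ?D G"
    unfolding L_def by (rule list_prod_hom) (use hom gen_comm img_mem in blast)+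
  have Dgrp: "group ?D" by (rule product_group) (use grp in simp)
  interpret L: group_hom ?D G L
    by (intro group_hom.intro group_hom_axioms.intro Dgrp Lhom is_group)
  \<comment> \<open>Used twice: with a = 1 it determines the kernel of \<open>L\<close>, and for
    general a it shows that the image of \<open>L\<close> meets the complement trivially.\<close>
  have rel: "a = \<one>\<^bsub>A\<^esub> \<and> (\<forall>i<n. \<phi> i (f i) \<in> {\<one>, c})"
    if f: "f \<in> carrier ?D" and a: "a \<in> carrier A" and eq: "L f \<otimes> \<omega> a = \<one>" for f a
  proof -
    have fi: "\<phi> i (f i) \<in> generate G (U i)" if "i < n" for i
      using f that img_mem by auto
    have w: "\<omega> a \<in> generate G {d} \<Longrightarrow> \<omega> a = \<one>"
      using \<omega>(3)[OF a] hom_one[OF \<omega>(1) A is_group] by metis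
    note \<omega>a = \<omega>(2)[OF a]
    have eq': "list_prod (\<lambda>i. \<phi> i (f i)) [0..<n] \<otimes> \<omega> a = \<one>" using eq by (simp add: L_def)
    have 1: "\<omega> a = \<one>"
      by (rule factor_relation(1)[of n U "\<lambda>i. \<phi> i (f i)" t d]) (fact U fi gen_comm cent d \<omega>a w eq')+
    have 2: "\<phi> i (f i) \<in> {\<one>, c}" if i: "i < n" for i
      by (rule factor_relation(2)[of n U "\<lambda>i. \<phi> i (f i)" t d]) (fact U fi gen_comm cent d \<omega>a w eq' i)+
    from 1 have "a = \<one>\<^bsub>A\<^esub>" using \<omega>(3)[OF a] generate.one by metis
    then show ?thesis using 2 by blast
  qed
  let ?K = "{f \<in> (\<Pi>\<^sub>E i\<in>{..<n}. amalgam_subgroup (Hs ! i)).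
        even (card {i \<in> {..<n}. f i \<noteq> \<one>\<^bsub>Hs ! i\<^esub>})}"
  have parity: "L f = (if even (card {i \<in> {..<n}. f i \<noteq> \<one>\<^bsub>Hs ! i\<^esub>}) then \<one> else c)"
    if f: "f \<in> carrier ?D" "\<forall>i<n. \<phi> i (f i) \<in> {\<one>, c}" for f
  proof -
    have "\<phi> i (f i) \<noteq> \<one> \<longleftrightarrow> f i \<noteq> \<one>\<^bsub>Hs ! i\<^esub>" if "i < n" for i
    proof -
      have "f i \<in> carrier (Hs ! i)" "\<one>\<^bsub>Hs ! i\<^esub> \<in> carrier (Hs ! i)"
        using f(1) that one_mem by auto
      then show ?thesis using inj_onD[OF inj[OF that], of "f i" "\<one>\<^bsub>Hs ! i\<^esub>"] one[OF that] by metis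
    qed
    then have "{i \<in> set [0..<n]. \<phi> i (f i) \<noteq> \<one>} = {i \<in> {..<n}. f i \<noteq> \<one>\<^bsub>Hs ! i\<^esub>}" by auto
    then show ?thesis unfolding L_def using list_prod_one_c[of "[0..<n]" "\<lambda>i. \<phi> i (f i)"] f(2) by simp
  qed
  \<comment> \<open>By \<open>rel\<close> the entries of a kernel tuple map into {1, c}, and on such
    tuples \<open>L\<close> only sees the parity of the number of nontrivial entries.\<close>
  have ker: "kernel ?D G L = ?K"
  proof (rule Set.set_eqI)
    fix f
    have am: "f \<in> (\<Pi>\<^sub>E i\<in>{..<n}. amalgam_subgroup (Hs ! i)) \<longleftrightarrow>
      f \<in> carrier ?D \<and> (\<forall>i<n. \<phi> i (f i) \<in> {\<one>, c})"
      using amalgam by (auto simp: PiE_iff)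
    have "\<forall>i<n. \<phi> i (f i) \<in> {\<one>, c}" if "f \<in> carrier ?D" "L f = \<one>"
      using rel[OF that(1), of "\<one>\<^bsub>A\<^esub>"] that(2) hom_one[OF \<omega>(1) A is_group] A
      by (simp add: monoid.one_closed group.is_monoid)
    then show "f \<in> kernel ?D G L \<longleftrightarrow> f \<in> ?K"
      unfolding kernel_def mem_Collect_eq am using parity[of f] c_neq_one by metis
  qed
  let ?Y = "L ` carrier ?D" and ?C = "central_product Hs"
  have Csub: "subgroup ?Y G" by (rule L.img_is_subgroup)
  have "group_hom ?D (G\<lparr>carrier := ?Y\<rparr>) L"
    using Lhom by (intro group_hom.intro group_hom_axioms.intro Dgrp subgroup.subgroup_is_group[OF Csub] is_group)
      (auto simp: hom_def)
  then interpret LY: group_hom ?D "G\<lparr>carrier := ?Y\<rparr>" L .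
  have C: "?C = ?D Mod (kernel ?D (G\<lparr>carrier := ?Y\<rparr>) L)"
    using ker by (simp add: central_product_def n_def kernel_def)
  define \<psi> where "\<psi> = (\<lambda>S. the_elem (L ` S))"
  have \<psi>: "\<psi> \<in> iso ?C (G\<lparr>carrier := ?Y\<rparr>)"
    unfolding C \<psi>_def by (rule LY.FactGroup_iso_set) simp
  have Cgrp: "group ?C" unfolding C by (rule normal.factorgroup_is_group[OF LY.normal_kernel])
  have \<psi>inj: "inj_on \<psi> (carrier ?C)" and \<psi>img: "\<psi> ` carrier ?C = ?Y"
    using \<psi> by (simp_all add: iso_def bij_betw_def)
  have \<psi>hom: "\<psi> \<in> hom ?C G"
  proof (rule homI)
    fix x y assume xy: "x \<in> carrier ?C" "y \<in> carrier ?C"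
    show "\<psi> x \<in> carrier G" using xy(1) \<psi>img subgroup.subset[OF Csub] by blast
    show "\<psi> (x \<otimes>\<^bsub>?C\<^esub> y) = \<psi> x \<otimes> \<psi> y"
      using \<psi> xy hom_mult[of \<psi> ?C "G\<lparr>carrier := ?Y\<rparr>" x y] by (simp add: iso_def)
  qed
  have \<psi>one: "\<psi> \<one>\<^bsub>?C\<^esub> = \<one>" by (rule hom_one[OF \<psi>hom Cgrp is_group])
  let ?\<Psi> = "\<lambda>(x, a). \<psi> x \<otimes> \<omega> a"
  have CA: "group (?C \<times>\<times> A)" by (rule DirProd_group[OF Cgrp A])
  have mem: "\<psi> x \<in> carrier G" "\<omega> a \<in> carrier G" if "x \<in> carrier ?C" "a \<in> carrier A" for x a
    using that \<psi>hom \<omega>(1) by (auto dest: hom_in_carrier)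
  have \<Psi>hom: "?\<Psi> \<in> hom (?C \<times>\<times> A) G"
  proof (rule homI)
    fix p q assume "p \<in> carrier (?C \<times>\<times> A)" "q \<in> carrier (?C \<times>\<times> A)"
    then obtain x a y b where p: "p = (x, a)" "q = (y, b)" "x \<in> carrier ?C" "y \<in> carrier ?C"
      "a \<in> carrier A" "b \<in> carrier A" by auto
    have "\<omega> a \<otimes> \<psi> y = \<psi> y \<otimes> \<omega> a" using center_commute[OF \<omega>(2)] mem p by blast
    then have "\<psi> x \<otimes> (\<psi> y \<otimes> (\<omega> a \<otimes> \<omega> b)) = \<psi> x \<otimes> (\<omega> a \<otimes> (\<psi> y \<otimes> \<omega> b))"
      using mem p by (simp add: m_assoc[symmetric])
    then show "?\<Psi> (p \<otimes>\<^bsub>?C \<times>\<times> A\<^esub> q) = ?\<Psi> p \<otimes> ?\<Psi> q"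
      using p mem hom_mult[OF \<psi>hom] hom_mult[OF \<omega>(1)] by (simp add: m_assoc)
  qed (use mem in auto)
  interpret \<Psi>: group_hom "?C \<times>\<times> A" G ?\<Psi>
    by (intro group_hom.intro group_hom_axioms.intro CA \<Psi>hom is_group)
  have "inj_on ?\<Psi> (carrier (?C \<times>\<times> A))"
    unfolding \<Psi>.inj_on_one_iff
  proof (intro allI impI)
    fix p assume p: "p \<in> carrier (?C \<times>\<times> A)" "?\<Psi> p = \<one>"
    obtain x a where xa: "p = (x, a)" "x \<in> carrier ?C" "a \<in> carrier A" using p(1) by auto
    obtain f where f: "f \<in> carrier ?D" "\<psi> x = L f" using \<psi>img xa(2) by blast
    have "a = \<one>\<^bsub>A\<^esub>" using rel[OF f(1) xa(3)] p(2) f(2) xa(1) by simp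
    moreover from this have "\<psi> x = \<one>"
      using p(2) xa mem[OF xa(2,3)] hom_one[OF \<omega>(1) A is_group] by simp
    then have "x = \<one>\<^bsub>?C\<^esub>"
      using inj_onD[OF \<psi>inj, of x "\<one>\<^bsub>?C\<^esub>"] xa(2) \<psi>one Cgrp by (simp add: monoid.one_closed group.is_monoid)
    ultimately show "p = \<one>\<^bsub>?C \<times>\<times> A\<^esub>" using xa(1) by simp
  qed
  moreover have "?\<Psi> ` carrier (?C \<times>\<times> A) = carrier G"
  proof
    show "?\<Psi> ` carrier (?C \<times>\<times> A) \<subseteq> carrier G" using mem by auto
    have sub: "subgroup (?\<Psi> ` carrier (?C \<times>\<times> A)) G" by (rule \<Psi>.img_is_subgroup)
    have "\<omega> a \<in> ?\<Psi> ` carrier (?C \<times>\<times> A)" if "a \<in> carrier A" for a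
      using that \<psi>one mem[of "\<one>\<^bsub>?C\<^esub>" a] Cgrp
      by (intro image_eqI[of _ _ "(\<one>\<^bsub>?C\<^esub>, a)"]) (auto simp: monoid.one_closed group.is_monoid)
    moreover have "x \<in> ?\<Psi> ` carrier (?C \<times>\<times> A)" if i: "i < n" and x: "x \<in> U i" for i x
    proof -
      have "x \<in> generate G (U i)" using x by (rule generate.incl)
      then obtain p where p: "p \<in> carrier (Hs ! i)" "x = \<phi> i p" using img[OF i] by blast
      \<comment> \<open>The tuple with p in place i and 1 elsewhere, whose image under
        \<open>L\<close> is x.\<close>
      define f where "f = (\<lambda>j\<in>{..<n}. if j = i then p else \<one>\<^bsub>Hs ! j\<^esub>)"
      have f: "f \<in> carrier ?D"
        using p(1) one_mem by (auto simp: f_def)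
      have "L f = \<phi> i (f i)"
        unfolding L_def using i p x U[OF i] one by (intro list_prod_single) (auto simp: f_def)
      then have "L f = x" using i p(2) by (simp add: f_def)
      then obtain z where z: "z \<in> carrier ?C" "\<psi> z = x" using \<psi>img f by (metis (no_types, lifting) imageE image_eqI)
      have "x = ?\<Psi> (z, \<one>\<^bsub>A\<^esub>)" using z hom_one[OF \<omega>(1) A is_group] U[OF i] x by auto
      moreover have "(z, \<one>\<^bsub>A\<^esub>) \<in> carrier (?C \<times>\<times> A)"
        using z(1) A by (simp add: monoid.one_closed group.is_monoid)
      ultimately show ?thesis by (rule image_eqI)
    qed
    ultimately show "carrier G \<subseteq> ?\<Psi> ` carrier (?C \<times>\<times> A)"
      unfolding gen by (intro generate_subgroup_incl[OF _ sub]) auto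
  qed
  ultimately have "?\<Psi> \<in> iso (?C \<times>\<times> A) G"
    using \<Psi>hom by (auto simp only: iso_def bij_betw_def mem_Collect_eq)
  then have "?C \<times>\<times> A \<cong> G" unfolding is_iso_def by blast
  then show ?thesis by (rule group.iso_sym[OF CA])
qed

end

subsection \<open>Splitting off the center\<close>

text \<open>x^(q j) = 1, so it does not matter that sums in the cyclic group are reduced modulo
  q.\<close>

lemma (in group) int_pow_integer_mod_hom:
  assumes x: "x \<in> carrier G" "x [^] (q::nat) = \<one>"
  shows "(\<lambda>a. x [^] a) \<in> hom (integer_mod_group q) G"
proof (rule homI)
  fix a b
  have "a + b = int q * ((a + b) div int q) + (a + b) mod int q" by simp
  then have "x [^] (a + b) = x [^] (int q * ((a + b) div int q)) \<otimes> x [^] ((a + b) mod int q)"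
    using x(1) by (metis int_pow_mult)
  moreover have "x [^] (int q * ((a + b) div int q)) = \<one>"
    using x int_pow_pow[of x "int q" "(a + b) div int q"] by (simp add: int_pow_int)
  ultimately show "x [^] (a \<otimes>\<^bsub>integer_mod_group q\<^esub> b) = x [^] a \<otimes> x [^] b"
    using x(1) by (simp add: int_pow_mult)
qed (use x in simp)

context group
begin

lemma int_pow_mod_group_eq_one:
  assumes "x \<in> carrier G" "ord x = q" "q > 0" "a \<in> carrier (integer_mod_group q)" "x [^] a = \<one>"
  shows "a = 0"
proof -
  have "int q dvd a" using int_pow_eq_id[OF assms(1), of a] assms(2,5) by simp
  moreover have "0 \<le> a" "a < int q" using assms(3,4) by (auto simp: carrier_integer_mod_group)
  ultimately show ?thesis using zdvd_imp_le[of "int q" a] by force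
qed

text \<open>Solved for its i-th term, the relation places y_i^(e_i) in the subgroup generated by the
  others, which meets <y_i> trivially.\<close>

lemma direct_product_relation:
  fixes y :: "nat \<Rightarrow> 'a" and e :: "nat \<Rightarrow> int"
  assumes y: "\<And>i. i < n \<Longrightarrow> y i \<in> carrier G"
    and indep: "\<And>i. i < n \<Longrightarrow>
      generate G {y i} \<inter> generate G (\<Union>j\<in>{..<n} - {i}. generate G {y j}) = {\<one>}"
    and rel: "list_prod (\<lambda>i. y i [^] e i) [0..<n] = \<one>" and i: "i < n"
  shows "y i [^] e i = \<one>"
proof -
  let ?S = "\<Union>j\<in>{..<n} - {i}. generate G {y j}"
  have pow: "y j [^] e j \<in> generate G {y j}" if "j < n" for j
    using generate_pow[OF y[OF that]] by blast
  have "?S \<subseteq> carrier G" using y generate_incl by blast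
  then have sub: "subgroup (generate G ?S) G" by (rule generate_is_subgroup)
  have "y i [^] e i \<in> generate G ?S"
  proof (rule list_prod_solve[OF i _ sub rel])
    fix j assume "j < n"
    then show "y j [^] e j \<in> carrier G" using y by simp
    assume "j \<noteq> i"
    with \<open>j < n\<close> show "y j [^] e j \<in> generate G ?S" by (intro generate.incl) (use pow in blast)
  qed
  then show ?thesis using pow[OF i] indep[OF i] by blast
qed

end

context two_commutator_group
begin

text \<open>In the application \<open>y 0\<close> is \<open>z 1\<close>, \<open>y 1\<close> is
  \<open>z 2\<close>, and the others are the involutions \<open>z 3\<close> onwards. The map
  \<omega> parametrizes the subgroup generated by all \<open>y i\<close> except \<open>y 1\<close>;
  that only 1 is sent into <y 1> says at once that \<omega> is injective and that its image meets <y
  1> trivially.\<close>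

lemma center_complement:
  fixes y :: "nat \<Rightarrow> 'a" and q s :: nat
  defines "A \<equiv> integer_mod_group q \<times>\<times> cyclic_power 2 s"
  assumes y: "\<And>i. i < Suc (Suc s) \<Longrightarrow> y i \<in> group_center G"
    and indep: "\<And>i. i < Suc (Suc s) \<Longrightarrow>
      generate G {y i} \<inter> generate G (\<Union>j\<in>{..<Suc (Suc s)} - {i}. generate G {y j}) = {\<one>}"
    and ord0: "ord (y 0) = q" "q > 1" and ord2: "\<And>i. i < s \<Longrightarrow> ord (y (Suc (Suc i))) = 2"
  obtains \<omega> where "group A" "\<omega> \<in> hom A G" "\<And>a. a \<in> carrier A \<Longrightarrow> \<omega> a \<in> group_center G"
    "\<And>a. a \<in> carrier A \<Longrightarrow> \<omega> a \<in> generate G {y 1} \<Longrightarrow> a = \<one>\<^bsub>A\<^esub>"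
    "y 0 \<in> \<omega> ` carrier A" "\<And>i. i < s \<Longrightarrow> y (Suc (Suc i)) \<in> \<omega> ` carrier A"
proof -
  let ?Z = "integer_mod_group q" and ?E = "cyclic_power 2 s"
  define \<epsilon> where "\<epsilon> = (\<lambda>g::nat \<Rightarrow> int. list_prod (\<lambda>i. y (Suc (Suc i)) [^] g i) [0..<s])"
  define \<omega> where "\<omega> = (\<lambda>(a::int, g). y 0 [^] a \<otimes> \<epsilon> g)"
  have yG: "y i \<in> carrier G" if "i < Suc (Suc s)" for i using y[OF that] by (rule center_in_carrier)
  have pow: "y i [^] (a::int) \<in> group_center G" if "i < Suc (Suc s)" for i a
  proof -
    have "y i [^] a \<in> generate G {y i}" using generate_pow[OF yG[OF that]] by blast
    moreover have "generate G {y i} \<subseteq> group_center G"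
      using y[OF that] by (intro generate_subgroup_incl[OF _ subgroup_center]) auto
    ultimately show ?thesis by blast
  qed
  have \<epsilon>C: "\<epsilon> g \<in> group_center G" for g
    unfolding \<epsilon>_def by (rule list_prod_in_subgroup[OF subgroup_center]) (simp add: pow)
  have \<epsilon>hom: "\<epsilon> \<in> hom ?E G"
    unfolding \<epsilon>_def
  proof (rule list_prod_hom)
    fix i assume i: "i < s"
    then have "y (Suc (Suc i)) [^] (2::nat) = \<one>" using pow_ord_eq_1[OF yG, of "Suc (Suc i)"] ord2[OF i] by simp
    then show "(\<lambda>a. y (Suc (Suc i)) [^] a) \<in> hom (integer_mod_group 2) G"
      using i yG by (intro int_pow_integer_mod_hom) auto
  next
    fix i j and p q :: int assume "i < s" "j < s"
    then show "y (Suc (Suc i)) [^] p \<otimes> y (Suc (Suc j)) [^] q = y (Suc (Suc j)) [^] q \<otimes> y (Suc (Suc i)) [^] p"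
      by (intro center_commute[OF pow] int_pow_closed yG) auto
  qed
  have A: "group A" unfolding A_def by (intro DirProd_group) auto
  have q1: "y 0 [^] q = \<one>" using pow_ord_eq_1[OF yG[of 0]] ord0 by simp
  have zhom: "(\<lambda>a. y 0 [^] a) \<in> hom ?Z G" using yG[of 0] q1 by (intro int_pow_integer_mod_hom) auto
  have \<omega>C: "\<omega> a \<in> group_center G" for a
    unfolding \<omega>_def using subgroup.m_closed[OF subgroup_center pow \<epsilon>C] by (cases a) simp
  have \<omega>hom: "\<omega> \<in> hom A G"
  proof (rule homI)
    fix u v assume "u \<in> carrier A" "v \<in> carrier A"
    then obtain a g b h where uv: "u = (a, g)" "v = (b, h)" "a \<in> carrier ?Z" "b \<in> carrier ?Z"
      "g \<in> carrier ?E" "h \<in> carrier ?E" unfolding A_def carrier_DirProd by blast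
    have [simp]: "y 0 [^] i \<in> carrier G" for i :: int using yG by simp
    have [simp]: "\<epsilon> f \<in> carrier G" for f using \<epsilon>C by (rule center_in_carrier)
    have "\<epsilon> g \<otimes> y 0 [^] b = y 0 [^] b \<otimes> \<epsilon> g" by (rule center_commute[OF \<epsilon>C]) simp
    then have "\<epsilon> g \<otimes> (y 0 [^] b \<otimes> \<epsilon> h) = y 0 [^] b \<otimes> (\<epsilon> g \<otimes> \<epsilon> h)" by (simp add: m_assoc[symmetric])
    moreover have "u \<otimes>\<^bsub>A\<^esub> v = (a \<otimes>\<^bsub>?Z\<^esub> b, g \<otimes>\<^bsub>?E\<^esub> h)" by (simp only: uv A_def mult_DirProd)
    moreover have "y 0 [^] (a \<otimes>\<^bsub>?Z\<^esub> b) = y 0 [^] a \<otimes> y 0 [^] b" by (rule hom_mult[OF zhom uv(3,4)])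
    moreover have "\<epsilon> (g \<otimes>\<^bsub>?E\<^esub> h) = \<epsilon> g \<otimes> \<epsilon> h" by (rule hom_mult[OF \<epsilon>hom uv(5,6)])
    ultimately show "\<omega> (u \<otimes>\<^bsub>A\<^esub> v) = \<omega> u \<otimes> \<omega> v"
      by (simp only: \<omega>_def uv prod.case) (simp add: m_assoc)
  qed (use \<omega>C center_in_carrier in blast)
  have trivial: "u = \<one>\<^bsub>A\<^esub>" if u: "u \<in> carrier A" "\<omega> u \<in> generate G {y 1}" for u
  proof -
    obtain a g where ag: "u = (a, g)" "a \<in> carrier ?Z" "g \<in> carrier ?E"
      using u(1) unfolding A_def carrier_DirProd by blast
    obtain b :: int where b: "\<omega> u = y 1 [^] b" using u(2) generate_pow[OF yG[of 1]] by auto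
    \<comment> \<open>The exponents of the relation that equates \<open>\<omega> u\<close> with
      y_1^b; the entries of g start at index 2.\<close>
    define e where "e = (\<lambda>i. if i = 0 then a else if i = 1 then - b else g (i - 2))"
    have up: "[0..<Suc (Suc s)] = 0 # 1 # map (\<lambda>i. Suc (Suc i)) [0..<s]"
      by (simp add: upt_conv_Cons map_Suc_upt[symmetric] del: upt_Suc)
    have "list_prod (\<lambda>i. y i [^] e i) [0..<Suc (Suc s)] = y 0 [^] a \<otimes> (y 1 [^] (- b) \<otimes> \<epsilon> g)"
      unfolding up by (simp add: list_prod_map e_def \<epsilon>_def)
    also have "\<dots> = (y 0 [^] a \<otimes> \<epsilon> g) \<otimes> y 1 [^] (- b)"
      using center_commute[OF \<epsilon>C, of "y 1 [^] (- b)" g] center_in_carrier[OF \<epsilon>C] yG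
      by (simp add: m_assoc)
    also have "\<dots> = \<one>" using b ag(1) yG[of 1] by (simp add: \<omega>_def int_pow_neg)
    finally have rel: "list_prod (\<lambda>i. y i [^] e i) [0..<Suc (Suc s)] = \<one>" .
    have e1: "y i [^] e i = \<one>" if "i < Suc (Suc s)" for i
      by (rule direct_product_relation[OF yG indep rel that])
    have "a = 0"
      using e1[of 0] ag(2) ord0 yG[of 0] by (intro int_pow_mod_group_eq_one[of "y 0" q a]) (auto simp: e_def)
    moreover have "g i = 0" if i: "i < s" for i
    proof (rule int_pow_mod_group_eq_one[of "y (Suc (Suc i))" 2])
      show "g i \<in> carrier (integer_mod_group 2)" using ag(3) i by auto
      show "y (Suc (Suc i)) [^] g i = \<one>" using e1[of "Suc (Suc i)"] i by (simp add: e_def)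
    qed (use i yG ord2 in auto)
    then have "g = (\<lambda>i\<in>{..<s}. 0)" using ag(3) by (auto simp: fun_eq_iff PiE_iff extensional_def)
    ultimately show ?thesis by (simp add: ag(1) A_def)
  qed
  have "y 0 \<in> \<omega> ` carrier A"
  proof (rule image_eqI)
    \<comment> \<open>The residue 1 is in the carrier because q > 1.\<close>
    show "(1, \<one>\<^bsub>?E\<^esub>) \<in> carrier A" using ord0(2) by (auto simp: A_def)
    have "\<epsilon> \<one>\<^bsub>?E\<^esub> = \<one>" by (rule hom_one[OF \<epsilon>hom _ is_group]) simp
    then show "y 0 = \<omega> (1, \<one>\<^bsub>?E\<^esub>)" using yG[of 0] by (simp add: \<omega>_def del: one_product_group)
  qed
  moreover have "y (Suc (Suc i)) \<in> \<omega> ` carrier A" if i: "i < s" for i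
  proof (rule image_eqI)
    let ?g = "\<lambda>j\<in>{..<s}. if j = i then 1 else (0::int)"
    show "(0, ?g) \<in> carrier A" using ord0(2) by (auto simp: A_def)
    have "\<epsilon> ?g = y (Suc (Suc i)) [^] ?g i"
      unfolding \<epsilon>_def using i yG by (intro list_prod_single) auto
    then show "y (Suc (Suc i)) = \<omega> (0, ?g)" using i yG by (simp add: \<omega>_def)
  qed
  ultimately show thesis using that[OF A \<omega>hom \<omega>C trivial] by blast
qed

section \<open>Assembling pairs, central complement and cyclic factor\<close>

lemma commuting_pairs_nth:
  assumes "sorted_wrt commuting_pairs qs" "i < length qs" "j < length qs" "i \<noteq> j"
  shows "commuting_pairs (qs ! i) (qs ! j)"
proof (cases "i < j")
  case True
  then show ?thesis using sorted_wrt_nth_less[OF assms(1)] assms(3) by blast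
next
  case False
  then have "commuting_pairs (qs ! j) (qs ! i)"
    using sorted_wrt_nth_less[OF assms(1), of j i] assms by auto
  then show ?thesis by metis
qed

lemma pair_elements_nth: "pair_elements qs = (\<Union>i<length qs. {fst (qs ! i), snd (qs ! i)})"
proof -
  have "set qs = (\<lambda>i. qs ! i) ` {..<length qs}" by (auto simp: set_conv_nth)
  then show ?thesis by simp
qed

lemma generate_insert_center:
  assumes S: "S \<subseteq> carrier G" "carrier G = generate G (S \<union> group_center G)"
    and T: "S \<subseteq> generate G T" "group_center G \<subseteq> generate G T" "T \<subseteq> carrier G"
  shows "carrier G = generate G T"
proof
  show "carrier G \<subseteq> generate G T"
    unfolding S(2) using T by (intro generate_subgroup_incl[OF _ generate_is_subgroup]) auto
  show "generate G T \<subseteq> carrier G" by (rule generate_incl[OF T(3)])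
qed

text \<open>Families (iii) and (iv). The groups of the pairs have their centers inside <c>, so d
  comes from a cyclic factor, appended at the last index; that index is the exceptional
  \<open>t\<close> of \<open>central_product_iso\<close>.\<close>

lemma pairs_with_cyclic_iso:
  fixes A :: "('q, 'r) monoid_scheme" and Fs :: "nat gword set monoid list"
  assumes len: "length Fs = length qs"
    and qs: "pair_elements qs \<subseteq> carrier G" "sorted_wrt commuting_pairs qs"
      "carrier G = generate G (pair_elements qs \<union> group_center G)"
    and fac: "\<And>i. i < length qs \<Longrightarrow> \<exists>\<phi>. factor (Fs ! i) \<phi> {fst (qs ! i), snd (qs ! i)}"
    and cent: "\<And>i x. i < length qs \<Longrightarrow> x \<in> generate G {fst (qs ! i), snd (qs ! i)} \<Longrightarrow>
      x \<otimes> fst (qs ! i) = fst (qs ! i) \<otimes> x \<Longrightarrow> x \<otimes> snd (qs ! i) = snd (qs ! i) \<otimes> x \<Longrightarrow> x \<in> generate G {c}"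
    and d: "d \<in> group_center G" "d [^] (2 ^ k :: nat) = c"
    and A: "group A" and \<omega>: "\<omega> \<in> hom A G" "\<And>a. a \<in> carrier A \<Longrightarrow> \<omega> a \<in> group_center G"
      "\<And>a. a \<in> carrier A \<Longrightarrow> \<omega> a \<in> generate G {d} \<Longrightarrow> a = \<one>\<^bsub>A\<^esub>"
    and gen: "group_center G \<subseteq> generate G (insert d (\<omega> ` carrier A))"
  shows "G \<cong> central_product (Fs @ [cyclic_presented (2 ^ Suc k)]) \<times>\<times> A"
proof -
  let ?n = "length qs"
  define U where "U = (\<lambda>i. if i < ?n then {fst (qs ! i), snd (qs ! i)} else {d})"
  have dG: "d \<in> carrier G" using d(1) by (rule center_in_carrier)
  have qG: "{fst (qs ! i), snd (qs ! i)} \<subseteq> carrier G" if "i < ?n" for i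
    using qs(1) that by (auto simp: pair_elements_nth)
  have \<omega>G: "\<omega> ` carrier A \<subseteq> carrier G" using \<omega>(2) center_in_carrier by blast
  have cd: "c \<in> generate G {d}"
    using d(2) generate_pow[OF dG] by (auto simp flip: int_pow_int)
  show ?thesis
  proof (rule central_product_iso[where U = U and t = ?n and d = d and \<omega> = \<omega>])
    fix i assume "i < length (Fs @ [cyclic_presented (2 ^ Suc k)])"
    then have i: "i < ?n \<or> i = ?n" using len by auto
    show "\<exists>\<phi>. factor ((Fs @ [cyclic_presented (2 ^ Suc k)]) ! i) \<phi> (U i)"
      using i
    proof
      assume "i < ?n"
      then show ?thesis using fac len by (simp add: U_def nth_append)
    next
      assume "i = ?n"
      then show ?thesis using cyclic_factor[OF dG d(2)] len by (simp add: U_def nth_append)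
    qed
    show "U i \<subseteq> carrier G" using qG dG by (simp add: U_def)
    show "x \<in> generate G {if i = ?n then d else c}"
      if x: "x \<in> generate G (U i)" "\<And>u. u \<in> U i \<Longrightarrow> x \<otimes> u = u \<otimes> x" for x
      using i
    proof
      assume "i < ?n"
      then show ?thesis using cent[of i x] x by (simp add: U_def)
    next
      assume "i = ?n"
      then show ?thesis using x(1) by (simp add: U_def)
    qed
    fix j u v
    assume "j < length (Fs @ [cyclic_presented (2 ^ Suc k)])" "i \<noteq> j" and uv: "u \<in> U i" "v \<in> U j"
    then have j: "j < ?n \<or> j = ?n" using len by auto
    have UG: "u \<in> carrier G" "v \<in> carrier G" using uv qG dG by (auto simp: U_def split: if_splits)
    consider "i = ?n" | "j = ?n" | "i < ?n" "j < ?n" using i j by blast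
    then show "u \<otimes> v = v \<otimes> u"
    proof cases
      case 1
      then show ?thesis using uv UG center_commute[OF d(1)] by (simp add: U_def)
    next
      case 2
      then show ?thesis using uv UG center_commute[OF d(1)] by (simp add: U_def)
    next
      case 3
      then show ?thesis using commuting_pairs_nth[OF qs(2) 3 \<open>i \<noteq> j\<close>] uv by (simp add: U_def) blast
    qed
  next
    let ?l = "length (Fs @ [cyclic_presented (2 ^ Suc k)])"
    have un: "(\<Union>i<?l. U i) = insert d (pair_elements qs)"
      using len by (auto simp: pair_elements_nth U_def lessThan_Suc)
    show "carrier G = generate G ((\<Union>i<?l. U i) \<union> \<omega> ` carrier A)"
      unfolding un
    proof (rule generate_insert_center[OF qs(1,3)])
      show "pair_elements qs \<subseteq> generate G (insert d (pair_elements qs) \<union> \<omega> ` carrier A)"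
        by (auto intro: generate.incl)
      show "group_center G \<subseteq> generate G (insert d (pair_elements qs) \<union> \<omega> ` carrier A)"
        using gen mono_generate[of "insert d (\<omega> ` carrier A)" "insert d (pair_elements qs) \<union> \<omega> ` carrier A"]
        by blast
      show "insert d (pair_elements qs) \<union> \<omega> ` carrier A \<subseteq> carrier G" using dG qs(1) \<omega>G by blast
    qed
  qed (use dG cd A \<omega> in auto)
qed

text \<open>Family (i). The first pair satisfies a^2 = d, so its group already contains d and has
  center <d>; it takes the exceptional index t = 0, and no cyclic factor is appended.\<close>

lemma M2_pairs_iso:
  fixes A :: "('q, 'r) monoid_scheme"
  assumes qs: "pair_elements (p # ps) \<subseteq> carrier G" "sorted_wrt commuting_pairs (p # ps)"
      "carrier G = generate G (pair_elements (p # ps) \<union> group_center G)"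
    and ps: "\<And>q. q \<in> set ps \<Longrightarrow> D8_pair (fst q) (snd q)"
    and p: "fst p \<otimes> snd p \<noteq> snd p \<otimes> fst p" "fst p \<otimes> fst p = d" "snd p \<otimes> snd p = \<one>"
    and d: "d \<in> group_center G" "d [^] (2 ^ k :: nat) = c"
    and A: "group A" and \<omega>: "\<omega> \<in> hom A G" "\<And>a. a \<in> carrier A \<Longrightarrow> \<omega> a \<in> group_center G"
      "\<And>a. a \<in> carrier A \<Longrightarrow> \<omega> a \<in> generate G {d} \<Longrightarrow> a = \<one>\<^bsub>A\<^esub>"
    and gen: "group_center G \<subseteq> generate G (insert d (\<omega> ` carrier A))"
  shows "G \<cong> central_product (M2_group (Suc k + 1) 1 # replicate (length ps) D8_group) \<times>\<times> A"
proof -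
  let ?qs = "p # ps"
  let ?Fs = "M2_group (Suc k + 1) 1 # replicate (length ps) D8_group"
  define U where "U = (\<lambda>i. {fst (?qs ! i), snd (?qs ! i)})"
  have len: "length ?Fs = length ?qs" by simp
  have dG: "d \<in> carrier G" using d(1) by (rule center_in_carrier)
  have qG: "U i \<subseteq> carrier G" if "i < length ?qs" for i
    using qs(1) that unfolding pair_elements_nth U_def by blast
  have \<omega>G: "\<omega> ` carrier A \<subseteq> carrier G" using \<omega>(2) center_in_carrier by blast
  have cd: "c \<in> generate G {d}"
    using d(2) generate_pow[OF dG] by (auto simp flip: int_pow_int)
  have pG: "fst p \<in> carrier G" "snd p \<in> carrier G" using qG[of 0] by (auto simp: U_def)
  \<comment> \<open>a^(2^(k + 1)) = d^(2^k) = c, which fixes the parameter of the factor as M_2(k +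
    2, 1).\<close>
  have "fst p [^] (2 ^ Suc k :: nat) = (fst p [^] (2::nat)) [^] (2 ^ k :: nat)"
    using pG by (simp add: nat_pow_pow)
  then have pow: "fst p [^] (2 ^ Suc k :: nat) = c"
    using p(2) d(2) pG by (simp add: numeral_2_eq_2)
  have psG: "fst (ps ! i) \<in> carrier G" "snd (ps ! i) \<in> carrier G" "D8_pair (fst (ps ! i)) (snd (ps ! i))"
    if "i < length ps" for i
    using qG[of "Suc i"] that ps by (auto simp: U_def)
  show ?thesis
  proof (rule central_product_iso[where U = U and t = 0 and d = d and \<omega> = \<omega>])
    fix i assume i: "i < length ?Fs"
    show "\<exists>\<phi>. factor (?Fs ! i) \<phi> (U i)"
    proof (cases i)
      case 0
      then show ?thesis using M2_factor(1)[OF pG p(1,3) pow] by (simp add: U_def)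
    next
      case (Suc j)
      then show ?thesis using D8_factor(1)[OF psG] i by (simp add: U_def)
    qed
    show "U i \<subseteq> carrier G" using qG i by simp
    show "x \<in> generate G {if i = 0 then d else c}"
      if x: "x \<in> generate G (U i)" "\<And>u. u \<in> U i \<Longrightarrow> x \<otimes> u = u \<otimes> x" for x
    proof (cases i)
      case 0
      then show ?thesis using M2_factor(2)[OF pG p(1,3) pow, of x] x p(2) by (simp add: U_def)
    next
      case (Suc j)
      then show ?thesis using D8_factor(2)[OF psG, of j x] i x by (simp add: U_def)
    qed
    fix j u v
    assume "j < length ?Fs" "i \<noteq> j" "u \<in> U i" "v \<in> U j"
    then show "u \<otimes> v = v \<otimes> u"
      using commuting_pairs_nth[OF qs(2), of i j] i len unfolding U_def by metis
  next
    have un: "(\<Union>i<length ?Fs. U i) = pair_elements ?qs"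
      unfolding len pair_elements_nth U_def ..
    let ?T = "pair_elements ?qs \<union> \<omega> ` carrier A"
    have T: "?T \<subseteq> carrier G" using qs(1) \<omega>G by blast
    have incl: "x \<in> generate G ?T" if "x \<in> pair_elements ?qs \<or> x \<in> \<omega> ` carrier A" for x
      using that by (blast intro: generate.incl)
    have "fst p \<in> generate G ?T" by (rule incl) simp
    then have "d \<in> generate G ?T" using p(2) generate.eng by metis
    then have "generate G (insert d (\<omega> ` carrier A)) \<subseteq> generate G ?T"
      using incl by (intro generate_subgroup_incl[OF _ generate_is_subgroup[OF T]]) blast
    then show "carrier G = generate G ((\<Union>i<length ?Fs. U i) \<union> \<omega> ` carrier A)"
      unfolding un using gen incl by (intro generate_insert_center[OF qs(1,3) _ _ T]) blast+
  qed (use dG cd A \<omega> in auto)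
qed

end

subsection \<open>The classification\<close>

context group
begin

lemma generate_singleton_one:
  assumes "x \<in> carrier G" "x \<otimes> x = \<one>"
  shows "generate G {x} \<subseteq> {\<one>, x}"
proof (rule generate_subgroup_incl)
  have "inv x = x" using assms by (intro inv_equality)
  then show "subgroup {\<one>, x} G" using assms by (intro subgroupI) auto
qed simp

lemma commute_or_of_derived:
  assumes c: "c \<in> group_center G" "c \<otimes> c = \<one>" "derived G (carrier G) \<subseteq> generate G {c}"
    and xy: "x \<in> carrier G" "y \<in> carrier G"
  shows "x \<otimes> y = y \<otimes> x \<or> x \<otimes> y = y \<otimes> x \<otimes> c"
proof -
  have cG: "c \<in> carrier G" using c(1) by (simp add: group_center_def)
  have "x \<otimes> y \<otimes> inv x \<otimes> inv y \<in> derived G (carrier G)"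
    unfolding derived_def using xy by (blast intro: generate.incl)
  then have "x \<otimes> y \<otimes> inv x \<otimes> inv y \<in> {\<one>, c}" using c(3) generate_singleton_one[OF cG c(2)] by blast
  moreover have "x \<otimes> y = (x \<otimes> y \<otimes> inv x \<otimes> inv y) \<otimes> (y \<otimes> x)"
    using xy by (simp add: m_assoc inv_mult_group[symmetric])
  moreover have "c \<otimes> (y \<otimes> x) = y \<otimes> x \<otimes> c" using c(1) xy by (simp add: group_center_def)
  ultimately show ?thesis using xy by fastforce
qed

lemma square_mem_of_elementary_abelian:
  assumes N: "subgroup N G" "N \<subseteq> group_center G" "elementary_abelian 2 (G Mod N)"
    and x: "x \<in> carrier G"
  shows "x \<otimes> x \<in> N"
proof -
  have NG: "N \<subseteq> carrier G" using N(1) by (rule subgroup.subset)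
  have "N #> g = g <# N" if "g \<in> carrier G" for g
    using N(2) that by (force simp: r_coset_def l_coset_def group_center_def)
  then interpret N: normal N G using N(1) by (intro normalI) auto
  have "N #> x \<in> carrier (G Mod N)" using x by (auto simp: FactGroup_def RCOSETS_def)
  then have "(N #> x) [^]\<^bsub>G Mod N\<^esub> (2::nat) = \<one>\<^bsub>G Mod N\<^esub>"
    using N(3) by (simp add: elementary_abelian_def)
  then have "N #> (x [^] (2::nat)) = N"
    using x by (simp add: N.FactGroup_pow)
  moreover have "x \<otimes> x \<in> N #> (x \<otimes> x)" using rcos_self[OF _ N(1), of "x \<otimes> x"] x by simp
  ultimately show ?thesis using x by (simp add: numeral_2_eq_2)
qed

text \<open>If c = d^j, then 2^(k + 1) divides 2 j, so c is a power of the element d^(2^k) of square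
  1, with odd exponent because c is not 1.\<close>

lemma involution_in_cyclic:
  assumes d: "d \<in> carrier G" "ord d = 2 ^ Suc k"
    and c: "c \<in> generate G {d}" "c \<noteq> \<one>" "c \<otimes> c = \<one>"
  shows "d [^] (2 ^ k :: nat) = c"
proof -
  obtain j :: int where j: "c = d [^] j" using c(1) generate_pow[OF d(1)] by blast
  have "d [^] (2 * j) = \<one>" using c(3) j int_pow_mult[OF d(1), of j j] by simp
  then have "2 ^ Suc k dvd 2 * j" using int_pow_eq_id[OF d(1), of "2 * j"] d(2) by simp
  then obtain i where i: "j = 2 ^ k * i" by auto
  let ?w = "d [^] (2 ^ k :: int)"
  have ww: "?w \<otimes> ?w = \<one>"
    using d int_pow_eq_id[OF d(1), of "2 ^ Suc k"] by (simp flip: int_pow_mult)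
  have pow: "c = ?w [^] i" using j d(1) by (simp add: i int_pow_pow)
  have even_pow: "?w [^] (2 * l) = \<one>" for l :: int
  proof -
    have "?w [^] (2 * l) = (?w [^] (2::int)) [^] l" using d(1) by (simp add: int_pow_pow mult.assoc)
    also have "?w [^] (2::int) = \<one>" using int_pow_mult[of ?w 1 1] ww d(1) by simp
    finally show ?thesis by simp
  qed
  have "odd i"
  proof
    assume "even i"
    then show False using pow even_pow c(2) by (auto elim: evenE)
  qed
  then obtain l where "i = 2 * l + 1" by (rule oddE)
  then have "c = ?w" using pow even_pow[of l] d(1) by (simp add: int_pow_mult)
  then show ?thesis by (simp flip: int_pow_int)
qed

text \<open>Modulo squares of central elements <u^2> vanishes and <d> leaves the classes of 1 and d;
  these are closed under products because d^2 is such a square.\<close>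

lemma square_classes_of_generated:
  assumes u: "u \<in> group_center G" and d: "d \<in> group_center G"
    and x: "x \<in> generate G (generate G {u \<otimes> u} \<union> generate G {d})"
  shows "\<exists>v\<in>group_center G. x = v \<otimes> v \<or> x = v \<otimes> v \<otimes> d"
proof -
  have CG: "v \<in> carrier G" if "v \<in> group_center G" for v using that by (simp add: group_center_def)
  have C: "subgroup (group_center G) G" by (rule subgroup_center)
  have powC: "v [^] (i::int) \<in> group_center G" if "v \<in> group_center G" for v i
    using subgroup_int_pow_closed[OF C that] .
  have comm: "v \<otimes> w = w \<otimes> v" if "v \<in> group_center G" "w \<in> group_center G" for v w
    using that unfolding group_center_def by blast
  have base: "\<exists>v\<in>group_center G. x = v \<otimes> v \<or> x = v \<otimes> v \<otimes> d"
    if "x \<in> generate G {u \<otimes> u} \<union> generate G {d}" for x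
    using that
  proof
    assume "x \<in> generate G {u \<otimes> u}"
    then obtain i :: int where "x = (u \<otimes> u) [^] i"
      using generate_pow[of "u \<otimes> u"] CG[OF u] by auto
    then have "x = u [^] i \<otimes> u [^] i" using CG[OF u] by (simp add: int_pow_mult_distrib)
    then show ?thesis using powC[OF u] by blast
  next
    assume "x \<in> generate G {d}"
    then obtain i :: int where i: "x = d [^] i" using generate_pow[OF CG[OF d]] by auto
    have "i = i div 2 + i div 2 \<or> i = i div 2 + i div 2 + 1" by presburger
    then have "x = d [^] (i div 2) \<otimes> d [^] (i div 2) \<or> x = d [^] (i div 2) \<otimes> d [^] (i div 2) \<otimes> d"
      using i CG[OF d] by (metis int_pow_mult int_pow_1)
    then show ?thesis using powC[OF d] by blast
  qed
  show ?thesis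
    using x
  proof (induction rule: generate.induct)
    case one
    show ?case using subgroup.one_closed[OF C] by (intro bexI[of _ \<one>]) auto
  next
    case (incl x)
    then show ?case by (rule base)
  next
    case (inv x)
    have "subgroup (generate G {u \<otimes> u}) G" "subgroup (generate G {d}) G"
      using CG u d by (auto intro: generate_is_subgroup)
    then have "inv x \<in> generate G {u \<otimes> u} \<union> generate G {d}"
      using inv subgroup.m_inv_closed by fast
    then show ?case by (rule base)
  next
    case (eng x y)
    then obtain v w where v: "v \<in> group_center G" "x = v \<otimes> v \<or> x = v \<otimes> v \<otimes> d"
      and w: "w \<in> group_center G" "y = w \<otimes> w \<or> y = w \<otimes> w \<otimes> d" by blast
    have m: "p \<otimes> q \<in> group_center G" if "p \<in> group_center G" "q \<in> group_center G" for p q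
      using subgroup.m_closed[OF C that] .
    have lc: "p \<otimes> (q \<otimes> s) = q \<otimes> (p \<otimes> s)"
      if "p \<in> group_center G" "q \<in> group_center G" "s \<in> group_center G" for p q s
      using comm[OF that(1,2)] that by (simp add: m_assoc[symmetric] CG)
    note ac = m_assoc comm lc m CG
    consider "x = v \<otimes> v" "y = w \<otimes> w" | "x = v \<otimes> v \<otimes> d" "y = w \<otimes> w"
      | "x = v \<otimes> v" "y = w \<otimes> w \<otimes> d" | "x = v \<otimes> v \<otimes> d" "y = w \<otimes> w \<otimes> d" using v w by blast
    then show ?case
    proof cases
      case 1
      then have "x \<otimes> y = (v \<otimes> w) \<otimes> (v \<otimes> w)" using v(1) w(1) d by (simp add: ac)
      then show ?thesis using m v w by blast
    next
      case 2
      then have "x \<otimes> y = (v \<otimes> w) \<otimes> (v \<otimes> w) \<otimes> d" using v(1) w(1) d by (simp add: ac)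
      then show ?thesis using m v w by blast
    next
      case 3
      then have "x \<otimes> y = (v \<otimes> w) \<otimes> (v \<otimes> w) \<otimes> d" using v(1) w(1) d by (simp add: ac)
      then show ?thesis using m v w by blast
    next
      case 4
      then have "x \<otimes> y = (v \<otimes> w \<otimes> d) \<otimes> (v \<otimes> w \<otimes> d)" using v(1) w(1) d by (simp add: ac)
      then show ?thesis using m v w d by blast
    qed
  qed
qed

end

theorem theorem3p12:
  fixes G :: "('a, 'b) monoid_scheme" (structure)
    and N :: "'a set" and c :: 'a and z :: "nat \<Rightarrow> 'a" and n m r :: nat
  assumes nm: "n \<ge> m" "m \<ge> 1"
    and G: "group G" "finite (carrier G)" "\<exists>e. order G = 2 ^ e" "\<not> comm_group G"
    and N: "subgroup N G" "N \<subseteq> group_center G"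
      "G\<lparr>carrier := N\<rparr> \<cong> integer_mod_group (2 ^ n) \<times>\<times> integer_mod_group (2 ^ m)"
    and quot: "elementary_abelian 2 (G Mod N)"
    and derived: "c \<in> carrier G" "group.ord G c = 2" "derived G (carrier G) = generate G {c}"
    and r: "r \<ge> 2"
    and z: "\<And>i. i \<in> {1..r} \<Longrightarrow> z i \<in> carrier G"
      "group.ord G (z 1) = 2 ^ (n + 1)" "group.ord G (z 2) = 2 ^ m"
      "\<And>i. i \<in> {3..r} \<Longrightarrow> group.ord G (z i) = 2"
    and center: "internal_direct_product G (group_center G) (map (\<lambda>i. generate G {z i}) [1..<r + 1])"
      "G\<lparr>carrier := group_center G\<rparr> \<cong>
         integer_mod_group (2 ^ (n + 1)) \<times>\<times> integer_mod_group (2 ^ m) \<times>\<times> cyclic_power 2 (r - 2)"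
    and N_eq: "internal_direct_product G N [generate G {z 1 [^] (2::nat)}, generate G {z 2}]"
    and c: "c \<in> generate G {z 2}"
  shows
    "(\<exists>k\<ge>1. G \<cong> central_product (M2_group (m + 1) 1 # replicate (k - 1) D8_group)
         \<times>\<times> integer_mod_group (2 ^ (n + 1)) \<times>\<times> cyclic_power 2 (r - 2)) \<or>
     (\<exists>k\<ge>2. G \<cong> central_product (M2_group (m + 1) 1 # Q8_group # replicate (k - 2) D8_group)
         \<times>\<times> integer_mod_group (2 ^ (n + 1)) \<times>\<times> cyclic_power 2 (r - 2)) \<or>
     (\<exists>k\<ge>1. G \<cong> central_product (replicate k D8_group @ [cyclic_presented (2 ^ m)])
         \<times>\<times> integer_mod_group (2 ^ (n + 1)) \<times>\<times> cyclic_power 2 (r - 2)) \<or>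
     (\<exists>k\<ge>1. G \<cong> central_product (Q8_group # replicate (k - 1) D8_group @ [cyclic_presented (2 ^ m)])
         \<times>\<times> integer_mod_group (2 ^ (n + 1)) \<times>\<times> cyclic_power 2 (r - 2))"
proof -
  interpret group G by (rule G(1))
  \<comment> \<open>With m = k + 1 the element \<open>z 2\<close> has order 2^(k + 1), and its power
    with exponent 2^k is the involution c.\<close>
  obtain k where m: "m = Suc k" using nm(2) by (cases m) auto
  define s where "s = r - 2"
  have r_eq: "r = Suc (Suc s)" using r by (simp add: s_def)
  \<comment> \<open>Indices are shifted to start at 0: \<open>y 0\<close> is \<open>z 1\<close>, and
    \<open>y 1\<close> is d.\<close>
  define y where "y = (\<lambda>i. z (Suc i))"
  define d where "d = z 2"
  have y1: "y 1 = d" by (simp add: y_def d_def numeral_2_eq_2)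
  have yG: "y i \<in> carrier G" if "i < r" for i using z(1)[of "Suc i"] that by (simp add: y_def)
  let ?As = "map (\<lambda>i. generate G {y i}) [0..<r]"
  have As: "map (\<lambda>i. generate G {z i}) [1..<r + 1] = ?As"
    unfolding y_def using map_Suc_upt[of 0 r] by (metis (no_types, lifting) One_nat_def Suc_eq_plus1 list.map_comp comp_apply map_eq_conv)
  have idp: "internal_direct_product G (group_center G) ?As" using center(1) unfolding As .
  have center_gen: "group_center G = generate G (\<Union>i<r. generate G {y i})"
  proof -
    have "\<Union>(set ?As) = (\<Union>i<r. generate G {y i})" by (auto simp: atLeast0LessThan)
    then show ?thesis using idp by (simp add: internal_direct_product_def)
  qed
  have yC: "y i \<in> group_center G" if "i < r" for i
    unfolding center_gen using that by (blast intro: generate.incl)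
  have indep: "generate G {y i} \<inter> generate G (\<Union>j\<in>{..<r} - {i}. generate G {y j}) = {\<one>}" if "i < r" for i
  proof -
    have "(\<Union>j\<in>{..<length ?As} - {i}. ?As ! j) = (\<Union>j\<in>{..<r} - {i}. generate G {y j})" by auto
    moreover have "?As ! i \<inter> generate G (\<Union>j\<in>{..<length ?As} - {i}. ?As ! j) = {\<one>}"
      using idp that unfolding internal_direct_product_def by simp
    ultimately show ?thesis using that by simp
  qed
  have dC: "d \<in> group_center G" and dG: "d \<in> carrier G" using yC[of 1] yG[of 1] r_eq y1 by auto
  have c_ne: "c \<noteq> \<one>" using derived(2) by auto
  have c_sq: "c \<otimes> c = \<one>" using pow_ord_eq_1[OF derived(1)] derived(1,2) by (simp add: numeral_2_eq_2)
  have cd: "c \<in> generate G {d}" using c by (simp add: d_def)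
  have "generate G {d} \<subseteq> group_center G"
    using dC by (intro generate_subgroup_incl[OF _ subgroup_center]) auto
  then have cC: "c \<in> group_center G" using cd by blast
  have pow: "d [^] (2 ^ k :: nat) = c"
    using z(3) by (intro involution_in_cyclic[OF dG _ cd c_ne c_sq]) (simp add: d_def m)
  have "z 1 \<in> carrier G" "z 1 \<in> group_center G" using yC[of 0] yG[of 0] r_eq by (auto simp: y_def)
  moreover have "N = generate G (generate G {z 1 \<otimes> z 1} \<union> generate G {d})"
    using N_eq calculation by (simp add: internal_direct_product_def d_def numeral_2_eq_2)
  \<comment> \<open>Squares lie in N because G / N is elementary abelian, and N is generated by
    \<open>z 1 \<otimes> z 1\<close> and d.\<close>
  ultimately have sq: "\<exists>u\<in>group_center G. x \<otimes> x = u \<otimes> u \<or> x \<otimes> x = u \<otimes> u \<otimes> d" if "x \<in> carrier G" for x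
    using square_classes_of_generated[OF _ dC] square_mem_of_elementary_abelian[OF N(1,2) quot that] by blast
  interpret square_classes G c d
  proof
    show "x \<otimes> y = y \<otimes> x \<or> x \<otimes> y = y \<otimes> x \<otimes> c" if "x \<in> carrier G" "y \<in> carrier G" for x y
      using commute_or_of_derived[OF cC c_sq _ that] derived(3) by simp
    show "c \<otimes> x = x \<otimes> c" if "x \<in> carrier G" for x using cC that by (simp add: group_center_def)
  qed (use derived(1) c_sq c_ne dC sq in auto)
  \<comment> \<open>For m = 1 the involution c of <d> is d itself; for m > 1 it is the square of
    d^(2^(m - 2)).\<close>
  have dc: "d = c \<or> (\<exists>v\<in>group_center G. c = v \<otimes> v)"
  proof (cases k)
    case 0
    then show ?thesis using pow dG by simp
  next
    case (Suc l)
    then have "c = d [^] (2 ^ l :: nat) \<otimes> d [^] (2 ^ l :: nat)" using pow dG by (simp add: nat_pow_mult mult_2)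
    moreover have "d [^] (2 ^ l :: nat) \<in> group_center G"
      using subgroup_int_pow_closed[OF subgroup_center dC, of "int (2 ^ l)"] by (simp only: int_pow_int)
    ultimately show ?thesis by blast
  qed
  have nonab: "\<exists>a\<in>carrier G. \<exists>b\<in>carrier G. a \<otimes> b \<noteq> b \<otimes> a"
    using G(4) group_comm_groupI by blast
  let ?A = "integer_mod_group (2 ^ (n + 1)) \<times>\<times> cyclic_power 2 s"
  have q: "(2 ^ (n + 1) :: nat) > 1" by (rule one_less_power) auto
  have ord0: "ord (y 0) = 2 ^ (n + 1)" using z(2) by (simp add: y_def)
  have ord2: "ord (y (Suc (Suc i))) = 2" if "i < s" for i
    using z(4)[of "Suc (Suc (Suc i))"] that by (simp add: y_def r_eq)
  obtain \<omega> where A: "group ?A" and \<omega>: "\<omega> \<in> hom ?A G" "\<And>a. a \<in> carrier ?A \<Longrightarrow> \<omega> a \<in> group_center G"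
    "\<And>a. a \<in> carrier ?A \<Longrightarrow> \<omega> a \<in> generate G {d} \<Longrightarrow> a = \<one>\<^bsub>?A\<^esub>"
    "y 0 \<in> \<omega> ` carrier ?A" "\<And>i. i < s \<Longrightarrow> y (Suc (Suc i)) \<in> \<omega> ` carrier ?A"
    using center_complement[of s y "2 ^ (n + 1)", OF yC[unfolded r_eq] indep[unfolded r_eq] ord0 q ord2]
    unfolding y1 by metis
  have gen: "group_center G \<subseteq> generate G (insert d (\<omega> ` carrier ?A))"
  proof -
    have T: "insert d (\<omega> ` carrier ?A) \<subseteq> carrier G" using dG \<omega>(2) center_in_carrier by blast
    have "y i \<in> insert d (\<omega> ` carrier ?A)" if i: "i < r" for i
    proof -
      consider "i = 0" | "i = 1" | j where "i = Suc (Suc j)" "j < s"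
        using i r_eq by (metis One_nat_def Suc_less_eq not0_implies_Suc)
      then show ?thesis using \<omega>(4,5) y1 by cases auto
    qed
    then have "generate G {y i} \<subseteq> generate G (insert d (\<omega> ` carrier ?A))" if "i < r" for i
      using that by (intro mono_generate) auto
    then show ?thesis
      unfolding center_gen by (intro generate_subgroup_incl[OF _ generate_is_subgroup[OF T]]) blast
  qed
  obtain p ps where p: "pair_elements (p # ps) \<subseteq> carrier G" "sorted_wrt commuting_pairs (p # ps)"
    "carrier G = generate G (pair_elements (p # ps) \<union> group_center G)"
    and D8: "\<And>q. q \<in> set ps \<Longrightarrow> D8_pair (fst q) (snd q)"
    and last: "D8_pair (fst p) (snd p) \<or> last_pair (fst p) (snd p)"
    by (rule pair_decomposition[OF G(2) dc nonab]) (rule that)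
  have pG: "fst p \<in> carrier G" "snd p \<in> carrier G"
    and psG: "\<And>q. q \<in> set ps \<Longrightarrow> fst q \<in> carrier G \<and> snd q \<in> carrier G" using p(1) by auto
  \<comment> \<open>Families (iii) and (iv) together: \<open>F\<close> will be D_8 or Q_8, and all
    other pairs give D_8.\<close>
  have cyclic: "G \<cong> central_product ((F # replicate (length ps) D8_group) @ [cyclic_presented (2 ^ m)]) \<times>\<times> ?A"
    if F: "\<exists>\<phi>. factor F \<phi> {fst p, snd p}"
      "\<And>x. x \<in> generate G {fst p, snd p} \<Longrightarrow> x \<otimes> fst p = fst p \<otimes> x \<Longrightarrow> x \<otimes> snd p = snd p \<otimes> x \<Longrightarrow>
        x \<in> generate G {c}" for F :: "nat gword set monoid"
    unfolding m
  proof (rule pairs_with_cyclic_iso[OF _ p _ _ dC pow A \<omega>(1-3) gen])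
    fix i assume i: "i < length (p # ps)"
    have ps: "fst (ps ! j) \<in> carrier G" "snd (ps ! j) \<in> carrier G" "D8_pair (fst (ps ! j)) (snd (ps ! j))"
      if "i = Suc j" for j
      using D8[of "ps ! j"] psG[of "ps ! j"] i that by auto
    show "\<exists>\<phi>. factor ((F # replicate (length ps) D8_group) ! i) \<phi> {fst ((p # ps) ! i), snd ((p # ps) ! i)}"
      using F(1) D8_factor(1)[OF ps] i by (cases i) auto
    show "x \<in> generate G {c}"
      if "x \<in> generate G {fst ((p # ps) ! i), snd ((p # ps) ! i)}"
        "x \<otimes> fst ((p # ps) ! i) = fst ((p # ps) ! i) \<otimes> x" "x \<otimes> snd ((p # ps) ! i) = snd ((p # ps) ! i) \<otimes> x" for x
    proof (cases i)
      case 0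
      then show ?thesis using F(2)[of x] that by simp
    next
      case (Suc j)
      then show ?thesis using D8_factor(2)[OF ps[OF Suc], of x] that by simp
    qed
  qed simp
  \<comment> \<open>A last pair with b^2 = 1 falls under M_2 for every m; for m = 1 its group M_2(2,
    1) is D_8. The case \<open>Q8\<close> is the alternative with d = c. In each family the number k
    of pairs is \<open>Suc (length ps)\<close>.\<close>
  consider (D8) "D8_pair (fst p) (snd p)"
    | (M2) "fst p \<otimes> snd p \<noteq> snd p \<otimes> fst p" "fst p \<otimes> fst p = d" "snd p \<otimes> snd p = \<one>"
    | (Q8) "fst p \<otimes> snd p \<noteq> snd p \<otimes> fst p" "fst p \<otimes> fst p = c" "snd p \<otimes> snd p = c"
    using last unfolding last_pair_def by metis
  then show ?thesis
  proof cases
    case D8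
    have "G \<cong> central_product ((D8_group # replicate (length ps) D8_group) @ [cyclic_presented (2 ^ m)]) \<times>\<times> ?A"
      by (rule cyclic) (fact D8_factor[OF pG D8])+
    then have "G \<cong> central_product (replicate (Suc (length ps)) D8_group @ [cyclic_presented (2 ^ m)]) \<times>\<times> ?A"
      by (simp only: replicate_Suc)
    then show ?thesis unfolding s_def by (metis le_add1 plus_1_eq_Suc)
  next
    case M2
    have "G \<cong> central_product (M2_group (m + 1) 1 # replicate (Suc (length ps) - 1) D8_group) \<times>\<times> ?A"
      using M2_pairs_iso[OF p D8 M2 dC pow A \<omega>(1-3) gen] by (simp add: m)
    then show ?thesis unfolding s_def by (metis le_add1 plus_1_eq_Suc)
  next
    case Q8
    have "G \<cong> central_product ((Q8_group # replicate (length ps) D8_group) @ [cyclic_presented (2 ^ m)]) \<times>\<times> ?A"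
      by (rule cyclic) (fact Q8_factor[OF pG Q8])+
    then have "G \<cong> central_product (Q8_group # replicate (Suc (length ps) - 1) D8_group @ [cyclic_presented (2 ^ m)]) \<times>\<times> ?A"
      by (simp only: append_Cons diff_Suc_1)
    then show ?thesis unfolding s_def by (metis le_add1 plus_1_eq_Suc)
  qed
qed

end
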